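(* Let $(X_0,X_1)$ be an interpolation couple of two K\"othe function spaces such that $M_{X_0}$ and $M_{X_1}$ are not equivalent, and let $0<\theta<1$. Assume that $X_\theta=(X_0,X_1)_\theta$ is reflexive, that it is self-similar in the sense that $M_W\sim M_{X_\theta}$ for every infinite dimensional subspace $W\subset X_\theta$ generated by a disjoint sequence, and that $M_{X_\theta}\sim M_{X_0}^{1-\theta}M_{X_1}^{\theta}$. Then the induced centralizer $\Omega_\theta$ on $X_\theta$ is disjointly singular.
   Context: Scalars are complex. A K\"othe function space $X$ over a ($\sigma$-finite) measure space is a Banach space of classes of measurable functions, contained in the space $L_0$ of all measurable functions, such that $|f|\le|g|$, $f\in L_0$, $g\in X$ imply $f\in X$, $\|f\|\le\|g\|$. A subspace generated by a disjoint sequence is the closed linear span of a sequence of nonzero vectors with pairwise disjoint supports. For such $X$ (or such subspaces) $M_X(n)=\sup\{\|x_1+\dots+x_n\|:x_1,\dots,x_n\text{ pairwise disjointly supported in the unit ball of }X\}$. $f\sim g$ ("equivalent") means $0<\liminf f(n)/g(n)\le\limsup f(n)/g(n)<\infty$. Complex interpolation: let $\mathbb S=\{z\in\mathbb C:0\le\mathrm{Re}\,z\le1\}$, $\Sigma=X_0+X_1$; $\mathcal H$ is the Banach space of functions $g:\mathbb S\to\Sigma$ which are $\Sigma$-bounded, $\Sigma$-continuous on $\mathbb S$, analytic in the interior, with $t\mapsto g(j+it)\in X_j$ bounded and continuous for $j=0,1$, normed by $\sup\{\|g(j+it)\|_{X_j}\}$. $X_\theta=\{g(\theta):g\in\mathcal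 H\}$ with the quotient norm. The induced centralizer is $\Omega_\theta(x)=B_\theta(x)'(\theta)\in L_0$, where $B_\theta:X_\theta\to\mathcal H$ is a homogeneous map with $B_\theta(x)(\theta)=x$, $\|B_\theta(x)\|_{\mathcal H}\le C\|x\|$, chosen so that $B_\theta(ux)=uB_\theta(x)$ for every measurable $u$ with values in $\{-1,1\}$, and $\mathrm{supp}\,B_\theta(x)(z)\subset\mathrm{supp}\,x$. Different choices change $\Omega_\theta$ by a bounded map $X_\theta\to X_\theta$. $\Omega:X\to L_0$ is trivial on a subspace $W$ if there are a linear map $\ell:W\to L_0$ and a constant $C$ with $\Omega x-\ell x\in X$, $\|\Omega x-\ell x\|\le C\|x\|$ for all $x\in W$; it is disjointly singular if it is not trivial on any infinite dimensional subspace generated by a disjoint sequence. *)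

theory Defs
  imports "HOL-Analysis.Analysis"
begin

text \<open>
  The space \<open>L\<^sub>0\<close> is handled through representatives: its elements are the functions in
  \<open>borel_measurable M\<close>, two of them being identified when they agree almost everywhere.
  So the \<open>nrm\<close> component of a space below is only a seminorm on functions, and maps between
  such spaces are required to respect almost everywhere equality. The value of \<open>nrm\<close> outside
  \<open>elems\<close> is irrelevant.
\<close>

record 'b fspace =
  elems :: "('b \<Rightarrow> complex) set"
  nrm :: "('b \<Rightarrow> complex) \<Rightarrow> real"

definition seminormed :: "'b fspace \<Rightarrow> bool" where
  "seminormed X \<longleftrightarrow>
     (\<lambda>_. 0) \<in> elems X \<and>
     (\<forall>f\<in>elems X. \<forall>g\<in>elems X. (\<lambda>t. f t + g t) \<in> elems X \<and>
        nrm X (\<lambda>t. f t + g t) \<le> nrm X f + nrm X g) \<and>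
     (\<forall>c. \<forall>f\<in>elems X. (\<lambda>t. c * f t) \<in> elems X \<and> nrm X (\<lambda>t. c * f t) = cmod c * nrm X f) \<and>
     (\<forall>f\<in>elems X. 0 \<le> nrm X f)"

definition norm_complete :: "'b fspace \<Rightarrow> bool" where
  "norm_complete X \<longleftrightarrow>
     (\<forall>f::nat \<Rightarrow> 'b \<Rightarrow> complex.
        (\<forall>n. f n \<in> elems X) \<longrightarrow>
        (\<forall>\<epsilon>>0. \<exists>N. \<forall>m\<ge>N. \<forall>n\<ge>N. nrm X (\<lambda>t. f m t - f n t) < \<epsilon>) \<longrightarrow>
        (\<exists>l\<in>elems X. (\<lambda>n. nrm X (\<lambda>t. f n t - l t)) \<longlonglongrightarrow> 0))"

definition kothe_space :: "'a measure \<Rightarrow> 'a fspace \<Rightarrow> bool" where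
  "kothe_space M X \<longleftrightarrow>
     elems X \<subseteq> borel_measurable M \<and>
     seminormed X \<and>
     (\<forall>f\<in>elems X. nrm X f = 0 \<longleftrightarrow> (AE t in M. f t = 0)) \<and>
     norm_complete X \<and>
     (\<forall>f\<in>borel_measurable M. \<forall>g\<in>elems X.
        (AE t in M. cmod (f t) \<le> cmod (g t)) \<longrightarrow> f \<in> elems X \<and> nrm X f \<le> nrm X g)"


text \<open>
  The dual consists of functionals on \<open>elems X\<close>, extended by \<open>0\<close> so that pointwise equality
  is equality of functionals. A bounded linear functional automatically respects almost
  everywhere equality.
\<close>

definition dual_space :: "'b fspace \<Rightarrow> ('b \<Rightarrow> complex) fspace" where
  "dual_space X =
     \<lparr>elems = {\<phi>.
        (\<forall>f\<in>elems X. \<forall>g\<in>elems X. \<phi> (\<lambda>t. f t + g t) = \<phi> f + \<phi> g) \<and>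
        (\<forall>c. \<forall>f\<in>elems X. \<phi> (\<lambda>t. c * f t) = c * \<phi> f) \<and>
        (\<exists>C. \<forall>f\<in>elems X. cmod (\<phi> f) \<le> C * nrm X f) \<and>
        (\<forall>f. f \<notin> elems X \<longrightarrow> \<phi> f = 0)},
      nrm = (\<lambda>\<phi>. Sup {cmod (\<phi> f) |f. f \<in> elems X \<and> nrm X f \<le> 1})\<rparr>"

definition reflexive_space :: "'b fspace \<Rightarrow> bool" where
  "reflexive_space X \<longleftrightarrow>
     (\<forall>\<Phi>\<in>elems (dual_space (dual_space X)).
        \<exists>f\<in>elems X. \<forall>\<phi>\<in>elems (dual_space X). \<Phi> \<phi> = \<phi> f)"


definition disjoint_supp :: "'a measure \<Rightarrow> ('a \<Rightarrow> complex) \<Rightarrow> ('a \<Rightarrow> complex) \<Rightarrow> bool" where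
  "disjoint_supp M f g \<longleftrightarrow> (AE t in M. f t = 0 \<or> g t = 0)"

definition disjoint_seq :: "'a measure \<Rightarrow> 'a fspace \<Rightarrow> (nat \<Rightarrow> 'a \<Rightarrow> complex) \<Rightarrow> bool" where
  "disjoint_seq M X e \<longleftrightarrow>
     (\<forall>i. e i \<in> elems X \<and> \<not> (AE t in M. e i t = 0)) \<and>
     (\<forall>i j. i \<noteq> j \<longrightarrow> disjoint_supp M (e i) (e j))"

text \<open>
  The closed linear span, with the norm of \<open>X\<close>. When \<open>e\<close> is a \<open>disjoint_seq\<close>, it is
  infinite dimensional, since nonzero disjointly supported vectors are linearly independent.
\<close>

definition closed_span :: "'b fspace \<Rightarrow> (nat \<Rightarrow> 'b \<Rightarrow> complex) \<Rightarrow> 'b fspace" where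
  "closed_span X e =
     \<lparr>elems = {f \<in> elems X. \<forall>\<epsilon>>0. \<exists>(n::nat) (c::nat \<Rightarrow> complex).
                 nrm X (\<lambda>t. f t - (\<Sum>i<n. c i * e i t)) < \<epsilon>},
      nrm = nrm X\<rparr>"

text \<open>\<open>M_fun M X n\<close> is \<open>M\<^sub>X(n)\<close>; the supremum is over a nonempty set bounded by \<open>n\<close>.\<close>

definition M_fun :: "'a measure \<Rightarrow> 'a fspace \<Rightarrow> nat \<Rightarrow> real" where
  "M_fun M X n =
     Sup {nrm X (\<lambda>t. \<Sum>i<n. x i t) |x.
            (\<forall>i<n. x i \<in> elems X \<and> nrm X (x i) \<le> 1) \<and>
            (\<forall>i<n. \<forall>j<n. i \<noteq> j \<longrightarrow> disjoint_supp M (x i) (x j))}"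

definition equivalent_seq :: "(nat \<Rightarrow> real) \<Rightarrow> (nat \<Rightarrow> real) \<Rightarrow> bool" where
  "equivalent_seq f g \<longleftrightarrow>
     0 < liminf (\<lambda>n. ereal (f n / g n)) \<and> limsup (\<lambda>n. ereal (f n / g n)) < \<infinity>"

definition self_similar :: "'a measure \<Rightarrow> 'a fspace \<Rightarrow> bool" where
  "self_similar M X \<longleftrightarrow>
     (\<forall>e. disjoint_seq M X e \<longrightarrow> equivalent_seq (M_fun M (closed_span X e)) (M_fun M X))"


text \<open>
  For Koethe spaces \<open>X\<^sub>0\<close>, \<open>X\<^sub>1\<close> over the same measure space, both inclusions into \<open>L\<^sub>0\<close>
  are continuous, hence they form an interpolation couple without further assumptions.
\<close>

definition sum_space :: "'a measure \<Rightarrow> 'a fspace \<Rightarrow> 'a fspace \<Rightarrow> 'a fspace" where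
  "sum_space M X0 X1 =
     \<lparr>elems = {f \<in> borel_measurable M. \<exists>a\<in>elems X0. \<exists>b\<in>elems X1. AE t in M. f t = a t + b t},
      nrm = (\<lambda>f. Inf {nrm X0 a + nrm X1 b |a b.
                        a \<in> elems X0 \<and> b \<in> elems X1 \<and> (AE t in M. f t = a t + b t)})\<rparr>"

definition bdd_cont_into ::
  "'b fspace \<Rightarrow> 's::topological_space set \<Rightarrow> ('s \<Rightarrow> 'b \<Rightarrow> complex) \<Rightarrow> bool" where
  "bdd_cont_into X S g \<longleftrightarrow>
     (\<forall>s\<in>S. g s \<in> elems X) \<and>
     (\<exists>C. \<forall>s\<in>S. nrm X (g s) \<le> C) \<and>
     (\<forall>s\<in>S. ((\<lambda>r. nrm X (\<lambda>t. g r t - g s t)) \<longlongrightarrow> 0) (at s within S))"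

definition has_deriv_in ::
  "'b fspace \<Rightarrow> (complex \<Rightarrow> 'b \<Rightarrow> complex) \<Rightarrow> ('b \<Rightarrow> complex) \<Rightarrow> complex \<Rightarrow> bool" where
  "has_deriv_in X g d z \<longleftrightarrow>
     d \<in> elems X \<and>
     ((\<lambda>w. nrm X (\<lambda>t. (g w t - g z t) / (w - z) - d t)) \<longlongrightarrow> 0) (at z)"

definition strip :: "complex set" where
  "strip = {z. 0 \<le> Re z \<and> Re z \<le> 1}"

definition calderon ::
  "'a measure \<Rightarrow> 'a fspace \<Rightarrow> 'a fspace \<Rightarrow> (complex \<Rightarrow> 'a \<Rightarrow> complex) set" where
  "calderon M X0 X1 =
     {g. bdd_cont_into (sum_space M X0 X1) strip g \<and>
         (\<forall>z\<in>interior strip. \<exists>d. has_deriv_in (sum_space M X0 X1) g d z) \<and>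
         bdd_cont_into X0 UNIV (\<lambda>t::real. g (Complex 0 t)) \<and>
         bdd_cont_into X1 UNIV (\<lambda>t::real. g (Complex 1 t))}"

definition calderon_norm ::
  "'a fspace \<Rightarrow> 'a fspace \<Rightarrow> (complex \<Rightarrow> 'a \<Rightarrow> complex) \<Rightarrow> real" where
  "calderon_norm X0 X1 g =
     Sup (range (\<lambda>t. nrm X0 (g (Complex 0 t))) \<union> range (\<lambda>t. nrm X1 (g (Complex 1 t))))"

definition interp_space :: "'a measure \<Rightarrow> 'a fspace \<Rightarrow> 'a fspace \<Rightarrow> real \<Rightarrow> 'a fspace" where
  "interp_space M X0 X1 \<theta> =
     \<lparr>elems = {g (of_real \<theta>) |g. g \<in> calderon M X0 X1},
      nrm = (\<lambda>f. Inf {calderon_norm X0 X1 g |g.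
                        g \<in> calderon M X0 X1 \<and> (AE t in M. g (of_real \<theta>) t = f t)})\<rparr>"


text \<open>
  The admissible maps \<open>B\<^sub>\<theta>\<close>. Equalities of elements of the Calderon space are read as almost
  everywhere equality at every point of the strip; the second conjunct says that \<open>B\<close> is well
  defined on classes.
\<close>

definition admissible_selector ::
  "'a measure \<Rightarrow> 'a fspace \<Rightarrow> 'a fspace \<Rightarrow> real \<Rightarrow>
   (('a \<Rightarrow> complex) \<Rightarrow> complex \<Rightarrow> 'a \<Rightarrow> complex) \<Rightarrow> bool" where
  "admissible_selector M X0 X1 \<theta> B \<longleftrightarrow>
     (let X = interp_space M X0 X1 \<theta> in
     (\<forall>x\<in>elems X. B x \<in> calderon M X0 X1 \<and> (AE t in M. B x (of_real \<theta>) t = x t)) \<and>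
     (\<forall>x\<in>elems X. \<forall>y\<in>elems X. (AE t in M. x t = y t) \<longrightarrow>
        (\<forall>z\<in>strip. AE t in M. B x z t = B y z t)) \<and>
     (\<forall>c. \<forall>x\<in>elems X. \<forall>z\<in>strip. AE t in M. B (\<lambda>s. c * x s) z t = c * B x z t) \<and>
     (\<exists>C. \<forall>x\<in>elems X. calderon_norm X0 X1 (B x) \<le> C * nrm X x) \<and>
     (\<forall>u\<in>borel_measurable M. (\<forall>t\<in>space M. u t \<in> {-1, 1}) \<longrightarrow>
        (\<forall>x\<in>elems X. \<forall>z\<in>strip. AE t in M. B (\<lambda>s. u s * x s) z t = u t * B x z t)) \<and>
     (\<forall>x\<in>elems X. \<forall>z\<in>strip. AE t in M. x t = 0 \<longrightarrow> B x z t = 0))"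

definition induced_centralizer ::
  "'a measure \<Rightarrow> 'a fspace \<Rightarrow> 'a fspace \<Rightarrow> real \<Rightarrow>
   (('a \<Rightarrow> complex) \<Rightarrow> 'a \<Rightarrow> complex) \<Rightarrow> bool" where
  "induced_centralizer M X0 X1 \<theta> \<Omega> \<longleftrightarrow>
     (\<exists>B. admissible_selector M X0 X1 \<theta> B \<and>
          (\<forall>x\<in>elems (interp_space M X0 X1 \<theta>).
             has_deriv_in (sum_space M X0 X1) (B x) (\<Omega> x) (of_real \<theta>)))"

text \<open>Linear maps into \<open>L\<^sub>0\<close>, that is, linear and well defined modulo null functions.\<close>

definition linear_into_L0 ::
  "'a measure \<Rightarrow> ('a \<Rightarrow> complex) set \<Rightarrow> (('a \<Rightarrow> complex) \<Rightarrow> 'a \<Rightarrow> complex) \<Rightarrow> bool" where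
  "linear_into_L0 M W l \<longleftrightarrow>
     (\<forall>x\<in>W. l x \<in> borel_measurable M) \<and>
     (\<forall>x\<in>W. \<forall>y\<in>W. (AE t in M. x t = y t) \<longrightarrow> (AE t in M. l x t = l y t)) \<and>
     (\<forall>x\<in>W. \<forall>y\<in>W. AE t in M. l (\<lambda>s. x s + y s) t = l x t + l y t) \<and>
     (\<forall>c. \<forall>x\<in>W. AE t in M. l (\<lambda>s. c * x s) t = c * l x t)"

definition trivial_on ::
  "'a measure \<Rightarrow> 'a fspace \<Rightarrow> (('a \<Rightarrow> complex) \<Rightarrow> 'a \<Rightarrow> complex) \<Rightarrow> ('a \<Rightarrow> complex) set \<Rightarrow> bool" where
  "trivial_on M X \<Omega> W \<longleftrightarrow>
     (\<exists>l C. linear_into_L0 M W l \<and>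
        (\<forall>x\<in>W. (\<lambda>t. \<Omega> x t - l x t) \<in> elems X \<and> nrm X (\<lambda>t. \<Omega> x t - l x t) \<le> C * nrm X x))"

definition disjointly_singular ::
  "'a measure \<Rightarrow> 'a fspace \<Rightarrow> (('a \<Rightarrow> complex) \<Rightarrow> 'a \<Rightarrow> complex) \<Rightarrow> bool" where
  "disjointly_singular M X \<Omega> \<longleftrightarrow>
     (\<forall>e. disjoint_seq M X e \<longrightarrow> \<not> trivial_on M X \<Omega> (elems (closed_span X e)))"

end

theory Submission
  imports Defs "HOL-Complex_Analysis.Conformal_Mappings"
begin

text \<open>
  For disjoint \<open>x\<^sub>i\<close> in the unit ball of \<open>X\<^sub>\<theta>\<close>, let \<open>L = log (M\<^bsub>X0\<^esub>(n) / M\<^bsub>X1\<^esub>(n))\<close>. The function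
  \<open>exp (L (z - \<theta>)) \<Sum> B(x\<^sub>i)(z)\<close> balances the norms on the two boundary lines, so that both
  are at most a constant times \<open>P = M\<^bsub>X0\<^esub>(n)\<^bsup>1-\<theta>\<^esup> M\<^bsub>X1\<^esub>(n)\<^bsup>\<theta>\<^esup>\<close>. It agrees with \<open>B(\<Sum> x\<^sub>i)\<close> at
  \<open>\<theta>\<close>, so dividing the difference by \<open>z - \<theta>\<close> shows that \<open>\<Omega>(\<Sum> x\<^sub>i) - \<Sum> \<Omega>(x\<^sub>i) - L \<Sum> x\<^sub>i\<close> has
  norm \<open>O(P)\<close> in \<open>X\<^sub>\<theta>\<close>. If \<open>\<Omega> - l\<close> is bounded on the closed span \<open>W\<close> of a disjoint sequence,
  averaging over sign changes shows that \<open>\<Omega>(\<Sum> x\<^sub>i) - \<Sum> \<Omega>(x\<^sub>i)\<close> has norm \<open>O(M\<^bsub>X\<theta>\<^esub>(n))\<close> for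
  \<open>x\<^sub>i\<close> in \<open>W\<close>. Hence \<open>\<bar>L\<bar> M\<^sub>W(n) = O(M\<^bsub>X\<theta>\<^esub>(n))\<close>, and self-similarity bounds \<open>L\<close>, contradicting the
  inequivalence of \<open>M\<^bsub>X0\<^esub>\<close> and \<open>M\<^bsub>X1\<^esub>\<close>.
\<close>

section \<open>Seminormed function spaces and norming functionals\<close>

text \<open>Two obstacles shape the proof. First, division by \<open>z - \<theta>\<close> must not
  leave the Calderon space, so the quotient has to be differentiable at \<open>\<theta>\<close> in
  the seminorm of the sum space. This is a second-order statement about functions with values in a
  mere set carrying a seminorm; hence the Hahn-Banach theorem, scalar estimates and the completeness
  of the sum are built up by hand. Second, a linear map \<open>l\<close> that trivialises
  \<open>\<Omega>\<close> need not respect supports. The errors \<open>\<Omega> x - l x\<close> for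
  disjoint vectors \<open>x\<close> may overlap, and \<open>n\<close> of them could add up to order
  \<open>n\<close> instead of the value of the function \<open>M_fun\<close> of \<open>X\<close>.
  \<open>\<Omega>\<close> itself commutes with sign changes, so averaging affects only
  \<open>l\<close>, cutting each \<open>l x\<close> down to the support of \<open>x\<close>; the
  errors become disjoint. The number \<open>L\<close> is the one for which both boundary norms get
  the same bound, and it enters the final formula as the derivative of the exponential factor at
  \<open>\<theta>\<close>. Since all equalities hold only almost everywhere, identities for
  \<open>\<Omega>\<close> appear as membership in \<open>X\<close> together with seminorm
  zero.\<close>

lemma
  assumes "seminormed X"
  shows seminormed_zero: "(\<lambda>_. 0) \<in> elems X"
    and seminormed_add: "f \<in> elems X \<Longrightarrow> g \<in> elems X \<Longrightarrow> (\<lambda>t. f t + g t) \<in> elems X"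
    and seminormed_triangle:
      "f \<in> elems X \<Longrightarrow> g \<in> elems X \<Longrightarrow> nrm X (\<lambda>t. f t + g t) \<le> nrm X f + nrm X g"
    and seminormed_scale: "f \<in> elems X \<Longrightarrow> (\<lambda>t. c * f t) \<in> elems X"
    and nrm_scale: "f \<in> elems X \<Longrightarrow> nrm X (\<lambda>t. c * f t) = cmod c * nrm X f"
    and nrm_nonneg: "f \<in> elems X \<Longrightarrow> 0 \<le> nrm X f"
  using assms unfolding seminormed_def by auto

lemma nrm_zero:
  assumes "seminormed X" shows "nrm X (\<lambda>_. 0) = 0"
  using nrm_scale[OF assms seminormed_zero[OF assms], of 0] by simp

lemma
  assumes "seminormed X" "f \<in> elems X"
  shows seminormed_uminus: "(\<lambda>t. - f t) \<in> elems X"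
    and nrm_uminus: "nrm X (\<lambda>t. - f t) = nrm X f"
  using seminormed_scale[OF assms, of "-1"] nrm_scale[OF assms, of "-1"] by simp_all

lemma
  assumes "seminormed X" "f \<in> elems X" "g \<in> elems X"
  shows seminormed_diff: "(\<lambda>t. f t - g t) \<in> elems X"
    and nrm_triangle_diff: "nrm X (\<lambda>t. f t - g t) \<le> nrm X f + nrm X g"
    and nrm_diff_commute: "nrm X (\<lambda>t. f t - g t) = nrm X (\<lambda>t. g t - f t)"
    and nrm_triangle_sub: "nrm X f \<le> nrm X (\<lambda>t. f t - g t) + nrm X g"
proof -
  note S = assms(1)
  note u = seminormed_uminus[OF S assms(3)]
  show d: "(\<lambda>t. f t - g t) \<in> elems X"
    using seminormed_add[OF S assms(2) u] by simp
  show "nrm X (\<lambda>t. f t - g t) \<le> nrm X f + nrm X g"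
    using seminormed_triangle[OF S assms(2) u] nrm_uminus[OF S assms(3)] by simp
  show "nrm X (\<lambda>t. f t - g t) = nrm X (\<lambda>t. g t - f t)"
    using nrm_uminus[OF S d] by simp
  show "nrm X f \<le> nrm X (\<lambda>t. f t - g t) + nrm X g"
    using seminormed_triangle[OF S d assms(3)] by simp
qed

lemma
  assumes "seminormed X" "finite I" "\<And>i. i \<in> I \<Longrightarrow> f i \<in> elems X"
  shows seminormed_sum: "(\<lambda>t. \<Sum>i\<in>I. f i t) \<in> elems X"
    and nrm_sum_le: "nrm X (\<lambda>t. \<Sum>i\<in>I. f i t) \<le> (\<Sum>i\<in>I. nrm X (f i))"
proof -
  have "(\<lambda>t. \<Sum>i\<in>I. f i t) \<in> elems X \<and> nrm X (\<lambda>t. \<Sum>i\<in>I. f i t) \<le> (\<Sum>i\<in>I. nrm X (f i))"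
    using assms(2,3)
  proof (induction I rule: finite_induct)
    case empty
    then show ?case
      using seminormed_zero[OF assms(1)] nrm_zero[OF assms(1)] by simp
  next
    case (insert i I)
    then have IH: "(\<lambda>t. \<Sum>i\<in>I. f i t) \<in> elems X"
        "nrm X (\<lambda>t. \<Sum>i\<in>I. f i t) \<le> (\<Sum>i\<in>I. nrm X (f i))" and fi: "f i \<in> elems X"
      by auto
    show ?case
      using seminormed_add[OF assms(1) fi IH(1)] seminormed_triangle[OF assms(1) fi IH(1)]
        IH(2) insert.hyps by simp
  qed
  then show "(\<lambda>t. \<Sum>i\<in>I. f i t) \<in> elems X"
    and "nrm X (\<lambda>t. \<Sum>i\<in>I. f i t) \<le> (\<Sum>i\<in>I. nrm X (f i))" by auto
qed

section \<open>Hahn-Banach theorem by minimal sublinear functionals\<close>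

text \<open>Functionals are ordered pointwise as total functions, so the value off
  \<open>elems X\<close> is pinned to 0; this keeps infima comparable with \<open>q\<close>
  everywhere and lets minimality yield equality of functions. Homogeneity is asked only as an
  inequality, since passing from \<open>c\<close> to \<open>1/c\<close> gives the other one.\<close>

definition sublinear_below :: "'b fspace \<Rightarrow> (('b \<Rightarrow> complex) \<Rightarrow> real) \<Rightarrow> bool" where
  "sublinear_below X q \<longleftrightarrow>
     (\<forall>x\<in>elems X. \<forall>y\<in>elems X. q (\<lambda>t. x t + y t) \<le> q x + q y) \<and>
     (\<forall>x\<in>elems X. \<forall>c::real. 0 < c \<longrightarrow> q (\<lambda>t. c * x t) \<le> c * q x) \<and>
     (\<forall>x\<in>elems X. q x \<le> nrm X x) \<and>
     (\<forall>x. x \<notin> elems X \<longrightarrow> q x = 0)"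

lemma sublinear_belowD:
  assumes "sublinear_below X q"
  shows "x \<in> elems X \<Longrightarrow> y \<in> elems X \<Longrightarrow> q (\<lambda>t. x t + y t) \<le> q x + q y"
    and "x \<in> elems X \<Longrightarrow> 0 < c \<Longrightarrow> q (\<lambda>t. complex_of_real c * x t) \<le> c * q x"
    and "x \<in> elems X \<Longrightarrow> q x \<le> nrm X x"
    and "x \<notin> elems X \<Longrightarrow> q x = 0"
  using assms unfolding sublinear_below_def by blast+

lemma sublinear_below_zero:
  assumes X: "seminormed X" and q: "sublinear_below X q"
  shows "q (\<lambda>_. 0) = 0"
proof -
  have 0: "(\<lambda>_. 0) \<in> elems X" by (rule seminormed_zero[OF X])
  have "q (\<lambda>t. 0 + 0) \<le> q (\<lambda>_. 0) + q (\<lambda>_. 0)"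
    by (rule sublinear_belowD(1)[OF q 0 0])
  moreover have "q (\<lambda>_. 0) \<le> nrm X (\<lambda>_. 0)" by (rule sublinear_belowD(3)[OF q 0])
  ultimately show ?thesis using nrm_zero[OF X] by simp
qed

lemma sublinear_below_scale:
  assumes X: "seminormed X" and q: "sublinear_below X q" and x: "x \<in> elems X" and c: "0 \<le> c"
  shows "q (\<lambda>t. complex_of_real c * x t) = c * q x"
proof (cases "c = 0")
  case True
  then show ?thesis using sublinear_below_zero[OF X q] by simp
next
  case False
  then have c: "0 < c" using c by simp
  have "q (\<lambda>t. of_real (1/c) * (of_real c * x t)) \<le> (1/c) * q (\<lambda>t. of_real c * x t)"
    by (rule sublinear_belowD(2)[OF q seminormed_scale[OF X x]]) (use c in simp)
  then have "q x \<le> (1/c) * q (\<lambda>t. of_real c * x t)" using c by simp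
  then have "c * q x \<le> q (\<lambda>t. of_real c * x t)" using c by (simp add: field_simps)
  with sublinear_belowD(2)[OF q x c] show ?thesis by simp
qed

lemma sublinear_below_lower:
  assumes X: "seminormed X" and q: "sublinear_below X q" and x: "x \<in> elems X"
  shows "- q (\<lambda>t. - x t) \<le> q x" "- nrm X x \<le> q x"
proof -
  note u = seminormed_uminus[OF X x]
  have "q (\<lambda>t. x t + - x t) \<le> q x + q (\<lambda>t. - x t)"
    by (rule sublinear_belowD(1)[OF q x u])
  then show 1: "- q (\<lambda>t. - x t) \<le> q x" using sublinear_below_zero[OF X q] by simp
  show "- nrm X x \<le> q x"
    using 1 sublinear_belowD(3)[OF q u] nrm_uminus[OF X x] by simp
qed

text \<open>The largest sublinear functional below \<open>q\<close> whose value at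
  \<open>- y\<close> is at most \<open>- q y\<close>: any such \<open>p\<close> satisfies
  \<open>p x \<le> p (x + r y) + p (- r y) \<le> q (x + r y) - r q y\<close> for
  \<open>r \<ge> 0\<close>.\<close>

definition directional_inf ::
  "'b fspace \<Rightarrow> ('b \<Rightarrow> complex) \<Rightarrow> (('b \<Rightarrow> complex) \<Rightarrow> real) \<Rightarrow> ('b \<Rightarrow> complex) \<Rightarrow> real" where
  "directional_inf X y q x =
     (if x \<in> elems X then INF r\<in>{0..}. q (\<lambda>t. x t + complex_of_real r * y t) - r * q y else 0)"

lemma directional_inf_le:
  assumes X: "seminormed X" and q: "sublinear_below X q" and y: "y \<in> elems X"
    and x: "x \<in> elems X" and r: "0 \<le> r"
  shows "directional_inf X y q x \<le> q (\<lambda>t. x t + complex_of_real r * y t) - r * q y"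
proof -
  \<comment> \<open>Subadditivity gives a lower bound independent of \<open>s\<close>, so that the
    \<open>INF\<close> is a genuine infimum.\<close>
  have "- q (\<lambda>t. - x t) \<le> q (\<lambda>t. x t + complex_of_real s * y t) - s * q y" if "0 \<le> s" for s
  proof -
    note sy = seminormed_scale[OF X y, of "of_real s"]
    have "q (\<lambda>t. (x t + of_real s * y t) + - x t)
        \<le> q (\<lambda>t. x t + of_real s * y t) + q (\<lambda>t. - x t)"
      by (rule sublinear_belowD(1)[OF q seminormed_add[OF X x sy] seminormed_uminus[OF X x]])
    then show ?thesis using sublinear_below_scale[OF X q y that] by simp
  qed
  then have "bdd_below ((\<lambda>r. q (\<lambda>t. x t + complex_of_real r * y t) - r * q y) ` {0..})"
    by (intro bdd_belowI[of _ "- q (\<lambda>t. - x t)"]) auto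
  then show ?thesis
    unfolding directional_inf_def using x r by (auto intro: cINF_lower)
qed

lemma directional_inf_greatest:
  assumes "x \<in> elems X"
    and "\<And>r. 0 \<le> r \<Longrightarrow> b \<le> q (\<lambda>t. x t + complex_of_real r * y t) - r * q y"
  shows "b \<le> directional_inf X y q x"
  unfolding directional_inf_def using assms by (auto intro!: cINF_greatest)

text \<open>Subadditivity merges the parameters \<open>r\<close> and \<open>s\<close> into
  \<open>r + s\<close>; homogeneity rescales \<open>r\<close> to \<open>c * r\<close>. The values at
  \<open>r = 0\<close> and \<open>r = 1\<close> give the other two claims.\<close>

lemma sublinear_below_directional_inf:
  assumes X: "seminormed X" and q: "sublinear_below X q" and y: "y \<in> elems X"
  shows "sublinear_below X (directional_inf X y q)"
    and "directional_inf X y q x \<le> q x"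
    and "directional_inf X y q (\<lambda>t. - y t) \<le> - q y"
proof -
  let ?d = "directional_inf X y q"
  note le = directional_inf_le[OF X q y]
  show le_q: "?d x \<le> q x" for x
    using le[of x 0] sublinear_belowD(4)[OF q, of x]
    by (cases "x \<in> elems X") (auto simp: directional_inf_def)
  show "?d (\<lambda>t. - y t) \<le> - q y"
    using le[OF seminormed_uminus[OF X y], of 1] sublinear_below_zero[OF X q] by simp
  have add: "?d (\<lambda>t. a t + b t) \<le> ?d a + ?d b" if a: "a \<in> elems X" and b: "b \<in> elems X" for a b
  proof -
    have *: "?d (\<lambda>t. a t + b t) \<le>
        (q (\<lambda>t. a t + of_real r * y t) - r * q y) + (q (\<lambda>t. b t + of_real s * y t) - s * q y)"
      if "0 \<le> r" "0 \<le> s" for r s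
    proof -
      have "q (\<lambda>t. (a t + of_real r * y t) + (b t + of_real s * y t))
          \<le> q (\<lambda>t. a t + of_real r * y t) + q (\<lambda>t. b t + of_real s * y t)"
        by (intro sublinear_belowD(1)[OF q] seminormed_add[OF X] seminormed_scale[OF X] a b y)
      moreover have "(\<lambda>t. (a t + of_real r * y t) + (b t + of_real s * y t))
          = (\<lambda>t. (a t + b t) + of_real (r + s) * y t)"
        by (simp add: fun_eq_iff algebra_simps)
      ultimately show ?thesis
        using le[OF seminormed_add[OF X a b], of "r + s"] that by (simp add: algebra_simps)
    qed
    \<comment> \<open>The two parameters vary independently, so the infimum is taken first over
      \<open>s\<close> with \<open>r\<close> fixed, then over \<open>r\<close>.\<close>
    have "?d (\<lambda>t. a t + b t) - (q (\<lambda>t. a t + of_real r * y t) - r * q y) \<le> ?d b" if "0 \<le> r" for r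
      by (rule directional_inf_greatest[OF b]) (use *[OF that] in \<open>simp add: algebra_simps\<close>)
    then have "?d (\<lambda>t. a t + b t) - ?d b \<le> ?d a"
      by (intro directional_inf_greatest[OF a]) (simp add: algebra_simps)
    then show ?thesis by simp
  qed
  have scale: "?d (\<lambda>t. of_real c * a t) \<le> c * ?d a" if a: "a \<in> elems X" and c: "0 < c" for a c
  proof -
    have "?d (\<lambda>t. of_real c * a t) / c \<le> ?d a"
    proof (rule directional_inf_greatest[OF a])
      fix r :: real assume r: "0 \<le> r"
      have "q (\<lambda>t. of_real c * (a t + of_real r * y t)) \<le> c * q (\<lambda>t. a t + of_real r * y t)"
        by (intro sublinear_belowD(2)[OF q] seminormed_add[OF X] seminormed_scale[OF X] a y c)
      moreover have "(\<lambda>t. of_real c * (a t + of_real r * y t))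
          = (\<lambda>t. of_real c * a t + of_real (c * r) * y t)"
        by (simp add: fun_eq_iff algebra_simps)
      ultimately have "?d (\<lambda>t. of_real c * a t) \<le> c * q (\<lambda>t. a t + of_real r * y t) - c * r * q y"
        using le[OF seminormed_scale[OF X a, of "of_real c"], of "c * r"] r c by simp
      then show "?d (\<lambda>t. of_real c * a t) / c \<le> q (\<lambda>t. a t + of_real r * y t) - r * q y"
        using c by (simp add: field_simps)
    qed
    then show ?thesis using c by (simp add: field_simps)
  qed
  have "?d a \<le> nrm X a" if "a \<in> elems X" for a
    using le_q[of a] sublinear_belowD(3)[OF q that] by simp
  then show "sublinear_below X ?d"
    unfolding sublinear_below_def using add scale by (auto simp: directional_inf_def)
qed

text \<open>Supplies the bounds for Zorn's lemma. The chain condition is what saves subadditivity: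
  for two members \<open>p\<close> and \<open>q\<close>, the smaller one bounds the infimum at
  \<open>a + b\<close> by \<open>p a + q b\<close>.\<close>

lemma sublinear_below_chain_Inf:
  assumes X: "seminormed X" and C: "C \<noteq> {}" "\<And>q. q \<in> C \<Longrightarrow> sublinear_below X q"
    and chain: "\<And>p q. p \<in> C \<Longrightarrow> q \<in> C \<Longrightarrow> p \<le> q \<or> q \<le> p"
  shows "sublinear_below X (\<lambda>x. INF q\<in>C. q x)" "p \<in> C \<Longrightarrow> (INF q\<in>C. q x) \<le> p x"
proof -
  have bdd: "bdd_below ((\<lambda>q. q x) ` C)" for x
  proof (cases "x \<in> elems X")
    case True
    then show ?thesis
      using sublinear_below_lower(2)[OF X C(2) True] by (intro bdd_belowI[of _ "- nrm X x"]) auto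
  next
    case False
    then show ?thesis
      using sublinear_belowD(4)[OF C(2) False]
      by (intro bdd_belowI[of _ 0]) (metis imageE order_refl)
  qed
  let ?I = "\<lambda>x. INF q\<in>C. q x"
  show le: "?I x \<le> p x" if "p \<in> C" for p x
    using cINF_lower[OF bdd that] by simp
  have ge: "b \<le> ?I x" if "\<And>q. q \<in> C \<Longrightarrow> b \<le> q x" for b x
    using that C(1) by (intro cINF_greatest)
  have add: "?I (\<lambda>t. a t + b t) \<le> ?I a + ?I b" if a: "a \<in> elems X" and b: "b \<in> elems X" for a b
  proof -
    have *: "?I (\<lambda>t. a t + b t) \<le> p a + q b" if pq: "p \<in> C" "q \<in> C" for p q
    proof -
      obtain r where r: "r \<in> C" "r \<le> p" "r \<le> q" using chain[OF pq] pq by blast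
      have "?I (\<lambda>t. a t + b t) \<le> r (\<lambda>t. a t + b t)" by (rule le[OF r(1)])
      also have "\<dots> \<le> r a + r b" by (rule sublinear_belowD(1)[OF C(2)[OF r(1)] a b])
      also have "\<dots> \<le> p a + q b" using r(2,3) by (intro add_mono) (auto simp: le_fun_def)
      finally show ?thesis .
    qed
    have "?I (\<lambda>t. a t + b t) - p a \<le> ?I b" if "p \<in> C" for p
      using *[OF that] by (intro ge) (simp add: algebra_simps)
    then have "?I (\<lambda>t. a t + b t) - ?I b \<le> ?I a"
      by (intro ge) (simp add: algebra_simps)
    then show ?thesis by simp
  qed
  have scale: "?I (\<lambda>t. of_real c * a t) \<le> c * ?I a" if a: "a \<in> elems X" and c: "0 < c" for a c
  proof -
    have "?I (\<lambda>t. of_real c * a t) / c \<le> ?I a"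
    proof (rule ge)
      fix q assume q: "q \<in> C"
      show "?I (\<lambda>t. of_real c * a t) / c \<le> q a"
        using le[OF q, of "\<lambda>t. of_real c * a t"] sublinear_belowD(2)[OF C(2)[OF q] a c] c
        by (simp add: field_simps)
    qed
    then show ?thesis using c by (simp add: field_simps)
  qed
  obtain q where q: "q \<in> C" using C(1) by blast
  have "?I a \<le> nrm X a" if "a \<in> elems X" for a
    using le[OF q, of a] sublinear_belowD(3)[OF C(2)[OF q] that] by simp
  moreover have "?I x = 0" if "x \<notin> elems X" for x
  proof -
    have "(\<lambda>q. q x) ` C = (\<lambda>_. 0) ` C"
      by (rule image_cong[OF refl]) (rule sublinear_belowD(4)[OF C(2) that])
    then show ?thesis using C(1) by simp
  qed
  ultimately show "sublinear_below X ?I"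
    unfolding sublinear_below_def using add scale by blast
qed

lemma minimal_sublinear_below_exists:
  assumes X: "seminormed X" and p: "sublinear_below X p"
  obtains q where "sublinear_below X q" "q \<le> p"
    "\<And>r. sublinear_below X r \<Longrightarrow> r \<le> q \<Longrightarrow> r = q"
proof -
  let ?A = "{q. sublinear_below X q \<and> q \<le> p}"
  \<comment> \<open>The order is reversed, so that a maximal element for \<open>?R\<close> is a
    minimal functional.\<close>
  let ?R = "\<lambda>a b :: ('a \<Rightarrow> complex) \<Rightarrow> real. b \<le> a"
  have "\<exists>m\<in>?A. \<forall>a\<in>?A. ?R m a \<longrightarrow> a = m"
  proof (rule predicate_Zorn)
    show "partial_order_on ?A (relation_of ?R ?A)"
      by (auto simp: partial_order_on_def preorder_on_def relation_of_def
          intro!: refl_onI transI antisymI)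
    fix C assume "C \<in> Chains (relation_of ?R ?A)"
    then have C: "\<And>a b. a \<in> C \<Longrightarrow> b \<in> C \<Longrightarrow> a \<in> ?A \<and> b \<in> ?A \<and> (a \<le> b \<or> b \<le> a)"
      unfolding Chains_def relation_of_def by blast
    show "\<exists>u\<in>?A. \<forall>a\<in>C. ?R a u"
    proof (cases "C = {}")
      case True
      then show ?thesis using p by auto
    next
      case False
      have sub: "\<And>q. q \<in> C \<Longrightarrow> sublinear_below X q" using C by blast
      have ch: "\<And>p q. p \<in> C \<Longrightarrow> q \<in> C \<Longrightarrow> p \<le> q \<or> q \<le> p" using C by blast
      note I = sublinear_below_chain_Inf[OF X False sub ch, simplified]
      obtain q where q: "q \<in> C" using False by blast
      then have "q \<le> p" using C by blast
      let ?I = "\<lambda>x. INF q\<in>C. q x"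
      have low: "\<And>p. p \<in> C \<Longrightarrow> ?I \<le> p"
        unfolding le_fun_def using I(2) by blast
      then have "?I \<le> p" using q \<open>q \<le> p\<close> by (meson order_trans)
      then have "?I \<in> ?A" using I(1) by blast
      then show ?thesis using low by (intro bexI[of _ ?I]) auto
    qed
  qed
  then obtain q where q: "sublinear_below X q" "q \<le> p"
      "\<And>a. sublinear_below X a \<Longrightarrow> a \<le> p \<Longrightarrow> a \<le> q \<Longrightarrow> a = q"
    by blast
  show thesis
    using that[OF q(1,2)] q(2,3) order_trans by blast
qed

text \<open>A minimal sublinear functional \<open>q\<close> coincides with all its directional infima, which
  makes it additive.\<close>

lemma minimal_sublinear_below_linear:
  assumes X: "seminormed X" and q: "sublinear_below X q"
    and min: "\<And>r. sublinear_below X r \<Longrightarrow> r \<le> q \<Longrightarrow> r = q"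
  shows "x \<in> elems X \<Longrightarrow> y \<in> elems X \<Longrightarrow> q (\<lambda>t. x t + y t) = q x + q y"
    and "x \<in> elems X \<Longrightarrow> q (\<lambda>t. complex_of_real c * x t) = c * q x"
proof -
  show add: "q (\<lambda>t. x t + y t) = q x + q y" if x: "x \<in> elems X" and y: "y \<in> elems X" for x y
  proof -
    have "directional_inf X y q = q"
      using sublinear_below_directional_inf[OF X q y] by (intro min) (auto simp: le_fun_def)
    then have "q x \<le> q (\<lambda>t. x t + y t) - q y"
      using directional_inf_le[OF X q y x, of 1] by simp
    with sublinear_belowD(1)[OF q x y] show ?thesis by simp
  qed
  have neg: "q (\<lambda>t. - x t) = - q x" if x: "x \<in> elems X" for x
    using add[OF x seminormed_uminus[OF X x]] sublinear_below_zero[OF X q] by simp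
  show "q (\<lambda>t. complex_of_real c * x t) = c * q x" if x: "x \<in> elems X"
  proof (cases "0 \<le> c")
    case True
    then show ?thesis by (rule sublinear_below_scale[OF X q x])
  next
    case False
    then have "q (\<lambda>t. of_real (- c) * (- x t)) = (- c) * q (\<lambda>t. - x t)"
      by (intro sublinear_below_scale[OF X q seminormed_uminus[OF X x]]) simp
    then show ?thesis using neg[OF x] by simp
  qed
qed

text \<open>Zorn's lemma is started not at the norm but at its directional infimum along
  \<open>v\<close>. Every functional below that one has value at most \<open>- nrm X v\<close> at
  \<open>- v\<close>, and linearity turns this into the norming property.\<close>

lemma norming_real_functional:
  assumes X: "seminormed X" and v: "v \<in> elems X"
  obtains q where "\<And>x y. x \<in> elems X \<Longrightarrow> y \<in> elems X \<Longrightarrow> q (\<lambda>t. x t + y t) = q x + q y"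
    "\<And>c x. x \<in> elems X \<Longrightarrow> q (\<lambda>t. complex_of_real c * x t) = c * q x"
    "\<And>x. x \<in> elems X \<Longrightarrow> q x \<le> nrm X x" "q v = nrm X v"
proof -
  define p where "p x = (if x \<in> elems X then nrm X x else 0)" for x
  have p: "sublinear_below X p"
    unfolding sublinear_below_def p_def
    using X by (auto simp: seminormed_add seminormed_triangle seminormed_scale nrm_scale)
  obtain q where q: "sublinear_below X q" "q \<le> directional_inf X v p"
      "\<And>r. sublinear_below X r \<Longrightarrow> r \<le> q \<Longrightarrow> r = q"
    using minimal_sublinear_below_exists[OF X sublinear_below_directional_inf(1)[OF X p v]] by blast
  note lin = minimal_sublinear_below_linear[OF X q(1,3), simplified]
  have "q (\<lambda>t. - v t) \<le> directional_inf X v p (\<lambda>t. - v t)"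
    using q(2) by (simp add: le_fun_def)
  also have "\<dots> \<le> - nrm X v"
    using sublinear_below_directional_inf(3)[OF X p v] v by (simp add: p_def)
  finally have "nrm X v \<le> q v"
    using lin(2)[OF v, of "-1"] by simp
  then have "q v = nrm X v" using sublinear_belowD(3)[OF q(1) v] by simp
  then show thesis
    using that[of q] lin sublinear_belowD(3)[OF q(1)] by blast
qed

text \<open>The usual complexification \<open>q x - \<i> q (\<i> x)\<close>. Rotating
  \<open>x\<close> by a unimodular scalar makes the value real and bounds its modulus; at
  \<open>v\<close> the real part already exhausts the bound, so the imaginary part vanishes.\<close>

lemma norming_functional:
  assumes X: "seminormed X" and v: "v \<in> elems X"
  obtains \<phi> :: "('b \<Rightarrow> complex) \<Rightarrow> complex"
  where "\<And>x y. x \<in> elems X \<Longrightarrow> y \<in> elems X \<Longrightarrow> \<phi> (\<lambda>t. x t + y t) = \<phi> x + \<phi> y"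
    "\<And>c x. x \<in> elems X \<Longrightarrow> \<phi> (\<lambda>t. c * x t) = c * \<phi> x"
    "\<And>x. x \<in> elems X \<Longrightarrow> cmod (\<phi> x) \<le> nrm X x" "\<phi> v = nrm X v"
proof -
  obtain q where add: "\<And>x y. x \<in> elems X \<Longrightarrow> y \<in> elems X \<Longrightarrow> q (\<lambda>t. x t + y t) = q x + q y"
    and scale: "\<And>c x. x \<in> elems X \<Longrightarrow> q (\<lambda>t. complex_of_real c * x t) = c * q x"
    and le: "\<And>x. x \<in> elems X \<Longrightarrow> q x \<le> nrm X x" and qv: "q v = nrm X v"
    by (rule norming_real_functional[OF X v]) blast
  define \<phi> where "\<phi> x = Complex (q x) (- q (\<lambda>t. \<i> * x t))" for x
  note S = seminormed_scale[OF X]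
  have \<phi>_add: "\<phi> (\<lambda>t. x t + y t) = \<phi> x + \<phi> y" if "x \<in> elems X" "y \<in> elems X" for x y
    using add[OF that] add[OF S[OF that(1)] S[OF that(2)], of \<i> \<i>]
    by (simp add: \<phi>_def complex_eq_iff algebra_simps)
  have q_scale: "q (\<lambda>t. c * x t) = Re c * q x + Im c * q (\<lambda>t. \<i> * x t)" if x: "x \<in> elems X" for c x
  proof -
    have "(\<lambda>t. c * x t) = (\<lambda>t. of_real (Re c) * x t + of_real (Im c) * (\<i> * x t))"
      by (rule ext, subst complex_eq[of c]) (simp add: algebra_simps)
    then show ?thesis
      using add[OF S[OF x] S[OF S[OF x]], of "of_real (Re c)" "of_real (Im c)" \<i>]
        scale[OF x] scale[OF S[OF x]] by simp
  qed
  have \<phi>_scale: "\<phi> (\<lambda>t. c * x t) = c * \<phi> x" if x: "x \<in> elems X" for c x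
    using q_scale[OF x, of c] q_scale[OF x, of "\<i> * c"]
    by (simp add: \<phi>_def complex_eq_iff mult.assoc[symmetric])
  have \<phi>_le: "cmod (\<phi> x) \<le> nrm X x" if x: "x \<in> elems X" for x
  proof (cases "\<phi> x = 0")
    case True
    then show ?thesis using nrm_nonneg[OF X x] by simp
  next
    case False
    define c where "c = cnj (\<phi> x) / cmod (\<phi> x)"
    have c: "cmod c = 1" using False by (simp add: c_def norm_divide)
    have "c * \<phi> x = of_real (cmod (\<phi> x))"
      using False by (simp add: c_def complex_norm_square[symmetric] power2_eq_square mult.commute)
    then have "cmod (\<phi> x) = Re (\<phi> (\<lambda>t. c * x t))" using \<phi>_scale[OF x, of c] by simp
    also have "\<dots> \<le> nrm X (\<lambda>t. c * x t)" using le[OF S[OF x]] by (simp add: \<phi>_def)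
    finally show ?thesis using nrm_scale[OF X x, of c] c by simp
  qed
  have "Im (\<phi> v) = 0"
  proof -
    have "(cmod (\<phi> v))\<^sup>2 \<le> (nrm X v)\<^sup>2"
      by (rule power_mono[OF \<phi>_le[OF v]]) simp
    moreover have "Re (\<phi> v) = nrm X v" using qv by (simp add: \<phi>_def)
    ultimately show ?thesis by (simp add: cmod_power2)
  qed
  then have "\<phi> v = nrm X v" using qv by (simp add: \<phi>_def complex_eq_iff)
  then show thesis using that[of \<phi>] \<phi>_add \<phi>_scale \<phi>_le by blast
qed

section \<open>Scalar estimates for difference quotients\<close>

text \<open>On the circle of radius \<open>R\<close> the numerator is at most \<open>2 * B\<close>
  and the denominator at least \<open>R / 2\<close>. The singularity at \<open>b\<close> is
  removable, so the maximum principle carries the bound inside.\<close>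

lemma difference_quotient_bound:
  fixes f :: "complex \<Rightarrow> complex"
  assumes S: "open S" "cball a R \<subseteq> S" and f: "f holomorphic_on S"
    and B: "\<And>z. z \<in> cball a R \<Longrightarrow> cmod (f z) \<le> B" and R: "0 < R" and b: "dist a b \<le> R / 2"
  defines "g \<equiv> (\<lambda>z. if z = b then deriv f b else (f z - f b) / (z - b))"
  shows "g holomorphic_on S" and "z \<in> cball a R \<Longrightarrow> cmod (g z) \<le> 4 * B / R"
proof -
  show hol: "g holomorphic_on S"
    unfolding g_def by (rule pole_lemma_open[OF f S(1)])
  have "cmod (g z) \<le> 4 * B / R" if "z \<in> cball a R"
  proof (rule maximum_modulus_frontier[of g "cball a R"])
    show "g holomorphic_on interior (cball a R)"
      by (rule holomorphic_on_subset[OF hol]) (use S(2) interior_subset in blast)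
    show "continuous_on (closure (cball a R)) g"
      using holomorphic_on_imp_continuous_on[OF hol] S(2) continuous_on_subset by auto
    fix z assume "z \<in> frontier (cball a R)"
    then have z: "dist a z = R" by (simp add: dist_commute)
    have "R / 2 \<le> dist z b"
      using dist_triangle[of a z b] z b by (simp add: dist_commute)
    then have zb: "R / 2 \<le> cmod (z - b)" by (simp add: dist_norm)
    then have "z \<noteq> b" using R by auto
    have "cmod (f z - f b) \<le> cmod (f z) + cmod (f b)" by (rule norm_triangle_ineq4)
    also have "\<dots> \<le> B + B" using z b R by (intro add_mono B) auto
    finally have "cmod (f z - f b) \<le> B + B" .
    moreover have "0 \<le> B" using order_trans[OF norm_ge_zero B[of a]] R by simp
    ultimately have "cmod (f z - f b) / cmod (z - b) \<le> (B + B) / (R / 2)"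
      using zb R by (intro frac_le) auto
    then show "cmod (g z) \<le> 4 * B / R"
      using \<open>z \<noteq> b\<close> by (simp add: g_def norm_divide)
  qed (use that in auto)
  then show "z \<in> cball a R \<Longrightarrow> cmod (g z) \<le> 4 * B / R" by blast
qed

text \<open>\<open>difference_quotient_bound\<close> is applied three times, with base points
  \<open>a\<close>, \<open>a\<close> and finally \<open>w\<close>; each application multiplies the
  bound by \<open>4 / R\<close>. The last quotient, between \<open>z\<close> and \<open>w\<close>,
  is the Lipschitz estimate.\<close>

lemma second_difference_quotient_Lipschitz:
  fixes f :: "complex \<Rightarrow> complex"
  assumes S: "open S" "cball a R \<subseteq> S" and f: "f holomorphic_on S"
    and B: "\<And>z. z \<in> cball a R \<Longrightarrow> cmod (f z) \<le> B" and R: "0 < R"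
    and z: "dist a z \<le> R / 2" "z \<noteq> a" and w: "dist a w \<le> R / 2" "w \<noteq> a"
  shows "cmod (((f z - f a) / (z - a) - deriv f a) / (z - a)
             - ((f w - f a) / (w - a) - deriv f a) / (w - a)) \<le> 64 * B / R ^ 3 * cmod (z - w)"
proof (cases "z = w")
  case False
  define g where "g = (\<lambda>z. if z = a then deriv f a else (f z - f a) / (z - a))"
  have g: "g holomorphic_on S" "\<And>z. z \<in> cball a R \<Longrightarrow> cmod (g z) \<le> 4 * B / R"
    using difference_quotient_bound[OF S f B R, of a] R unfolding g_def by auto
  define h where "h = (\<lambda>z. if z = a then deriv g a else (g z - g a) / (z - a))"
  have h: "h holomorphic_on S" "\<And>z. z \<in> cball a R \<Longrightarrow> cmod (h z) \<le> 4 * (4 * B / R) / R"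
    using difference_quotient_bound[OF S g R, of a] R unfolding h_def by auto
  have "cmod ((h z - h w) / (z - w)) \<le> 4 * (4 * (4 * B / R) / R) / R"
    using difference_quotient_bound(2)[OF S h R w(1), of z] z R False by auto
  then have "cmod (h z - h w) \<le> 64 * B / R ^ 3 * cmod (z - w)"
    using False by (simp add: norm_divide field_simps power3_eq_cube)
  then show ?thesis using z w by (simp add: h_def g_def)
qed auto

section \<open>Solid spaces and their sum\<close>

text \<open>The part of \<open>kothe_space\<close> shared by \<open>X0\<close>, \<open>X1\<close>,
  their sum and the interpolation space, so that one collection of lattice lemmas serves all
  four.\<close>

definition solid_space :: "'a measure \<Rightarrow> 'a fspace \<Rightarrow> bool" where
  "solid_space M X \<longleftrightarrow>
     elems X \<subseteq> borel_measurable M \<and> seminormed X \<and>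
     (\<forall>f\<in>borel_measurable M. \<forall>g\<in>elems X.
        (AE t in M. cmod (f t) \<le> cmod (g t)) \<longrightarrow> f \<in> elems X \<and> nrm X f \<le> nrm X g)"

lemma kothe_imp_solid: "kothe_space M X \<Longrightarrow> solid_space M X"
  unfolding kothe_space_def solid_space_def by blast

lemma solid_seminormed: "solid_space M X \<Longrightarrow> seminormed X"
  and solid_measurable: "solid_space M X \<Longrightarrow> f \<in> elems X \<Longrightarrow> f \<in> borel_measurable M"
  unfolding solid_space_def by blast+

lemma
  assumes X: "solid_space M X" and g: "g \<in> elems X" and f: "f \<in> borel_measurable M"
    and le: "AE t in M. cmod (f t) \<le> cmod (g t)"
  shows solid_dominated: "f \<in> elems X" and solid_nrm_mono: "nrm X f \<le> nrm X g"
  using assms unfolding solid_space_def by blast+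

lemma
  assumes X: "solid_space M X" and g: "g \<in> elems X" and f: "f \<in> borel_measurable M"
    and eq: "AE t in M. f t = g t"
  shows solid_AE_eq: "f \<in> elems X" and nrm_AE_eq: "nrm X f = nrm X g"
proof -
  have le: "AE t in M. cmod (f t) \<le> cmod (g t)" "AE t in M. cmod (g t) \<le> cmod (f t)"
    using eq by (auto elim: eventually_mono)
  show 1: "f \<in> elems X" by (rule solid_dominated[OF X g f le(1)])
  show "nrm X f = nrm X g"
    using solid_nrm_mono[OF X g f le(1)] solid_nrm_mono[OF X 1 solid_measurable[OF X g] le(2)]
    by simp
qed

lemma nrm_AE_zero:
  assumes X: "solid_space M X" and f: "f \<in> elems X" and eq: "AE t in M. f t = 0"
  shows "nrm X f = 0"
proof -
  note S = solid_seminormed[OF X]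
  show ?thesis
    using nrm_AE_eq[OF X seminormed_zero[OF S] solid_measurable[OF X f]] eq nrm_zero[OF S] by simp
qed

lemma
  assumes X: "solid_space M X" and g: "g \<in> elems X" and u: "u \<in> borel_measurable M"
    and le: "\<And>t. cmod (u t) \<le> 1"
  shows solid_multiplier: "(\<lambda>t. u t * g t) \<in> elems X"
    and nrm_multiplier: "nrm X (\<lambda>t. u t * g t) \<le> nrm X g"
proof -
  have m: "(\<lambda>t. u t * g t) \<in> borel_measurable M"
    using u solid_measurable[OF X g] by simp
  have "AE t in M. cmod (u t * g t) \<le> cmod (g t)"
    using le by (auto simp: norm_mult mult_left_le_one_le)
  then show "(\<lambda>t. u t * g t) \<in> elems X" "nrm X (\<lambda>t. u t * g t) \<le> nrm X g"
    using solid_dominated[OF X g m] solid_nrm_mono[OF X g m] by blast+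
qed

text \<open>A dominated \<open>f\<close> is almost everywhere \<open>u * g\<close> with
  \<open>u\<close> bounded by 1. Multiplication by \<open>u\<close> and changes on null sets pass
  easily through decompositions and liftings, whereas domination does not.\<close>

lemma solid_spaceI:
  assumes meas: "elems X \<subseteq> borel_measurable M" and S: "seminormed X"
    and eq: "\<And>f g. f \<in> borel_measurable M \<Longrightarrow> g \<in> elems X \<Longrightarrow> AE t in M. f t = g t \<Longrightarrow>
        f \<in> elems X \<and> nrm X f \<le> nrm X g"
    and mult: "\<And>u g. u \<in> borel_measurable M \<Longrightarrow> (\<And>t. cmod (u t) \<le> 1) \<Longrightarrow> g \<in> elems X \<Longrightarrow>
        (\<lambda>t. u t * g t) \<in> elems X \<and> nrm X (\<lambda>t. u t * g t) \<le> nrm X g"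
  shows "solid_space M X"
proof -
  have "f \<in> elems X \<and> nrm X f \<le> nrm X g"
    if f: "f \<in> borel_measurable M" and g: "g \<in> elems X"
      and le: "AE t in M. cmod (f t) \<le> cmod (g t)" for f g
  proof -
    \<comment> \<open>The bound on \<open>u\<close> has to hold at every point, so \<open>u\<close>
      is 0 where domination fails. Where \<open>g t = 0\<close> and domination holds,
      \<open>f t = 0\<close>, in agreement with division by zero giving 0.\<close>
    define u where "u t = (if cmod (f t) \<le> cmod (g t) then f t / g t else 0)" for t
    have gm: "g \<in> borel_measurable M" using g meas by blast
    have u: "u \<in> borel_measurable M"
      unfolding u_def using f gm by measurable
    have u1: "cmod (u t) \<le> 1" for t
      by (auto simp: u_def norm_divide divide_le_eq_1)
    have "AE t in M. f t = u t * g t"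
      using le by (auto simp: u_def elim!: eventually_mono)
    then show ?thesis
      using eq[OF f, of "\<lambda>t. u t * g t"] mult[OF u u1 g] by force
  qed
  then show ?thesis unfolding solid_space_def using meas S by blast
qed

text \<open>One inequality for scalars suffices: applied to \<open>1/c\<close> it gives the
  converse, and for \<open>c = 0\<close> nonnegativity closes the gap.\<close>

lemma seminormedI:
  assumes "(\<lambda>_. 0) \<in> elems X"
    and add: "\<And>f g. f \<in> elems X \<Longrightarrow> g \<in> elems X \<Longrightarrow>
        (\<lambda>t. f t + g t) \<in> elems X \<and> nrm X (\<lambda>t. f t + g t) \<le> nrm X f + nrm X g"
    and scale: "\<And>c f. f \<in> elems X \<Longrightarrow>
        (\<lambda>t. c * f t) \<in> elems X \<and> nrm X (\<lambda>t. c * f t) \<le> cmod c * nrm X f"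
    and nonneg: "\<And>f. f \<in> elems X \<Longrightarrow> 0 \<le> nrm X f"
  shows "seminormed X"
proof -
  have "nrm X (\<lambda>t. c * f t) = cmod c * nrm X f" if f: "f \<in> elems X" for c f
  proof (cases "c = 0")
    case True
    then show ?thesis using scale[OF f, of c] nonneg by force
  next
    case False
    have "nrm X (\<lambda>t. (1/c) * (c * f t)) \<le> cmod (1/c) * nrm X (\<lambda>t. c * f t)"
      using scale f by blast
    then have "cmod c * nrm X f \<le> nrm X (\<lambda>t. c * f t)"
      using False by (simp add: norm_divide field_simps)
    then show ?thesis using scale[OF f, of c] by linarith
  qed
  then show ?thesis unfolding seminormed_def using assms by blast
qed

lemma le_mult_if_le_mult_add_epsilon:
  fixes x y c :: real
  assumes "0 \<le> c" "\<And>\<epsilon>. 0 < \<epsilon> \<Longrightarrow> x \<le> c * (y + \<epsilon>)"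
  shows "x \<le> c * y"
proof (cases "c = 0")
  case True
  then show ?thesis using assms(2)[of 1] by simp
next
  case False
  show ?thesis
  proof (rule field_le_epsilon)
    fix e :: real assume "0 < e"
    then show "x \<le> c * y + e"
      using assms(2)[of "e / c"] assms(1) False by (simp add: distrib_left)
  qed
qed

section \<open>The sum of two solid spaces and its completeness\<close>

lemma sum_space_elems:
  "f \<in> elems (sum_space M X0 X1) \<longleftrightarrow> f \<in> borel_measurable M \<and>
     (\<exists>a\<in>elems X0. \<exists>b\<in>elems X1. AE t in M. f t = a t + b t)"
  by (simp add: sum_space_def)

lemma sum_space_elemsI:
  assumes "f \<in> borel_measurable M" "a \<in> elems X0" "b \<in> elems X1" "AE t in M. f t = a t + b t"
  shows "f \<in> elems (sum_space M X0 X1)"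
  unfolding sum_space_elems using assms by (intro conjI bexI[of _ a] bexI[of _ b])

lemma sum_space_nrm_le:
  assumes "solid_space M X0" "solid_space M X1" "a \<in> elems X0" "b \<in> elems X1"
    and "AE t in M. f t = a t + b t"
  shows "nrm (sum_space M X0 X1) f \<le> nrm X0 a + nrm X1 b"
proof -
  have "0 \<le> nrm X0 a + nrm X1 b" if "a \<in> elems X0" "b \<in> elems X1" for a b
    using nrm_nonneg[OF solid_seminormed] assms(1,2) that by (metis add_nonneg_nonneg)
  then show ?thesis
    unfolding sum_space_def using assms(3-5)
    by (auto intro!: cInf_lower bdd_belowI[of _ 0])
qed

lemma sum_space_decomposition:
  assumes "f \<in> elems (sum_space M X0 X1)" "nrm (sum_space M X0 X1) f < r"
  obtains a b where "a \<in> elems X0" "b \<in> elems X1" "AE t in M. f t = a t + b t"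
    "nrm X0 a + nrm X1 b < r"
proof -
  let ?S = "{nrm X0 a + nrm X1 b |a b. a \<in> elems X0 \<and> b \<in> elems X1 \<and> (AE t in M. f t = a t + b t)}"
  have "?S \<noteq> {}" using assms(1) unfolding sum_space_elems by blast
  moreover have "Inf ?S < r" using assms(2) by (simp add: sum_space_def)
  ultimately obtain s where "s \<in> ?S" "s < r" by (rule cInf_lessD[THEN bexE])
  then show thesis using that by blast
qed

lemma sum_space_solid:
  assumes X0: "solid_space M X0" and X1: "solid_space M X1"
  shows "solid_space M (sum_space M X0 X1)"
proof -
  let ?E = "sum_space M X0 X1"
  note S0 = solid_seminormed[OF X0] and S1 = solid_seminormed[OF X1]
  note le = sum_space_nrm_le[OF X0 X1]
  have meas: "elems ?E \<subseteq> borel_measurable M" by (auto simp: sum_space_elems)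
  have nonneg: "0 \<le> nrm ?E f" if f: "f \<in> elems ?E" for f
  proof (rule ccontr)
    assume "\<not> 0 \<le> nrm ?E f"
    then obtain a b where "a \<in> elems X0" "b \<in> elems X1" "nrm X0 a + nrm X1 b < 0"
      using sum_space_decomposition[OF f, of 0] by (metis not_le)
    then show False using nrm_nonneg[OF S0] nrm_nonneg[OF S1] by fastforce
  qed
  have add: "(\<lambda>t. f t + g t) \<in> elems ?E \<and> nrm ?E (\<lambda>t. f t + g t) \<le> nrm ?E f + nrm ?E g"
    if f: "f \<in> elems ?E" and g: "g \<in> elems ?E" for f g
  proof -
    have m: "(\<lambda>t. f t + g t) \<in> borel_measurable M"
      using meas f g by (intro borel_measurable_add) blast+
    have *: "(\<lambda>t. f t + g t) \<in> elems ?E \<and>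
        nrm ?E (\<lambda>t. f t + g t) \<le> nrm ?E f + nrm ?E g + \<epsilon>" if \<epsilon>: "0 < \<epsilon>" for \<epsilon>
    proof -
      obtain a b where ab: "a \<in> elems X0" "b \<in> elems X1" "AE t in M. f t = a t + b t"
          "nrm X0 a + nrm X1 b < nrm ?E f + \<epsilon> / 2"
        using sum_space_decomposition[OF f, of "nrm ?E f + \<epsilon> / 2"] \<epsilon> by auto
      obtain c d where cd: "c \<in> elems X0" "d \<in> elems X1" "AE t in M. g t = c t + d t"
          "nrm X0 c + nrm X1 d < nrm ?E g + \<epsilon> / 2"
        using sum_space_decomposition[OF g, of "nrm ?E g + \<epsilon> / 2"] \<epsilon> by auto
      note ac = seminormed_add[OF S0 ab(1) cd(1)] and bd = seminormed_add[OF S1 ab(2) cd(2)]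
      have eq: "AE t in M. f t + g t = (a t + c t) + (b t + d t)"
        using ab(3) cd(3) by eventually_elim simp
      have "nrm ?E (\<lambda>t. f t + g t) \<le> nrm X0 (\<lambda>t. a t + c t) + nrm X1 (\<lambda>t. b t + d t)"
        by (rule le[OF ac bd eq])
      then have "nrm ?E (\<lambda>t. f t + g t) \<le> nrm ?E f + nrm ?E g + \<epsilon>"
        using seminormed_triangle[OF S0 ab(1) cd(1)] seminormed_triangle[OF S1 ab(2) cd(2)]
          ab(4) cd(4) by linarith
      then show ?thesis using sum_space_elemsI[OF m ac bd eq] by simp
    qed
    then show ?thesis using field_le_epsilon[of "nrm ?E (\<lambda>t. f t + g t)"] zero_less_one by blast
  qed
  \<comment> \<open>One estimate for two later uses: constants \<open>u\<close>, with
    \<open>c\<close> their modulus, give homogeneity; functions \<open>u\<close> bounded by 1, with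
    \<open>c = 1\<close>, give solidity.\<close>
  have mult: "(\<lambda>t. u t * g t) \<in> elems ?E \<and> nrm ?E (\<lambda>t. u t * g t) \<le> c * nrm ?E g"
    if u: "u \<in> borel_measurable M" and c: "0 \<le> c" and g: "g \<in> elems ?E"
      and u0: "\<And>a. a \<in> elems X0 \<Longrightarrow> (\<lambda>t. u t * a t) \<in> elems X0 \<and> nrm X0 (\<lambda>t. u t * a t) \<le> c * nrm X0 a"
      and u1: "\<And>a. a \<in> elems X1 \<Longrightarrow> (\<lambda>t. u t * a t) \<in> elems X1 \<and> nrm X1 (\<lambda>t. u t * a t) \<le> c * nrm X1 a"
    for u g c
  proof -
    have m: "(\<lambda>t. u t * g t) \<in> borel_measurable M"
      using meas g u by (intro borel_measurable_times) blast+
    have *: "(\<lambda>t. u t * g t) \<in> elems ?E \<and> nrm ?E (\<lambda>t. u t * g t) \<le> c * (nrm ?E g + \<epsilon>)"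
      if \<epsilon>: "0 < \<epsilon>" for \<epsilon>
    proof -
      obtain a b where ab: "a \<in> elems X0" "b \<in> elems X1" "AE t in M. g t = a t + b t"
          "nrm X0 a + nrm X1 b < nrm ?E g + \<epsilon>"
        using sum_space_decomposition[OF g, of "nrm ?E g + \<epsilon>"] \<epsilon> by auto
      have eq: "AE t in M. u t * g t = u t * a t + u t * b t"
        using ab(3) by eventually_elim (simp add: distrib_left)
      have "nrm ?E (\<lambda>t. u t * g t) \<le> nrm X0 (\<lambda>t. u t * a t) + nrm X1 (\<lambda>t. u t * b t)"
        using le[OF _ _ eq] u0[OF ab(1)] u1[OF ab(2)] by blast
      also have "\<dots> \<le> c * (nrm X0 a + nrm X1 b)"
        using u0[OF ab(1)] u1[OF ab(2)] by (simp add: distrib_left)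
      also have "\<dots> \<le> c * (nrm ?E g + \<epsilon>)"
        using ab(4) c by (intro mult_left_mono) auto
      finally show ?thesis
        using sum_space_elemsI[OF m _ _ eq] u0[OF ab(1)] u1[OF ab(2)] by simp
    qed
    then show ?thesis
      using le_mult_if_le_mult_add_epsilon[OF c] zero_less_one by blast
  qed
  have S: "seminormed ?E"
  proof (rule seminormedI[OF _ add _ nonneg])
    show "(\<lambda>_. 0) \<in> elems ?E"
      unfolding sum_space_elems using seminormed_zero[OF S0] seminormed_zero[OF S1]
      by (intro conjI bexI[of _ "\<lambda>_. 0"]) auto
    show "(\<lambda>t. c * f t) \<in> elems ?E \<and> nrm ?E (\<lambda>t. c * f t) \<le> cmod c * nrm ?E f"
      if "f \<in> elems ?E" for c f
      using that by (intro mult) (auto simp: seminormed_scale nrm_scale S0 S1)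
  qed
  show ?thesis
  proof (rule solid_spaceI[OF meas S])
    fix f g assume f: "f \<in> borel_measurable M" and g: "g \<in> elems ?E" and eq: "AE t in M. f t = g t"
    have iff: "(AE t in M. f t = a t + b t) \<longleftrightarrow> (AE t in M. g t = a t + b t)" for a b
      using eq by (auto elim: eventually_elim2)
    show "f \<in> elems ?E \<and> nrm ?E f \<le> nrm ?E g"
      using f g unfolding sum_space_elems iff by (simp add: sum_space_def iff)
  next
    fix u :: "'a \<Rightarrow> complex" and g
    assume u: "u \<in> borel_measurable M" "\<And>t. cmod (u t) \<le> 1" and g: "g \<in> elems ?E"
    show "(\<lambda>t. u t * g t) \<in> elems ?E \<and> nrm ?E (\<lambda>t. u t * g t) \<le> nrm ?E g"
      using mult[OF u(1) _ g, of 1] solid_multiplier[OF X0 _ u] solid_multiplier[OF X1 _ u]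
        nrm_multiplier[OF X0 _ u] nrm_multiplier[OF X1 _ u] by simp
  qed
qed

lemma geometric_Cauchy_converges:
  assumes X: "kothe_space M X" and a: "\<And>k. a k \<in> elems X"
    and le: "\<And>k. nrm X (a k) \<le> C * (1/2) ^ k"
  obtains l where "l \<in> elems X" "(\<lambda>n. nrm X (\<lambda>t. (\<Sum>k<n. a k t) - l t)) \<longlonglongrightarrow> 0"
proof -
  note S = solid_seminormed[OF kothe_imp_solid[OF X]]
  let ?s = "\<lambda>n t. \<Sum>k<n. a k t"
  have s: "?s n \<in> elems X" for n by (rule seminormed_sum[OF S]) (simp_all add: a)
  have "summable (\<lambda>k. C * (1/2::real) ^ k)" by (intro summable_mult summable_geometric) simp
  then have tail: "\<exists>N. \<forall>m\<ge>N. \<forall>n. norm (\<Sum>k=m..<n. C * (1/2::real) ^ k) < \<epsilon>" if "0 < \<epsilon>" for \<epsilon>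
    using that unfolding summable_Cauchy by blast
  have ordered: "nrm X (\<lambda>t. ?s n t - ?s m t) \<le> norm (\<Sum>k=m..<n. C * (1/2::real) ^ k)"
    if "m \<le> n" for m n
  proof -
    have "(\<lambda>t. ?s n t - ?s m t) = (\<lambda>t. \<Sum>k=m..<n. a k t)"
      using that by (intro ext) (simp add: lessThan_atLeast0 sum_diff_nat_ivl)
    then have "nrm X (\<lambda>t. ?s n t - ?s m t) \<le> (\<Sum>k=m..<n. nrm X (a k))"
      using nrm_sum_le[OF S, of "{m..<n}" a] a by simp
    also have "\<dots> \<le> (\<Sum>k=m..<n. C * (1/2::real) ^ k)" by (intro sum_mono le)
    finally show ?thesis by simp
  qed
  have "\<exists>N. \<forall>m\<ge>N. \<forall>n\<ge>N. nrm X (\<lambda>t. ?s m t - ?s n t) < \<epsilon>" if \<epsilon>: "0 < \<epsilon>" for \<epsilon>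
  proof -
    obtain N where N: "\<And>m n. N \<le> m \<Longrightarrow> norm (\<Sum>k=m..<n. C * (1/2::real) ^ k) < \<epsilon>"
      using tail[OF \<epsilon>] by blast
    have "nrm X (\<lambda>t. ?s m t - ?s n t) < \<epsilon>" if mn: "N \<le> m" "N \<le> n" for m n
    proof (cases "m \<le> n")
      case True
      then show ?thesis
        using ordered[OF True] N[OF mn(1), of n] nrm_diff_commute[OF S s s, of m n] by linarith
    next
      case False
      then have "n \<le> m" by simp
      then show ?thesis using ordered[OF \<open>n \<le> m\<close>] N[OF mn(2), of m] by linarith
    qed
    then show ?thesis by blast
  qed
  then have cauchy: "\<forall>\<epsilon>>0. \<exists>N. \<forall>m\<ge>N. \<forall>n\<ge>N. nrm X (\<lambda>t. ?s m t - ?s n t) < \<epsilon>"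
    by simp
  have "norm_complete X" using X unfolding kothe_space_def by simp
  from this[unfolded norm_complete_def, THEN spec, of ?s, rule_format, OF s cauchy[rule_format]]
  show thesis using that by blast
qed

text \<open>Completeness of the sum in the only form used. Each increment is split into a part in
  \<open>X0\<close> and a part in \<open>X1\<close> of geometrically small norms, and the two series
  are summed separately.\<close>

lemma sum_space_geometric_Cauchy_converges:
  assumes K0: "kothe_space M X0" and K1: "kothe_space M X1"
    and f: "\<And>k. f k \<in> elems (sum_space M X0 X1)"
    and le: "\<And>k. nrm (sum_space M X0 X1) (\<lambda>t. f (Suc k) t - f k t) \<le> C * (1/2) ^ k"
  obtains l where "l \<in> elems (sum_space M X0 X1)"
    "(\<lambda>n. nrm (sum_space M X0 X1) (\<lambda>t. f n t - l t)) \<longlonglongrightarrow> 0"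
proof -
  let ?E = "sum_space M X0 X1"
  note X0 = kothe_imp_solid[OF K0] and X1 = kothe_imp_solid[OF K1]
  note E = sum_space_solid[OF X0 X1]
  note S0 = solid_seminormed[OF X0] and S1 = solid_seminormed[OF X1] and SE = solid_seminormed[OF E]
  \<comment> \<open>\<open>C + 1\<close> in place of \<open>C\<close> makes the bound strict, as
    needed to pick a decomposition close to the infimum.\<close>
  define P where "P k a b \<longleftrightarrow> a \<in> elems X0 \<and> b \<in> elems X1 \<and>
      (AE t in M. f (Suc k) t - f k t = a t + b t) \<and>
      nrm X0 a + nrm X1 b < (C + 1) * (1/2) ^ k" for k a b
  have "\<exists>a b. P k a b" for k
  proof -
    have "nrm ?E (\<lambda>t. f (Suc k) t - f k t) < (C + 1) * (1/2) ^ k"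
    proof -
      have "0 < (1/2::real) ^ k" by simp
      then show ?thesis using le[of k] unfolding distrib_right by linarith
    qed
    from sum_space_decomposition[OF seminormed_diff[OF SE f f] this] show ?thesis
      unfolding P_def by blast
  qed
  then obtain a b where P: "\<And>k. P k (a k) (b k)" by metis
  then have a: "a k \<in> elems X0" and b: "b k \<in> elems X1"
    and eq: "AE t in M. f (Suc k) t - f k t = a k t + b k t"
    and ab: "nrm X0 (a k) + nrm X1 (b k) < (C + 1) * (1/2) ^ k" for k
    unfolding P_def by blast+
  have a_le: "nrm X0 (a k) \<le> (C + 1) * (1/2) ^ k" and b_le: "nrm X1 (b k) \<le> (C + 1) * (1/2) ^ k" for k
    using ab[of k] nrm_nonneg[OF S0 a[of k]] nrm_nonneg[OF S1 b[of k]] by linarith+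
  obtain l0 where l0: "l0 \<in> elems X0" "(\<lambda>n. nrm X0 (\<lambda>t. (\<Sum>k<n. a k t) - l0 t)) \<longlonglongrightarrow> 0"
    by (rule geometric_Cauchy_converges[OF K0 a a_le])
  obtain l1 where l1: "l1 \<in> elems X1" "(\<lambda>n. nrm X1 (\<lambda>t. (\<Sum>k<n. b k t) - l1 t)) \<longlonglongrightarrow> 0"
    by (rule geometric_Cauchy_converges[OF K1 b b_le])
  define l where "l t = f 0 t + (l0 t + l1 t)" for t
  have "(\<lambda>t. l0 t + l1 t) \<in> elems ?E"
    using solid_measurable[OF X0 l0(1)] solid_measurable[OF X1 l1(1)]
    by (intro sum_space_elemsI[OF _ l0(1) l1(1)]) auto
  then have l: "l \<in> elems ?E" unfolding l_def by (rule seminormed_add[OF SE f])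
  have bound: "nrm ?E (\<lambda>t. f n t - l t)
      \<le> nrm X0 (\<lambda>t. (\<Sum>k<n. a k t) - l0 t) + nrm X1 (\<lambda>t. (\<Sum>k<n. b k t) - l1 t)" for n
  proof (rule sum_space_nrm_le[OF X0 X1])
    show "(\<lambda>t. (\<Sum>k<n. a k t) - l0 t) \<in> elems X0"
      by (intro seminormed_diff[OF S0] seminormed_sum[OF S0] l0(1)) (simp_all add: a)
    show "(\<lambda>t. (\<Sum>k<n. b k t) - l1 t) \<in> elems X1"
      by (intro seminormed_diff[OF S1] seminormed_sum[OF S1] l1(1)) (simp_all add: b)
    have "AE t in M. f n t = f 0 t + ((\<Sum>k<n. a k t) + (\<Sum>k<n. b k t))"
    proof (induction n)
      case (Suc n)
      then show ?case using eq[of n] by eventually_elim (simp add: algebra_simps)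
    qed simp
    then show "AE t in M. f n t - l t = (\<Sum>k<n. a k t) - l0 t + ((\<Sum>k<n. b k t) - l1 t)"
      by eventually_elim (simp add: l_def)
  qed
  have "(\<lambda>n. nrm ?E (\<lambda>t. f n t - l t)) \<longlonglongrightarrow> 0"
  proof (rule Lim_null_comparison)
    show "\<forall>\<^sub>F n in sequentially. norm (nrm ?E (\<lambda>t. f n t - l t))
        \<le> nrm X0 (\<lambda>t. (\<Sum>k<n. a k t) - l0 t) + nrm X1 (\<lambda>t. (\<Sum>k<n. b k t) - l1 t)"
      using bound nrm_nonneg[OF SE seminormed_diff[OF SE f l]] by simp
    show "(\<lambda>n. nrm X0 (\<lambda>t. (\<Sum>k<n. a k t) - l0 t) + nrm X1 (\<lambda>t. (\<Sum>k<n. b k t) - l1 t)) \<longlonglongrightarrow> 0"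
      using tendsto_add[OF l0(2) l1(2)] by simp
  qed
  with l show thesis by (rule that)
qed

section \<open>Continuity and differentiability in seminormed spaces\<close>

lemma nrm_tendsto_add:
  assumes S: "seminormed X" and g: "\<forall>\<^sub>F r in F. g r \<in> elems X" and h: "\<forall>\<^sub>F r in F. h r \<in> elems X"
    and k: "k \<in> elems X" and l: "l \<in> elems X"
    and lim: "((\<lambda>r. nrm X (\<lambda>t. g r t - k t)) \<longlongrightarrow> 0) F" "((\<lambda>r. nrm X (\<lambda>t. h r t - l t)) \<longlongrightarrow> 0) F"
  shows "((\<lambda>r. nrm X (\<lambda>t. (g r t + h r t) - (k t + l t))) \<longlongrightarrow> 0) F"
proof (rule Lim_null_comparison)
  show "\<forall>\<^sub>F r in F. norm (nrm X (\<lambda>t. (g r t + h r t) - (k t + l t)))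
      \<le> nrm X (\<lambda>t. g r t - k t) + nrm X (\<lambda>t. h r t - l t)"
    using g h
  proof eventually_elim
    case (elim r)
    note d = seminormed_diff[OF S elim(1) k] seminormed_diff[OF S elim(2) l]
    have "(\<lambda>t. (g r t + h r t) - (k t + l t)) = (\<lambda>t. (g r t - k t) + (h r t - l t))"
      by (simp add: fun_eq_iff)
    then show ?case
      using seminormed_triangle[OF S d] nrm_nonneg[OF S seminormed_add[OF S d]] by simp
  qed
  show "((\<lambda>r. nrm X (\<lambda>t. g r t - k t) + nrm X (\<lambda>t. h r t - l t)) \<longlongrightarrow> 0) F"
    using tendsto_add[OF lim] by simp
qed

lemma nrm_tendsto_mult:
  assumes S: "seminormed X" and g: "\<forall>\<^sub>F r in F. g r \<in> elems X" and l: "l \<in> elems X"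
    and lim: "((\<lambda>r. nrm X (\<lambda>t. g r t - l t)) \<longlongrightarrow> 0) F" and f: "(f \<longlongrightarrow> c) F"
  shows "((\<lambda>r. nrm X (\<lambda>t. f r * g r t - c * l t)) \<longlongrightarrow> 0) F"
proof (rule Lim_null_comparison)
  show "\<forall>\<^sub>F r in F. norm (nrm X (\<lambda>t. f r * g r t - c * l t))
      \<le> cmod (f r) * nrm X (\<lambda>t. g r t - l t) + cmod (f r - c) * nrm X l"
    using g
  proof eventually_elim
    case (elim r)
    note d = seminormed_diff[OF S elim l]
    note fd = seminormed_scale[OF S d, of "f r"] seminormed_scale[OF S l, of "f r - c"]
    have "(\<lambda>t. f r * g r t - c * l t) = (\<lambda>t. f r * (g r t - l t) + (f r - c) * l t)"
      by (simp add: fun_eq_iff algebra_simps)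
    then show ?case
      using seminormed_triangle[OF S fd] nrm_nonneg[OF S seminormed_add[OF S fd]]
      by (simp add: nrm_scale[OF S d] nrm_scale[OF S l])
  qed
  have "((\<lambda>r. cmod (f r) * nrm X (\<lambda>t. g r t - l t) + cmod (f r - c) * nrm X l)
      \<longlongrightarrow> cmod c * 0 + cmod (c - c) * nrm X l) F"
    by (intro tendsto_intros f lim)
  then show "((\<lambda>r. cmod (f r) * nrm X (\<lambda>t. g r t - l t) + cmod (f r - c) * nrm X l) \<longlongrightarrow> 0) F"
    by simp
qed

lemma nrm_tendsto_mono:
  assumes S: "seminormed X" and f: "\<forall>\<^sub>F r in F. f r \<in> elems X \<and> nrm X (f r) \<le> nrm X (g r)"
    and lim: "((\<lambda>r. nrm X (g r)) \<longlongrightarrow> 0) F"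
  shows "((\<lambda>r. nrm X (f r)) \<longlongrightarrow> 0) F"
  by (rule Lim_null_comparison[OF _ lim])
    (use f nrm_nonneg[OF S] in \<open>auto elim!: eventually_mono\<close>)

lemma bdd_cont_intoD:
  assumes "bdd_cont_into X S g"
  shows "s \<in> S \<Longrightarrow> g s \<in> elems X" and "\<exists>C. \<forall>s\<in>S. nrm X (g s) \<le> C"
    and "s \<in> S \<Longrightarrow> ((\<lambda>r. nrm X (\<lambda>t. g r t - g s t)) \<longlongrightarrow> 0) (at s within S)"
  using assms unfolding bdd_cont_into_def by blast+

lemma eventually_in_at_within: "(\<And>r. r \<in> S \<Longrightarrow> P r) \<Longrightarrow> \<forall>\<^sub>F r in at s within S. P r"
  by (simp add: eventually_at_filter)

lemma bdd_cont_into_add: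
  assumes S: "seminormed X" and g: "bdd_cont_into X A g" and h: "bdd_cont_into X A h"
  shows "bdd_cont_into X A (\<lambda>s t. g s t + h s t)"
  unfolding bdd_cont_into_def
proof (intro conjI ballI)
  note gs = bdd_cont_intoD(1)[OF g] and hs = bdd_cont_intoD(1)[OF h]
  obtain C D where CD: "\<And>s. s \<in> A \<Longrightarrow> nrm X (g s) \<le> C" "\<And>s. s \<in> A \<Longrightarrow> nrm X (h s) \<le> D"
    using bdd_cont_intoD(2)[OF g] bdd_cont_intoD(2)[OF h] by blast
  show "\<exists>C. \<forall>s\<in>A. nrm X (\<lambda>t. g s t + h s t) \<le> C"
  proof (intro exI ballI)
    fix s assume "s \<in> A"
    then show "nrm X (\<lambda>t. g s t + h s t) \<le> C + D"
      using seminormed_triangle[OF S gs hs, of s s] CD[of s] by simp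
  qed
  fix s assume s: "s \<in> A"
  show "(\<lambda>t. g s t + h s t) \<in> elems X" by (rule seminormed_add[OF S gs[OF s] hs[OF s]])
  show "((\<lambda>r. nrm X (\<lambda>t. g r t + h r t - (g s t + h s t))) \<longlongrightarrow> 0) (at s within A)"
    by (intro nrm_tendsto_add S gs hs s bdd_cont_intoD(3)[OF g] bdd_cont_intoD(3)[OF h]
        eventually_in_at_within)
qed

lemma bdd_cont_into_mult:
  assumes S: "seminormed X" and g: "bdd_cont_into X A g" and f: "continuous_on A f"
    and K: "\<And>s. s \<in> A \<Longrightarrow> cmod (f s) \<le> K"
  shows "bdd_cont_into X A (\<lambda>s t. f s * g s t)"
  unfolding bdd_cont_into_def
proof (intro conjI ballI)
  note gs = bdd_cont_intoD(1)[OF g]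
  obtain C where C: "\<And>s. s \<in> A \<Longrightarrow> nrm X (g s) \<le> C"
    using bdd_cont_intoD(2)[OF g] by blast
  show "\<exists>C. \<forall>s\<in>A. nrm X (\<lambda>t. f s * g s t) \<le> C"
  proof (intro exI ballI)
    fix s assume s: "s \<in> A"
    show "nrm X (\<lambda>t. f s * g s t) \<le> K * C"
      unfolding nrm_scale[OF S gs[OF s]]
      using K[OF s] C[OF s] nrm_nonneg[OF S gs[OF s]] order_trans[OF norm_ge_zero K[OF s]]
      by (intro mult_mono)
  qed
  fix s assume s: "s \<in> A"
  show "(\<lambda>t. f s * g s t) \<in> elems X" by (rule seminormed_scale[OF S gs[OF s]])
  have "(f \<longlongrightarrow> f s) (at s within A)" using f s by (simp add: continuous_on_def)
  then show "((\<lambda>r. nrm X (\<lambda>t. f r * g r t - f s * g s t)) \<longlongrightarrow> 0) (at s within A)"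
    by (intro nrm_tendsto_mult S gs s bdd_cont_intoD(3)[OF g] eventually_in_at_within)
qed

text \<open>Common core of the next two results: multiplication by a bounded function and
  modification on null sets increase neither the norms nor the norms of differences.\<close>

lemma bdd_cont_into_mono:
  assumes S: "seminormed X" and g: "bdd_cont_into X A g"
    and h: "\<And>s. s \<in> A \<Longrightarrow> h s \<in> elems X \<and> nrm X (h s) \<le> nrm X (g s)"
    and diff: "\<And>r s. r \<in> A \<Longrightarrow> s \<in> A \<Longrightarrow>
      nrm X (\<lambda>t. h r t - h s t) \<le> nrm X (\<lambda>t. g r t - g s t)"
  shows "bdd_cont_into X A h"
  unfolding bdd_cont_into_def
proof (intro conjI ballI)
  show "\<exists>C. \<forall>s\<in>A. nrm X (h s) \<le> C"
    using bdd_cont_intoD(2)[OF g] h order_trans by blast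
  fix s assume s: "s \<in> A"
  show "h s \<in> elems X" using h[OF s] by blast
  show "((\<lambda>r. nrm X (\<lambda>t. h r t - h s t)) \<longlongrightarrow> 0) (at s within A)"
    using h s diff
    by (intro nrm_tendsto_mono[OF S _ bdd_cont_intoD(3)[OF g s]] eventually_in_at_within conjI
        seminormed_diff[OF S]) auto
qed

lemma bdd_cont_into_multiplier:
  assumes X: "solid_space M X" and g: "bdd_cont_into X A g"
    and u: "u \<in> borel_measurable M" "\<And>t. cmod (u t) \<le> 1"
  shows "bdd_cont_into X A (\<lambda>s t. u t * g s t)"
proof (rule bdd_cont_into_mono[OF solid_seminormed[OF X] g])
  note gs = bdd_cont_intoD(1)[OF g]
  show "(\<lambda>t. u t * g s t) \<in> elems X \<and> nrm X (\<lambda>t. u t * g s t) \<le> nrm X (g s)" if "s \<in> A" for s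
    using solid_multiplier[OF X gs[OF that] u] nrm_multiplier[OF X gs[OF that] u] by blast
  show "nrm X (\<lambda>t. u t * g r t - u t * g s t) \<le> nrm X (\<lambda>t. g r t - g s t)"
    if "r \<in> A" "s \<in> A" for r s
    using nrm_multiplier[OF X seminormed_diff[OF solid_seminormed[OF X] gs gs] u, of r s] that
    by (simp add: right_diff_distrib)
qed

lemma bdd_cont_into_AE_eq:
  assumes X: "solid_space M X" and g: "bdd_cont_into X A g"
    and h: "\<And>s. s \<in> A \<Longrightarrow> h s \<in> borel_measurable M" "\<And>s. s \<in> A \<Longrightarrow> AE t in M. h s t = g s t"
  shows "bdd_cont_into X A h"
proof (rule bdd_cont_into_mono[OF solid_seminormed[OF X] g])
  note gs = bdd_cont_intoD(1)[OF g]
  show hs: "h s \<in> elems X \<and> nrm X (h s) \<le> nrm X (g s)" if "s \<in> A" for s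
    using solid_AE_eq[OF X gs[OF that] h[OF that]] nrm_AE_eq[OF X gs[OF that] h[OF that]] by simp
  show "nrm X (\<lambda>t. h r t - h s t) \<le> nrm X (\<lambda>t. g r t - g s t)" if r: "r \<in> A" and s: "s \<in> A" for r s
  proof -
    have "AE t in M. h r t - h s t = g r t - g s t"
      using h(2)[OF r] h(2)[OF s] by eventually_elim simp
    moreover have "(\<lambda>t. h r t - h s t) \<in> borel_measurable M" using h(1) r s by simp
    ultimately show ?thesis
      using nrm_AE_eq[OF X seminormed_diff[OF solid_seminormed[OF X] gs[OF r] gs[OF s]]] by simp
  qed
qed

lemma has_deriv_in_elems: "has_deriv_in X g d z \<Longrightarrow> d \<in> elems X"
  unfolding has_deriv_in_def by blast

lemma difference_quotient_elems:
  assumes "seminormed X" "g w \<in> elems X" "g z \<in> elems X"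
  shows "(\<lambda>t. (g w t - g z t) / (w - z)) \<in> elems X"
  using seminormed_scale[OF assms(1) seminormed_diff[OF assms], of "1 / (w - z)"] by simp

lemma has_deriv_in_add:
  assumes S: "seminormed X" and U: "open U" "z \<in> U"
    and g: "\<And>w. w \<in> U \<Longrightarrow> g w \<in> elems X" and h: "\<And>w. w \<in> U \<Longrightarrow> h w \<in> elems X"
    and d: "has_deriv_in X g d z" and e: "has_deriv_in X h e z"
  shows "has_deriv_in X (\<lambda>w t. g w t + h w t) (\<lambda>t. d t + e t) z"
  unfolding has_deriv_in_def
proof
  note dE = has_deriv_in_elems[OF d] and eE = has_deriv_in_elems[OF e]
  show "(\<lambda>t. d t + e t) \<in> elems X" by (rule seminormed_add[OF S dE eE])
  have ev: "\<forall>\<^sub>F w in at z. w \<in> U" by (rule eventually_at_in_open'[OF U])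
  have "((\<lambda>w. nrm X (\<lambda>t. ((g w t - g z t) / (w - z) + (h w t - h z t) / (w - z)) - (d t + e t)))
      \<longlongrightarrow> 0) (at z)"
    using ev d e dE eE g h U(2) unfolding has_deriv_in_def
    by (intro nrm_tendsto_add[OF S])
      (auto elim!: eventually_mono intro!: difference_quotient_elems[OF S])
  moreover have "(g w t + h w t - (g z t + h z t)) / (w - z)
      = (g w t - g z t) / (w - z) + (h w t - h z t) / (w - z)" for w t
    by (simp add: add_divide_distrib[symmetric] algebra_simps)
  ultimately show "((\<lambda>w. nrm X (\<lambda>t. (g w t + h w t - (g z t + h z t)) / (w - z) - (d t + e t)))
      \<longlongrightarrow> 0) (at z)"
    by presburger
qed

lemma has_deriv_in_mult:
  assumes S: "seminormed X" and U: "open U" "z \<in> U"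
    and g: "\<And>w. w \<in> U \<Longrightarrow> g w \<in> elems X"
    and d: "has_deriv_in X g d z" and f: "(f has_field_derivative f') (at z)"
  shows "has_deriv_in X (\<lambda>w t. f w * g w t) (\<lambda>t. f z * d t + f' * g z t) z"
  unfolding has_deriv_in_def
proof
  note dE = has_deriv_in_elems[OF d] and gz = g[OF U(2)]
  show "(\<lambda>t. f z * d t + f' * g z t) \<in> elems X"
    by (intro seminormed_add[OF S] seminormed_scale[OF S] dE gz)
  have ev: "\<forall>\<^sub>F w in at z. w \<in> U" by (rule eventually_at_in_open'[OF U])
  have fc: "(f \<longlongrightarrow> f z) (at z)"
    using DERIV_isCont[OF f] by (simp add: isCont_def)
  have fq: "((\<lambda>w. (f w - f z) / (w - z)) \<longlongrightarrow> f') (at z)"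
    using f by (simp add: has_field_derivative_iff)
  have evq: "\<forall>\<^sub>F w in at z. (\<lambda>t. (g w t - g z t) / (w - z)) \<in> elems X"
    using ev by eventually_elim (intro difference_quotient_elems[where g=g, OF S] g gz)
  have 1: "((\<lambda>w. nrm X (\<lambda>t. f w * ((g w t - g z t) / (w - z)) - f z * d t)) \<longlongrightarrow> 0) (at z)"
    using d unfolding has_deriv_in_def
    by (intro nrm_tendsto_mult[where g="\<lambda>w t. (g w t - g z t) / (w - z)", OF S evq dE _ fc]) blast
  have 2: "((\<lambda>w. nrm X (\<lambda>t. (f w - f z) / (w - z) * g z t - f' * g z t)) \<longlongrightarrow> 0) (at z)"
    using nrm_zero[OF S]
    by (intro nrm_tendsto_mult[where g="\<lambda>_. g z", OF S _ gz _ fq]) (simp_all add: gz)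
  have "((\<lambda>w. nrm X (\<lambda>t. (f w * ((g w t - g z t) / (w - z)) + (f w - f z) / (w - z) * g z t)
      - (f z * d t + f' * g z t))) \<longlongrightarrow> 0) (at z)"
  proof (rule nrm_tendsto_add[OF S _ _ _ _ 1 2])
    show "\<forall>\<^sub>F w in at z. (\<lambda>t. f w * ((g w t - g z t) / (w - z))) \<in> elems X"
      using evq by eventually_elim (rule seminormed_scale[OF S])
    show "\<forall>\<^sub>F w in at z. (\<lambda>t. (f w - f z) / (w - z) * g z t) \<in> elems X"
      by (intro always_eventually allI seminormed_scale[OF S gz])
  qed (intro seminormed_scale[OF S] dE gz)+
  moreover have "(f w * g w t - f z * g z t) / (w - z)
      = f w * ((g w t - g z t) / (w - z)) + (f w - f z) / (w - z) * g z t" for w t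
    by (simp add: add_divide_distrib[symmetric] algebra_simps)
  ultimately show "((\<lambda>w. nrm X (\<lambda>t. (f w * g w t - f z * g z t) / (w - z)
      - (f z * d t + f' * g z t))) \<longlongrightarrow> 0) (at z)"
    by presburger
qed

lemma has_deriv_in_mono:
  assumes S: "seminormed X" and U: "open U" "z \<in> U" and d: "has_deriv_in X g d z" and e: "e \<in> elems X"
    and le: "\<And>w. w \<in> U \<Longrightarrow> w \<noteq> z \<Longrightarrow>
      (\<lambda>t. (h w t - h z t) / (w - z) - e t) \<in> elems X \<and>
      nrm X (\<lambda>t. (h w t - h z t) / (w - z) - e t) \<le> nrm X (\<lambda>t. (g w t - g z t) / (w - z) - d t)"
  shows "has_deriv_in X h e z"
  unfolding has_deriv_in_def
proof
  have "\<forall>\<^sub>F w in at z. w \<in> U \<and> w \<noteq> z"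
    using eventually_at_in_open[OF U] by (auto elim: eventually_mono)
  then have ev: "\<forall>\<^sub>F w in at z. (\<lambda>t. (h w t - h z t) / (w - z) - e t) \<in> elems X \<and>
      nrm X (\<lambda>t. (h w t - h z t) / (w - z) - e t) \<le> nrm X (\<lambda>t. (g w t - g z t) / (w - z) - d t)"
    by eventually_elim (rule le; simp)
  show "((\<lambda>w. nrm X (\<lambda>t. (h w t - h z t) / (w - z) - e t)) \<longlongrightarrow> 0) (at z)"
    by (rule nrm_tendsto_mono[OF S ev]) (use d in \<open>simp add: has_deriv_in_def\<close>)
qed (rule e)

lemma has_deriv_in_multiplier:
  assumes X: "solid_space M X" and U: "open U" "z \<in> U"
    and g: "\<And>w. w \<in> U \<Longrightarrow> g w \<in> elems X" and d: "has_deriv_in X g d z"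
    and u: "u \<in> borel_measurable M" "\<And>t. cmod (u t) \<le> 1"
  shows "has_deriv_in X (\<lambda>w t. u t * g w t) (\<lambda>t. u t * d t) z"
proof (rule has_deriv_in_mono[OF solid_seminormed[OF X] U d])
  note S = solid_seminormed[OF X]
  show "(\<lambda>t. u t * d t) \<in> elems X" by (rule solid_multiplier[OF X has_deriv_in_elems[OF d] u])
  fix w assume w: "w \<in> U"
  let ?v = "\<lambda>t. (g w t - g z t) / (w - z) - d t"
  have v: "?v \<in> elems X"
    by (intro seminormed_diff[OF S] difference_quotient_elems[OF S] g w U(2) has_deriv_in_elems[OF d])
  have "(\<lambda>t. (u t * g w t - u t * g z t) / (w - z) - u t * d t) = (\<lambda>t. u t * ?v t)"
    by (simp add: fun_eq_iff right_diff_distrib)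
  then show "(\<lambda>t. (u t * g w t - u t * g z t) / (w - z) - u t * d t) \<in> elems X \<and>
      nrm X (\<lambda>t. (u t * g w t - u t * g z t) / (w - z) - u t * d t) \<le> nrm X ?v"
    using solid_multiplier[OF X v u] nrm_multiplier[OF X v u] by simp
qed

lemma has_deriv_in_AE_eq:
  assumes X: "solid_space M X" and U: "open U" "z \<in> U"
    and g: "\<And>w. w \<in> U \<Longrightarrow> g w \<in> elems X" and d: "has_deriv_in X g d z"
    and h: "\<And>w. w \<in> U \<Longrightarrow> h w \<in> borel_measurable M" "\<And>w. w \<in> U \<Longrightarrow> AE t in M. h w t = g w t"
  shows "has_deriv_in X h d z"
proof (rule has_deriv_in_mono[OF solid_seminormed[OF X] U d has_deriv_in_elems[OF d]])
  note S = solid_seminormed[OF X]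
  fix w assume w: "w \<in> U"
  let ?v = "\<lambda>t. (g w t - g z t) / (w - z) - d t"
  have v: "?v \<in> elems X"
    by (intro seminormed_diff[OF S] difference_quotient_elems[OF S] g w U(2) has_deriv_in_elems[OF d])
  have "d \<in> borel_measurable M" by (rule solid_measurable[OF X has_deriv_in_elems[OF d]])
  then have "(\<lambda>t. (h w t - h z t) / (w - z) - d t) \<in> borel_measurable M"
    using h(1)[OF w] h(1)[OF U(2)] by measurable
  moreover have "AE t in M. (h w t - h z t) / (w - z) - d t = ?v t"
    using h(2)[OF w] h(2)[OF U(2)] by eventually_elim simp
  ultimately show "(\<lambda>t. (h w t - h z t) / (w - z) - d t) \<in> elems X \<and>
      nrm X (\<lambda>t. (h w t - h z t) / (w - z) - d t) \<le> nrm X ?v"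
    using solid_AE_eq[OF X v] nrm_AE_eq[OF X v] by simp
qed

text \<open>Composed with a norming functional, differentiability in a seminormed space becomes
  ordinary holomorphy.\<close>

lemma bounded_functional_has_field_derivative:
  fixes \<phi> :: "('b \<Rightarrow> complex) \<Rightarrow> complex"
  assumes S: "seminormed X" and U: "open U" "z \<in> U"
    and g: "\<And>w. w \<in> U \<Longrightarrow> g w \<in> elems X" and d: "has_deriv_in X g d z"
    and add: "\<And>x y. x \<in> elems X \<Longrightarrow> y \<in> elems X \<Longrightarrow> \<phi> (\<lambda>t. x t + y t) = \<phi> x + \<phi> y"
    and scale: "\<And>c x. x \<in> elems X \<Longrightarrow> \<phi> (\<lambda>t. c * x t) = c * \<phi> x"
    and le: "\<And>x. x \<in> elems X \<Longrightarrow> cmod (\<phi> x) \<le> nrm X x"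
  shows "((\<lambda>w. \<phi> (g w)) has_field_derivative \<phi> d) (at z)"
proof -
  have diff: "\<phi> (\<lambda>t. x t - y t) = \<phi> x - \<phi> y" if "x \<in> elems X" "y \<in> elems X" for x y
    using add[OF that(1) seminormed_uminus[OF S that(2)]] scale[OF that(2), of "-1"] by simp
  have "((\<lambda>w. (\<phi> (g w) - \<phi> (g z)) / (w - z) - \<phi> d) \<longlongrightarrow> 0) (at z)"
  proof (rule Lim_null_comparison)
    show "\<forall>\<^sub>F w in at z. norm ((\<phi> (g w) - \<phi> (g z)) / (w - z) - \<phi> d)
        \<le> nrm X (\<lambda>t. (g w t - g z t) / (w - z) - d t)"
      using eventually_at_in_open'[OF U]
    proof eventually_elim
      case (elim w)
      note q = difference_quotient_elems[where g=g, OF S g[OF elim] g[OF U(2)]]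
      have "\<phi> (\<lambda>t. (g w t - g z t) / (w - z)) = (\<phi> (g w) - \<phi> (g z)) / (w - z)"
        using scale[OF seminormed_diff[OF S g[OF elim] g[OF U(2)]], of "1 / (w - z)"]
          diff[OF g[OF elim] g[OF U(2)]] by simp
      then show ?case
        using le[OF seminormed_diff[OF S q has_deriv_in_elems[OF d]]]
          diff[OF q has_deriv_in_elems[OF d]] by simp
    qed
  qed (use d in \<open>simp add: has_deriv_in_def\<close>)
  then show ?thesis
    unfolding has_field_derivative_iff using LIM_zero_iff by blast
qed

section \<open>The Calderon space\<close>

lemma open_strip_subset_interior: "{z. 0 < Re z \<and> Re z < 1} \<subseteq> interior strip"
proof (rule interior_maximal)
  show "open {z. 0 < Re z \<and> Re z < 1}"
    using open_Int[OF open_halfspace_Re_gt[of 0] open_halfspace_Re_lt[of 1]]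
    by (simp add: Int_def)
qed (auto simp: strip_def)

lemma interior_strip_subset: "z \<in> interior strip \<Longrightarrow> z \<in> strip"
  using interior_subset by blast

lemma cball_subset_interior_strip:
  assumes "R < \<theta>" "R < 1 - \<theta>"
  shows "cball (of_real \<theta>) R \<subseteq> interior strip"
proof -
  have "0 < Re z \<and> Re z < 1" if "z \<in> cball (of_real \<theta>) R" for z
  proof -
    have "\<bar>\<theta> - Re z\<bar> \<le> R"
      using that abs_Re_le_cmod[of "of_real \<theta> - z"] by (simp add: dist_norm)
    then show ?thesis using assms by linarith
  qed
  then show ?thesis using open_strip_subset_interior by blast
qed

lemma of_real_in_strip:
  assumes "0 < \<theta>" "\<theta> < 1"
  shows of_real_in_interior_strip: "complex_of_real \<theta> \<in> interior strip"
    and "complex_of_real \<theta> \<in> strip"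
  using assms open_strip_subset_interior by (auto simp: strip_def)

locale kothe_couple =
  fixes M :: "'a measure" and X0 X1 :: "'a fspace"
  assumes kothe0: "kothe_space M X0" and kothe1: "kothe_space M X1"
begin

abbreviation E :: "'a fspace" where "E \<equiv> sum_space M X0 X1"
abbreviation \<H> :: "(complex \<Rightarrow> 'a \<Rightarrow> complex) set" where "\<H> \<equiv> calderon M X0 X1"
abbreviation \<H>_norm :: "(complex \<Rightarrow> 'a \<Rightarrow> complex) \<Rightarrow> real" where "\<H>_norm \<equiv> calderon_norm X0 X1"

lemmas solid0 = kothe_imp_solid[OF kothe0] and solid1 = kothe_imp_solid[OF kothe1]
lemmas solidE = sum_space_solid[OF solid0 solid1]
lemmas semi0 = solid_seminormed[OF solid0] and semi1 = solid_seminormed[OF solid1]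
  and semiE = solid_seminormed[OF solidE]

lemma calderonD:
  assumes "g \<in> \<H>"
  shows "bdd_cont_into E strip g"
    and "z \<in> interior strip \<Longrightarrow> \<exists>d. has_deriv_in E g d z"
    and "bdd_cont_into X0 UNIV (\<lambda>t. g (Complex 0 t))"
    and "bdd_cont_into X1 UNIV (\<lambda>t. g (Complex 1 t))"
  using assms unfolding calderon_def by blast+

lemma calderonI:
  assumes "bdd_cont_into E strip g"
    and "\<And>z. z \<in> interior strip \<Longrightarrow> \<exists>d. has_deriv_in E g d z"
    and "bdd_cont_into X0 UNIV (\<lambda>t. g (Complex 0 t))"
    and "bdd_cont_into X1 UNIV (\<lambda>t. g (Complex 1 t))"
  shows "g \<in> \<H>"
  using assms unfolding calderon_def by blast

lemma
  assumes "g \<in> \<H>"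
  shows calderon_elems: "z \<in> strip \<Longrightarrow> g z \<in> elems E"
    and calderon_elems0: "g (Complex 0 s) \<in> elems X0"
    and calderon_elems1: "g (Complex 1 s) \<in> elems X1"
  using bdd_cont_intoD(1)[OF calderonD(1)[OF assms]] bdd_cont_intoD(1)[OF calderonD(3)[OF assms]]
    bdd_cont_intoD(1)[OF calderonD(4)[OF assms]] by auto

lemma calderon_measurable: "g \<in> \<H> \<Longrightarrow> z \<in> strip \<Longrightarrow> g z \<in> borel_measurable M"
  by (rule solid_measurable[OF solidE calderon_elems])

lemma
  assumes "g \<in> \<H>"
  shows calderon_norm_ge0: "nrm X0 (g (Complex 0 s)) \<le> \<H>_norm g"
    and calderon_norm_ge1: "nrm X1 (g (Complex 1 s)) \<le> \<H>_norm g"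
proof -
  obtain C D where CD: "\<And>s. nrm X0 (g (Complex 0 s)) \<le> C" "\<And>s. nrm X1 (g (Complex 1 s)) \<le> D"
    using bdd_cont_intoD(2)[OF calderonD(3)[OF assms]] bdd_cont_intoD(2)[OF calderonD(4)[OF assms]]
    by blast
  have "bdd_above (range (\<lambda>t. nrm X0 (g (Complex 0 t))) \<union> range (\<lambda>t. nrm X1 (g (Complex 1 t))))"
    unfolding bdd_above_Un by (rule conjI[OF bdd_aboveI2[OF CD(1)] bdd_aboveI2[OF CD(2)]])
  then show "nrm X0 (g (Complex 0 s)) \<le> \<H>_norm g" "nrm X1 (g (Complex 1 s)) \<le> \<H>_norm g"
    unfolding calderon_norm_def by (auto intro: cSup_upper)
qed

lemma calderon_norm_leI:
  assumes "\<And>s. nrm X0 (g (Complex 0 s)) \<le> B" "\<And>s. nrm X1 (g (Complex 1 s)) \<le> B"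
  shows "\<H>_norm g \<le> B"
  unfolding calderon_norm_def using assms by (intro cSup_least) auto

lemma calderon_norm_nonneg: "g \<in> \<H> \<Longrightarrow> 0 \<le> \<H>_norm g"
  using calderon_norm_ge0 nrm_nonneg[OF semi0 calderon_elems0] order_trans by blast

lemma
  assumes g: "g \<in> \<H>" and h: "h \<in> \<H>"
  shows calderon_add: "(\<lambda>z t. g z t + h z t) \<in> \<H>"
    and calderon_norm_add: "\<H>_norm (\<lambda>z t. g z t + h z t) \<le> \<H>_norm g + \<H>_norm h"
proof -
  show "(\<lambda>z t. g z t + h z t) \<in> \<H>"
  proof (rule calderonI)
    fix z assume z: "z \<in> interior strip"
    obtain d e where "has_deriv_in E g d z" "has_deriv_in E h e z"
      using calderonD(2)[OF g z] calderonD(2)[OF h z] by blast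
    then show "\<exists>d. has_deriv_in E (\<lambda>z t. g z t + h z t) d z"
      using has_deriv_in_add[OF semiE open_interior z, of g h] calderon_elems[OF g]
        calderon_elems[OF h] interior_strip_subset by blast
  qed (intro bdd_cont_into_add semiE semi0 semi1 calderonD[OF g] calderonD[OF h])+
  show "\<H>_norm (\<lambda>z t. g z t + h z t) \<le> \<H>_norm g + \<H>_norm h"
  proof (rule calderon_norm_leI)
    fix s
    show "nrm X0 (\<lambda>t. g (Complex 0 s) t + h (Complex 0 s) t) \<le> \<H>_norm g + \<H>_norm h"
      using seminormed_triangle[OF semi0 calderon_elems0[OF g] calderon_elems0[OF h], of s s]
        calderon_norm_ge0[OF g, of s] calderon_norm_ge0[OF h, of s] by simp
    show "nrm X1 (\<lambda>t. g (Complex 1 s) t + h (Complex 1 s) t) \<le> \<H>_norm g + \<H>_norm h"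
      using seminormed_triangle[OF semi1 calderon_elems1[OF g] calderon_elems1[OF h], of s s]
        calderon_norm_ge1[OF g, of s] calderon_norm_ge1[OF h, of s] by simp
  qed
qed

lemma calderon_mult:
  assumes g: "g \<in> \<H>" and f: "continuous_on strip f" "\<And>z. z \<in> strip \<Longrightarrow> cmod (f z) \<le> K"
    and f': "\<And>z. z \<in> interior strip \<Longrightarrow> f field_differentiable at z"
  shows "(\<lambda>z t. f z * g z t) \<in> \<H>"
proof (rule calderonI)
  show "bdd_cont_into E strip (\<lambda>z t. f z * g z t)"
    by (rule bdd_cont_into_mult[OF semiE calderonD(1)[OF g] f])
  have C: "continuous_on UNIV (\<lambda>t. f (Complex j t))" and K: "cmod (f (Complex j t)) \<le> K"
    if "0 \<le> j" "j \<le> 1" for j t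
    using that
    by (auto intro!: continuous_on_compose2[OF f(1)] f(2) continuous_intros simp: strip_def Complex_eq)
  show "bdd_cont_into X0 UNIV (\<lambda>s t. f (Complex 0 s) * g (Complex 0 s) t)"
    by (rule bdd_cont_into_mult[OF semi0 calderonD(3)[OF g] C K]) auto
  show "bdd_cont_into X1 UNIV (\<lambda>s t. f (Complex 1 s) * g (Complex 1 s) t)"
    by (rule bdd_cont_into_mult[OF semi1 calderonD(4)[OF g] C K]) auto
  fix z assume z: "z \<in> interior strip"
  obtain d where d: "has_deriv_in E g d z" using calderonD(2)[OF g z] by blast
  obtain e where "(f has_field_derivative e) (at z)"
    using f'[OF z] unfolding field_differentiable_def by blast
  from has_deriv_in_mult[OF semiE open_interior z _ d this]
  show "\<exists>d. has_deriv_in E (\<lambda>z t. f z * g z t) d z"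
    using calderon_elems[OF g] interior_strip_subset by blast
qed

lemma
  assumes g: "g \<in> \<H>"
  shows calderon_scale: "(\<lambda>z t. c * g z t) \<in> \<H>"
    and calderon_norm_scale: "\<H>_norm (\<lambda>z t. c * g z t) \<le> cmod c * \<H>_norm g"
proof -
  show "(\<lambda>z t. c * g z t) \<in> \<H>"
    by (rule calderon_mult[OF g, of "\<lambda>_. c" "cmod c"]) auto
  show "\<H>_norm (\<lambda>z t. c * g z t) \<le> cmod c * \<H>_norm g"
    by (rule calderon_norm_leI)
      (auto simp: nrm_scale[OF semi0 calderon_elems0[OF g]] nrm_scale[OF semi1 calderon_elems1[OF g]]
        intro!: mult_left_mono calderon_norm_ge0[OF g] calderon_norm_ge1[OF g])
qed

lemma
  assumes g: "g \<in> \<H>" and u: "u \<in> borel_measurable M" "\<And>t. cmod (u t) \<le> 1"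
  shows calderon_multiplier: "(\<lambda>z t. u t * g z t) \<in> \<H>"
    and calderon_norm_multiplier: "\<H>_norm (\<lambda>z t. u t * g z t) \<le> \<H>_norm g"
proof -
  show "(\<lambda>z t. u t * g z t) \<in> \<H>"
  proof (rule calderonI)
    fix z assume z: "z \<in> interior strip"
    obtain d where d: "has_deriv_in E g d z" using calderonD(2)[OF g z] by blast
    from has_deriv_in_multiplier[OF solidE open_interior z _ d u]
    show "\<exists>d. has_deriv_in E (\<lambda>z t. u t * g z t) d z"
      using calderon_elems[OF g] interior_strip_subset by blast
  qed (rule bdd_cont_into_multiplier[OF _ _ u] solidE solid0 solid1 calderonD[OF g])+
  show "\<H>_norm (\<lambda>z t. u t * g z t) \<le> \<H>_norm g"
  proof (rule calderon_norm_leI)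
    fix s
    show "nrm X0 (\<lambda>t. u t * g (Complex 0 s) t) \<le> \<H>_norm g"
      by (rule order_trans[OF nrm_multiplier[OF solid0 calderon_elems0[OF g] u]
          calderon_norm_ge0[OF g]])
    show "nrm X1 (\<lambda>t. u t * g (Complex 1 s) t) \<le> \<H>_norm g"
      by (rule order_trans[OF nrm_multiplier[OF solid1 calderon_elems1[OF g] u]
          calderon_norm_ge1[OF g]])
  qed
qed

text \<open>Membership in \<open>interp_space\<close> is defined through exact values at
  \<open>\<theta>\<close>. This permits exchanging one value of \<open>g\<close> for another
  representative of its class.\<close>

lemma calderon_AE_eq:
  assumes g: "g \<in> \<H>" and h: "\<And>z. z \<in> strip \<Longrightarrow> h z \<in> borel_measurable M"
    and eq: "\<And>z. z \<in> strip \<Longrightarrow> AE t in M. h z t = g z t"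
  shows "h \<in> \<H>"
proof (rule calderonI)
  have bd: "Complex 0 s \<in> strip" "Complex 1 s \<in> strip" for s by (auto simp: strip_def)
  show "bdd_cont_into E strip h" by (rule bdd_cont_into_AE_eq[OF solidE calderonD(1)[OF g] h eq])
  show "bdd_cont_into X0 UNIV (\<lambda>t. h (Complex 0 t))"
    by (rule bdd_cont_into_AE_eq[OF solid0 calderonD(3)[OF g] h[OF bd(1)] eq[OF bd(1)]])
  show "bdd_cont_into X1 UNIV (\<lambda>t. h (Complex 1 t))"
    by (rule bdd_cont_into_AE_eq[OF solid1 calderonD(4)[OF g] h[OF bd(2)] eq[OF bd(2)]])
  fix z assume z: "z \<in> interior strip"
  obtain d where d: "has_deriv_in E g d z" using calderonD(2)[OF g z] by blast
  have "has_deriv_in E h d z"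
    by (rule has_deriv_in_AE_eq[OF solidE open_interior z _ d])
      (auto intro: calderon_elems[OF g] h eq interior_strip_subset)
  then show "\<exists>d. has_deriv_in E h d z" by blast
qed

lemma calderon_zero: "(\<lambda>_ _. 0) \<in> \<H>"
  by (rule calderonI)
    (auto simp: bdd_cont_into_def has_deriv_in_def nrm_zero semiE semi0 semi1 seminormed_zero
      intro!: exI[of _ "\<lambda>_. 0"])

lemma calderon_sum:
  assumes "finite I" "\<And>i. i \<in> I \<Longrightarrow> g i \<in> \<H>"
  shows "(\<lambda>z t. \<Sum>i\<in>I. g i z t) \<in> \<H>"
  using assms by (induction I rule: finite_induct) (auto simp: calderon_zero intro!: calderon_add)

text \<open>Since \<open>E\<close> is not a type, the second derivative at \<open>\<theta>\<close> cannot be taken from the scalar theory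
  directly; instead norming functionals transfer a uniform Lipschitz estimate for the second
  difference quotients, and completeness of \<open>E\<close> gives their limit.\<close>

lemma calderon_second_difference_Lipschitz:
  assumes \<theta>: "0 < \<theta>" "\<theta> < 1" and H: "H \<in> \<H>" and H0: "AE t in M. H (of_real \<theta>) t = 0"
    and d: "has_deriv_in E H d (of_real \<theta>)"
  obtains R C where "0 < R" "cball (of_real \<theta>) R \<subseteq> interior strip"
    "\<And>z w. dist (of_real \<theta>) z \<le> R / 2 \<Longrightarrow> z \<noteq> of_real \<theta> \<Longrightarrow>
       dist (of_real \<theta>) w \<le> R / 2 \<Longrightarrow> w \<noteq> of_real \<theta> \<Longrightarrow>
       nrm E (\<lambda>t. (H z t / (z - of_real \<theta>) - d t) / (z - of_real \<theta>)
                - (H w t / (w - of_real \<theta>) - d t) / (w - of_real \<theta>)) \<le> C * cmod (z - w)"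
proof -
  define a where "a = complex_of_real \<theta>"
  \<comment> \<open>Half the distance from \<open>\<theta>\<close> to the boundary of the strip, so
    that the closed disc lies in the interior.\<close>
  define R where "R = min \<theta> (1 - \<theta>) / 2"
  have R: "0 < R" "R < \<theta>" "R < 1 - \<theta>" using \<theta> by (auto simp: R_def min_def)
  have cball: "cball a R \<subseteq> interior strip"
    unfolding a_def by (rule cball_subset_interior_strip[OF R(2,3)])
  obtain B where B: "\<And>z. z \<in> strip \<Longrightarrow> nrm E (H z) \<le> B"
    using bdd_cont_intoD(2)[OF calderonD(1)[OF H]] by blast
  have HE: "H z \<in> elems E" if "z \<in> interior strip" for z
    using calderon_elems[OF H] interior_strip_subset that by blast
  have a: "a \<in> interior strip" using cball R(1) by auto
  have "nrm E (\<lambda>t. (H z t / (z - a) - d t) / (z - a) - (H w t / (w - a) - d t) / (w - a))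
      \<le> 64 * B / R ^ 3 * cmod (z - w)"
    if z: "dist a z \<le> R / 2" "z \<noteq> a" and w: "dist a w \<le> R / 2" "w \<noteq> a" for z w
  proof -
    have zw: "z \<in> interior strip" "w \<in> interior strip" using z w cball R(1) by auto
    note dE = has_deriv_in_elems[OF d]
    \<comment> \<open>The second difference quotient of \<open>H\<close> at \<open>a\<close>, with
      divisions written as scalar multiples so that a linear functional can be moved through
      it.\<close>
    define D where "D z t = 1 / (z - a) * (1 / (z - a) * H z t - d t)" for z t
    have DE: "D z \<in> elems E" if "z \<in> interior strip" for z
      unfolding D_def by (intro seminormed_scale[OF semiE] seminormed_diff[OF semiE] HE that dE)
    \<comment> \<open>The functional depends on \<open>z\<close> and \<open>w\<close>, but only its
      contractivity enters the scalar estimate, so the Lipschitz constant does not.\<close>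
    obtain \<phi> where add: "\<And>x y. x \<in> elems E \<Longrightarrow> y \<in> elems E \<Longrightarrow> \<phi> (\<lambda>t. x t + y t) = \<phi> x + \<phi> y"
      and scale: "\<And>c x. x \<in> elems E \<Longrightarrow> \<phi> (\<lambda>t. c * x t) = c * \<phi> x"
      and le: "\<And>x. x \<in> elems E \<Longrightarrow> cmod (\<phi> x) \<le> nrm E x"
      and \<phi>: "\<phi> (\<lambda>t. D z t - D w t) = nrm E (\<lambda>t. D z t - D w t)"
      by (rule norming_functional[OF semiE seminormed_diff[OF semiE DE[OF zw(1)] DE[OF zw(2)]]]) blast
    have diff: "\<phi> (\<lambda>t. x t - y t) = \<phi> x - \<phi> y" if "x \<in> elems E" "y \<in> elems E" for x y
      using add[OF that(1) seminormed_uminus[OF semiE that(2)]] scale[OF that(2), of "-1"] by simp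
    define h where "h z = \<phi> (H z)" for z
    have h': "(h has_field_derivative \<phi> e) (at v)"
      if "v \<in> interior strip" "has_deriv_in E H e v" for v e
      unfolding h_def
      by (rule bounded_functional_has_field_derivative[OF semiE open_interior that(1) HE that(2)
            add scale le])
    have hol: "h holomorphic_on interior strip"
      unfolding holomorphic_on_open[OF open_interior] using h' calderonD(2)[OF H] by blast
    have deriv: "deriv h a = \<phi> d" using h'[OF a] d by (simp add: a_def DERIV_imp_deriv)
    \<comment> \<open>\<open>H\<close> vanishes at \<open>a\<close> only almost everywhere; the
      functional sees an exact zero because it is dominated by the seminorm.\<close>
    have "nrm E (H a) = 0" using nrm_AE_zero[OF solidE HE[OF a]] H0 by (simp add: a_def)
    then have ha: "h a = 0" using le[OF HE[OF a]] by (simp add: h_def)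
    have hB: "cmod (h v) \<le> B" if "v \<in> cball a R" for v
      using le[OF HE, of v] B[of v] that cball interior_strip_subset unfolding h_def
      by (meson order_trans subsetD)
    have \<phi>D: "\<phi> (D v) = ((h v - h a) / (v - a) - deriv h a) / (v - a)" if "v \<in> interior strip" for v
    proof -
      note s = seminormed_scale[OF semiE HE[OF that], of "1 / (v - a)"]
      have "\<phi> (D v) = 1 / (v - a) * (1 / (v - a) * h v - \<phi> d)"
        unfolding D_def h_def
        by (simp only: scale[OF seminormed_diff[OF semiE s dE]] diff[OF s dE] scale[OF HE[OF that]])
      then show ?thesis by (simp add: ha deriv)
    qed
    have "nrm E (\<lambda>t. D z t - D w t) \<le> cmod (\<phi> (\<lambda>t. D z t - D w t))" unfolding \<phi> by simp
    also have "\<dots> = cmod (\<phi> (D z) - \<phi> (D w))"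
      using diff[OF DE DE] zw by simp
    also have "\<dots> \<le> 64 * B / R ^ 3 * cmod (z - w)"
      unfolding \<phi>D[OF zw(1)] \<phi>D[OF zw(2)]
      by (rule second_difference_quotient_Lipschitz[OF open_interior cball hol hB R(1) z w])
    finally show ?thesis by (simp add: D_def)
  qed
  then show thesis using that[of R] R(1) cball unfolding a_def by blast
qed

text \<open>Along points approaching \<open>\<theta>\<close> geometrically the Lipschitz estimate
  makes the second quotients a geometric Cauchy sequence. The limit \<open>l\<close> will be the
  derivative at \<open>\<theta>\<close> of \<open>H\<close> divided by
  \<open>z - \<theta>\<close>.\<close>

lemma calderon_second_difference_converges:
  assumes \<theta>: "0 < \<theta>" "\<theta> < 1" and H: "H \<in> \<H>" and H0: "AE t in M. H (of_real \<theta>) t = 0"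
    and d: "has_deriv_in E H d (of_real \<theta>)"
  obtains l where "l \<in> elems E"
    "((\<lambda>z. nrm E (\<lambda>t. (H z t / (z - of_real \<theta>) - d t) / (z - of_real \<theta>) - l t)) \<longlongrightarrow> 0)
       (at (of_real \<theta>))"
proof -
  define a where "a = complex_of_real \<theta>"
  define D where "D z t = (H z t / (z - a) - d t) / (z - a)" for z t
  obtain R C where R: "0 < R" "cball a R \<subseteq> interior strip"
    and Lip: "\<And>z w. dist a z \<le> R / 2 \<Longrightarrow> z \<noteq> a \<Longrightarrow> dist a w \<le> R / 2 \<Longrightarrow> w \<noteq> a \<Longrightarrow>
       nrm E (\<lambda>t. D z t - D w t) \<le> C * cmod (z - w)"
    unfolding D_def a_def by (rule calderon_second_difference_Lipschitz[OF assms]) blast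
  note dE = has_deriv_in_elems[OF d]
  have DE: "D z \<in> elems E" if "dist a z \<le> R / 2" for z
  proof -
    have "z \<in> interior strip" using that R by auto
    then have "(\<lambda>t. 1 / (z - a) * (1 / (z - a) * H z t - d t)) \<in> elems E"
      using calderon_elems[OF H] interior_strip_subset
      by (intro seminormed_scale[OF semiE] seminormed_diff[OF semiE] dE) blast
    then show ?thesis by (simp add: D_def[abs_def])
  qed
  \<comment> \<open>The points start at distance \<open>R / 2\<close>, the edge of the region of the
    Lipschitz estimate; halving the distance makes consecutive points differ by
    \<open>R / 4 * (1/2) ^ k\<close>.\<close>
  define w where "w k = a + of_real (R / 2 * (1/2) ^ k)" for k :: nat
  have w: "dist a (w k) \<le> R / 2" "w k \<noteq> a" for k
  proof -
    have "dist a (w k) = R / 2 * (1/2) ^ k" using R(1) by (simp add: w_def dist_norm norm_mult norm_power)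
    then show "dist a (w k) \<le> R / 2" "w k \<noteq> a"
      using R(1) power_le_one[of "1/2::real" k] by auto
  qed
  have step: "nrm E (\<lambda>t. D (w (Suc k)) t - D (w k) t) \<le> (C * (R / 4)) * (1/2) ^ k" for k
  proof -
    have "w (Suc k) - w k = - of_real (R / 4 * (1/2) ^ k)" by (simp add: w_def)
    then have "cmod (w (Suc k) - w k) = R / 4 * (1/2) ^ k"
      using R(1) by (simp add: norm_mult norm_power)
    then show ?thesis using Lip[OF w w, of "Suc k" k] by (simp only: mult.assoc)
  qed
  obtain l where l: "l \<in> elems E" "(\<lambda>k. nrm E (\<lambda>t. D (w k) t - l t)) \<longlonglongrightarrow> 0"
    by (rule sum_space_geometric_Cauchy_converges[OF kothe0 kothe1 DE[OF w(1)] step])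
  \<comment> \<open>Compare \<open>D z\<close> with \<open>D (w k)\<close> and let \<open>k\<close>
    tend to infinity: the limit along the sequence is thereby a limit along all
    \<open>z\<close>.\<close>
  have bound: "nrm E (\<lambda>t. D z t - l t) \<le> C * cmod (z - a)" if z: "dist a z \<le> R / 2" "z \<noteq> a" for z
  proof (rule LIMSEQ_le_const)
    have wa: "w \<longlonglongrightarrow> a"
    proof -
      have "(\<lambda>k. a + of_real (R / 2 * (1/2) ^ k)) \<longlonglongrightarrow> a + of_real (R / 2 * 0)"
        by (intro tendsto_intros LIMSEQ_power_zero) simp
      then show ?thesis by (simp add: w_def[abs_def])
    qed
    have "(\<lambda>k. C * cmod (z - w k) + nrm E (\<lambda>t. D (w k) t - l t)) \<longlonglongrightarrow> C * cmod (z - a) + 0"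
      by (intro tendsto_intros l(2) wa)
    then show "(\<lambda>k. C * cmod (z - w k) + nrm E (\<lambda>t. D (w k) t - l t)) \<longlonglongrightarrow> C * cmod (z - a)"
      by simp
    have "nrm E (\<lambda>t. D z t - l t) \<le> C * cmod (z - w k) + nrm E (\<lambda>t. D (w k) t - l t)" for k
      using seminormed_triangle[OF semiE seminormed_diff[OF semiE DE DE]
          seminormed_diff[OF semiE DE l(1)], of z "w k" "w k"] z(1) w(1)[of k] Lip[OF z w, of k] by simp
    then show "\<exists>N. \<forall>n\<ge>N. nrm E (\<lambda>t. D z t - l t)
        \<le> C * cmod (z - w n) + nrm E (\<lambda>t. D (w n) t - l t)" by blast
  qed
  have "((\<lambda>z. nrm E (\<lambda>t. D z t - l t)) \<longlongrightarrow> 0) (at a)"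
  proof (rule Lim_null_comparison)
    have "\<forall>\<^sub>F z in at a. z \<in> ball a (R / 2) - {a}"
      using R(1) by (intro eventually_at_in_open) auto
    then show "\<forall>\<^sub>F z in at a. norm (nrm E (\<lambda>t. D z t - l t)) \<le> C * cmod (z - a)"
    proof eventually_elim
      case (elim z)
      then have z: "dist a z \<le> R / 2" "z \<noteq> a" by auto
      then show ?case
        using bound[OF z] nrm_nonneg[OF semiE seminormed_diff[OF semiE DE[OF z(1)] l(1)]] by simp
    qed
    have "((\<lambda>z. C * cmod (z - a)) \<longlongrightarrow> C * cmod (a - a)) (at a)" by (intro tendsto_intros)
    then show "((\<lambda>z. C * cmod (z - a)) \<longlongrightarrow> 0) (at a)" by simp
  qed
  then show thesis using that[OF l(1)] by (simp add: D_def[abs_def] a_def)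
qed

end

section \<open>The interpolation space\<close>

lemma
  assumes S: "seminormed X" and x: "\<And>i. i < n \<Longrightarrow> x i \<in> elems X"
    and disj: "\<And>i j. i < n \<Longrightarrow> j < n \<Longrightarrow> i \<noteq> j \<Longrightarrow> disjoint_supp M (x i) (x j)"
  shows nrm_sum_le_M_fun:
      "(\<And>i. i < n \<Longrightarrow> nrm X (x i) \<le> 1) \<Longrightarrow> nrm X (\<lambda>t. \<Sum>i<n. x i t) \<le> M_fun M X n"
    and nrm_sum_le_mult_M_fun:
      "0 < K \<Longrightarrow> (\<And>i. i < n \<Longrightarrow> nrm X (x i) \<le> K) \<Longrightarrow> nrm X (\<lambda>t. \<Sum>i<n. x i t) \<le> K * M_fun M X n"
proof -
  have unit: "nrm X (\<lambda>t. \<Sum>i<n. y i t) \<le> M_fun M X n"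
    if y: "\<And>i. i < n \<Longrightarrow> y i \<in> elems X \<and> nrm X (y i) \<le> 1"
      and "\<And>i j. i < n \<Longrightarrow> j < n \<Longrightarrow> i \<noteq> j \<Longrightarrow> disjoint_supp M (y i) (y j)" for y
    unfolding M_fun_def
  proof (rule cSup_upper)
    show "bdd_above {nrm X (\<lambda>t. \<Sum>i<n. x i t) |x.
        (\<forall>i<n. x i \<in> elems X \<and> nrm X (x i) \<le> 1) \<and>
        (\<forall>i<n. \<forall>j<n. i \<noteq> j \<longrightarrow> disjoint_supp M (x i) (x j))}"
    proof (rule bdd_aboveI, clarify)
      fix x assume x: "\<forall>i<n. x i \<in> elems X \<and> nrm X (x i) \<le> 1"
      then have "nrm X (\<lambda>t. \<Sum>i<n. x i t) \<le> (\<Sum>i<n. nrm X (x i))"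
        by (intro nrm_sum_le[OF S]) auto
      also have "\<dots> \<le> (\<Sum>i<n. 1)" using x by (intro sum_mono) auto
      finally show "nrm X (\<lambda>t. \<Sum>i<n. x i t) \<le> real n" by simp
    qed
  qed (use that in blast)
  show "(\<And>i. i < n \<Longrightarrow> nrm X (x i) \<le> 1) \<Longrightarrow> nrm X (\<lambda>t. \<Sum>i<n. x i t) \<le> M_fun M X n"
    using unit[of x] x disj by blast
  assume K: "0 < K" and le: "\<And>i. i < n \<Longrightarrow> nrm X (x i) \<le> K"
  have sum: "(\<lambda>t. \<Sum>i<n. x i t) \<in> elems X"
    by (rule seminormed_sum[OF S]) (simp_all add: x)
  have "nrm X (\<lambda>t. \<Sum>i<n. of_real (1 / K) * x i t) \<le> M_fun M X n"
  proof (rule unit)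
    fix i assume i: "i < n"
    show "(\<lambda>t. of_real (1 / K) * x i t) \<in> elems X \<and> nrm X (\<lambda>t. of_real (1 / K) * x i t) \<le> 1"
      using seminormed_scale[OF S x[OF i], of "of_real (1 / K)"] nrm_scale[OF S x[OF i], of "of_real (1 / K)"] le[OF i] K
      by (simp add: norm_divide)
    fix j assume "j < n" "i \<noteq> j"
    then show "disjoint_supp M (\<lambda>t. of_real (1 / K) * x i t) (\<lambda>t. of_real (1 / K) * x j t)"
      using disj[OF i, of j] unfolding disjoint_supp_def by (auto elim: eventually_mono)
  qed
  then have "nrm X (\<lambda>t. of_real (1 / K) * (\<Sum>i<n. x i t)) \<le> M_fun M X n"
    by (simp add: sum_distrib_left)
  then show "nrm X (\<lambda>t. \<Sum>i<n. x i t) \<le> K * M_fun M X n"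
    unfolding nrm_scale[OF S sum] using K by (simp add: norm_divide field_simps)
qed

lemma M_fun_leI:
  assumes "seminormed X"
    and "\<And>x. (\<And>i. i < n \<Longrightarrow> x i \<in> elems X \<and> nrm X (x i) \<le> 1) \<Longrightarrow>
      (\<And>i j. i < n \<Longrightarrow> j < n \<Longrightarrow> i \<noteq> j \<Longrightarrow> disjoint_supp M (x i) (x j)) \<Longrightarrow>
      nrm X (\<lambda>t. \<Sum>i<n. x i t) \<le> B"
  shows "M_fun M X n \<le> B"
  unfolding M_fun_def
proof (rule cSup_least)
  show "{nrm X (\<lambda>t. \<Sum>i<n. x i t) |x.
      (\<forall>i<n. x i \<in> elems X \<and> nrm X (x i) \<le> 1) \<and>
      (\<forall>i<n. \<forall>j<n. i \<noteq> j \<longrightarrow> disjoint_supp M (x i) (x j))} \<noteq> {}"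
    using seminormed_zero[OF assms(1)] nrm_zero[OF assms(1)]
    by (auto simp: disjoint_supp_def intro!: exI[of _ "\<lambda>_ _. 0"])
qed (use assms(2) in blast)

lemma M_fun_nonneg:
  assumes "seminormed X" shows "0 \<le> M_fun M X n"
  using nrm_sum_le_M_fun[of X n "\<lambda>_ _. 0" M, OF assms] seminormed_zero[OF assms] nrm_zero[OF assms]
  by (simp add: disjoint_supp_def)

context kothe_couple
begin

text \<open>The value \<open>d\<close> removes the singularity at \<open>\<theta>\<close>, and the
  second difference quotients give differentiability there. The norm is read off the two boundary
  lines only, where \<open>z\<close> has distance at least
  \<open>min \<theta> (1 - \<theta>)\<close> from \<open>\<theta>\<close>; this is the origin of the
  constant.\<close>

lemma
  assumes \<theta>: "0 < \<theta>" "\<theta> < 1" and H: "H \<in> \<H>" and H0: "AE t in M. H (of_real \<theta>) t = 0"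
    and d: "has_deriv_in E H d (of_real \<theta>)"
  defines "K \<equiv> \<lambda>z t. if z = of_real \<theta> then d t else H z t / (z - of_real \<theta>)"
  shows calderon_divided_difference: "K \<in> \<H>"
    and calderon_norm_divided_difference: "\<H>_norm K \<le> \<H>_norm H / min \<theta> (1 - \<theta>)"
proof -
  define a where "a = complex_of_real \<theta>"
  define f where "f z = 1 / (z - a)" for z
  note dE = has_deriv_in_elems[OF d]
  have a: "a \<in> interior strip" unfolding a_def by (rule of_real_in_interior_strip[OF \<theta>])
  have Ka: "K a = d" by (simp add: K_def a_def fun_eq_iff)
  have K: "K z = (\<lambda>t. f z * H z t)" if "z \<noteq> a" for z
    using that by (simp add: K_def a_def f_def fun_eq_iff)
  have KE: "K z \<in> elems E" if "z \<in> strip" for z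
    using dE seminormed_scale[OF semiE calderon_elems[OF H that]] by (cases "z = a") (auto simp: Ka K)
  \<comment> \<open>\<open>K z\<close> is the difference quotient of \<open>H\<close> at
    \<open>a\<close> only up to a null set, since \<open>H a\<close> is a null function rather than
    0. Hence only the seminorms are compared.\<close>
  have quotient: "nrm E (\<lambda>t. K z t - d t) = nrm E (\<lambda>t. (H z t - H a t) / (z - a) - d t)"
    if "z \<in> strip" "z \<noteq> a" for z
  proof (rule nrm_AE_eq[OF solidE])
    have m: "H z \<in> borel_measurable M" "H a \<in> borel_measurable M" "d \<in> borel_measurable M"
      using that a interior_strip_subset calderon_measurable[OF H] solid_measurable[OF solidE dE]
      by blast+
    show "(\<lambda>t. (H z t - H a t) / (z - a) - d t) \<in> elems E"
      by (intro seminormed_diff[OF semiE] dE difference_quotient_elems[OF semiE]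
          calderon_elems[OF H] that interior_strip_subset[OF a])
    show "(\<lambda>t. K z t - d t) \<in> borel_measurable M"
      unfolding K[OF that(2)] using m by measurable
    show "AE t in M. K z t - d t = (H z t - H a t) / (z - a) - d t"
      using H0 unfolding K[OF that(2)] a_def[symmetric] by eventually_elim (simp add: f_def)
  qed
  have cont_a: "((\<lambda>z. nrm E (\<lambda>t. K z t - d t)) \<longlongrightarrow> 0) (at a)"
  proof (rule Lim_transform_eventually)
    show "((\<lambda>z. nrm E (\<lambda>t. (H z t - H a t) / (z - a) - d t)) \<longlongrightarrow> 0) (at a)"
      using d by (simp add: has_deriv_in_def a_def)
    have "\<forall>\<^sub>F z in at a. z \<in> interior strip - {a}"
      using a by (intro eventually_at_in_open) auto
    then show "\<forall>\<^sub>F z in at a. nrm E (\<lambda>t. (H z t - H a t) / (z - a) - d t) = nrm E (\<lambda>t. K z t - d t)"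
      by eventually_elim (use quotient interior_strip_subset in auto)
  qed
  have bound: "\<exists>C. \<forall>z\<in>strip. nrm E (K z) \<le> C"
  proof -
    obtain B where B: "\<And>z. z \<in> strip \<Longrightarrow> nrm E (H z) \<le> B"
      using bdd_cont_intoD(2)[OF calderonD(1)[OF H]] by blast
    \<comment> \<open>Boundedness on the strip splits at a radius \<open>r\<close>: closer to
      \<open>a\<close>, \<open>K z\<close> is within 1 of \<open>d\<close>; farther away, division
      costs at most \<open>1 / r\<close>.\<close>
    have "\<forall>\<^sub>F z in at a. nrm E (\<lambda>t. K z t - d t) < 1"
      using order_tendstoD(2)[OF cont_a] by simp
    then obtain r where r: "0 < r" "\<And>z. z \<noteq> a \<Longrightarrow> dist z a < r \<Longrightarrow> nrm E (\<lambda>t. K z t - d t) < 1"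
      unfolding eventually_at by blast
    have B0: "0 \<le> B"
      using order_trans[OF nrm_nonneg[OF semiE calderon_elems[OF H]] B] interior_strip_subset[OF a]
      by blast
    have "nrm E (K z) \<le> max (nrm E d + 1) (B / r)" if z: "z \<in> strip" for z
    proof (cases "z = a")
      case True
      then show ?thesis by (simp add: Ka)
    next
      case False
      show ?thesis
      proof (cases "dist z a < r")
        case True
        then show ?thesis
          using nrm_triangle_sub[OF semiE KE[OF z] dE] r(2)[OF False True] by simp
      next
        case far: False
        have "nrm E (K z) = cmod (f z) * nrm E (H z)"
          unfolding K[OF False] by (rule nrm_scale[OF semiE calderon_elems[OF H z]])
        also have "\<dots> = nrm E (H z) / dist z a" by (simp add: f_def norm_divide dist_norm)
        also have "\<dots> \<le> B / r" using far r(1) B[OF z] B0 by (intro frac_le) auto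
        finally show ?thesis by simp
      qed
    qed
    then show ?thesis by blast
  qed
  have cont: "((\<lambda>z. nrm E (\<lambda>t. K z t - K s t)) \<longlongrightarrow> 0) (at s within strip)" if s: "s \<in> strip" for s
  proof (cases "s = a")
    case True
    then show ?thesis using tendsto_within_subset[OF cont_a subset_UNIV] by (simp add: Ka)
  next
    case False
    have "((\<lambda>z. nrm E (\<lambda>t. f z * H z t - f s * H s t)) \<longlongrightarrow> 0) (at s within strip)"
    proof (rule nrm_tendsto_mult[OF semiE _ calderon_elems[OF H s] bdd_cont_intoD(3)[OF calderonD(1)[OF H] s]])
      show "\<forall>\<^sub>F r in at s within strip. H r \<in> elems E"
        by (rule eventually_in_at_within) (rule calderon_elems[OF H])
      show "(f \<longlongrightarrow> f s) (at s within strip)"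
        unfolding f_def using False by (intro tendsto_intros) auto
    qed
    moreover have "\<forall>\<^sub>F z in at s within strip. nrm E (\<lambda>t. f z * H z t - f s * H s t) = nrm E (\<lambda>t. K z t - K s t)"
      using eventually_neq_at_within[of a s strip] by eventually_elim (simp add: K False)
    ultimately show ?thesis by (rule Lim_transform_eventually)
  qed
  define \<delta> where "\<delta> = min \<theta> (1 - \<theta>)"
  have \<delta>: "0 < \<delta>" using \<theta> by (simp add: \<delta>_def)
  have bd: "Complex 0 s \<noteq> a" "Complex 1 s \<noteq> a"
      "cmod (f (Complex 0 s)) \<le> 1 / \<delta>" "cmod (f (Complex 1 s)) \<le> 1 / \<delta>" for s
  proof -
    have "\<delta> \<le> \<bar>Re (Complex 0 s - a)\<bar>" "\<delta> \<le> \<bar>Re (Complex 1 s - a)\<bar>"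
      using \<theta> by (auto simp: a_def \<delta>_def)
    then have *: "\<delta> \<le> cmod (Complex 0 s - a)" "\<delta> \<le> cmod (Complex 1 s - a)"
      using abs_Re_le_cmod order_trans by blast+
    then show "Complex 0 s \<noteq> a" "Complex 1 s \<noteq> a" using \<delta> by auto
    show "cmod (f (Complex 0 s)) \<le> 1 / \<delta>" "cmod (f (Complex 1 s)) \<le> 1 / \<delta>"
      using * \<delta> by (auto simp: f_def norm_divide intro!: frac_le)
  qed
  have fc: "continuous_on UNIV (\<lambda>s. f (Complex 0 s))" "continuous_on UNIV (\<lambda>s. f (Complex 1 s))"
    unfolding f_def using bd(1,2) by (auto intro!: continuous_intros simp: Complex_eq)
  show "K \<in> \<H>"
  proof (rule calderonI)
    show "bdd_cont_into E strip K" unfolding bdd_cont_into_def using KE bound cont by blast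
    show "bdd_cont_into X0 UNIV (\<lambda>t. K (Complex 0 t))"
      unfolding K[OF bd(1)] by (rule bdd_cont_into_mult[OF semi0 calderonD(3)[OF H] fc(1) bd(3)])
    show "bdd_cont_into X1 UNIV (\<lambda>t. K (Complex 1 t))"
      unfolding K[OF bd(2)] by (rule bdd_cont_into_mult[OF semi1 calderonD(4)[OF H] fc(2) bd(4)])
    fix z assume z: "z \<in> interior strip"
    show "\<exists>e. has_deriv_in E K e z"
    proof (cases "z = a")
      case True
      obtain l where l: "l \<in> elems E"
        "((\<lambda>z. nrm E (\<lambda>t. (H z t / (z - a) - d t) / (z - a) - l t)) \<longlongrightarrow> 0) (at a)"
        unfolding a_def by (rule calderon_second_difference_converges[OF \<theta> H H0 d])
      have "((\<lambda>z. nrm E (\<lambda>t. (K z t - K a t) / (z - a) - l t)) \<longlongrightarrow> 0) (at a)"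
      proof (rule Lim_transform_eventually[OF l(2)])
        show "\<forall>\<^sub>F z in at a. nrm E (\<lambda>t. (H z t / (z - a) - d t) / (z - a) - l t)
            = nrm E (\<lambda>t. (K z t - K a t) / (z - a) - l t)"
          using eventually_neq_at_within[of a a UNIV] by eventually_elim (simp add: K Ka f_def)
      qed
      then show ?thesis using l(1) True unfolding has_deriv_in_def by blast
    next
      case False
      obtain e where e: "has_deriv_in E H e z" using calderonD(2)[OF H z] by blast
      have "f field_differentiable at z"
        unfolding f_def using False by (intro derivative_intros field_differentiable_divide) auto
      then obtain f' where f': "(f has_field_derivative f') (at z)"
        unfolding field_differentiable_def by blast
      let ?U = "interior strip - {a}"
      have U: "open ?U" "z \<in> ?U" using z False by auto
      have HE: "H w \<in> elems E" if "w \<in> ?U" for w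
        using that calderon_elems[OF H] interior_strip_subset by blast
      have g: "has_deriv_in E (\<lambda>w t. f w * H w t) (\<lambda>t. f z * e t + f' * H z t) z"
        by (rule has_deriv_in_mult[OF semiE U HE e f'])
      have "has_deriv_in E K (\<lambda>t. f z * e t + f' * H z t) z"
      proof (rule has_deriv_in_AE_eq[OF solidE U _ g])
        fix w assume w: "w \<in> ?U"
        then show "(\<lambda>t. f w * H w t) \<in> elems E" by (intro seminormed_scale[OF semiE] HE)
        show "K w \<in> borel_measurable M" using w KE interior_strip_subset solid_measurable[OF solidE] by blast
        show "AE t in M. K w t = f w * H w t" using w K by auto
      qed
      then show ?thesis by blast
    qed
  qed
  show "\<H>_norm K \<le> \<H>_norm H / min \<theta> (1 - \<theta>)"
    unfolding \<delta>_def[symmetric]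
  proof (rule calderon_norm_leI)
    fix s
    note n = calderon_norm_nonneg[OF H]
    show "nrm X0 (K (Complex 0 s)) \<le> \<H>_norm H / \<delta>"
      unfolding K[OF bd(1)] nrm_scale[OF semi0 calderon_elems0[OF H]]
      using mult_mono[OF bd(3) calderon_norm_ge0[OF H, of s], of s] \<delta> n
        nrm_nonneg[OF semi0 calderon_elems0[OF H, of s]] by simp
    show "nrm X1 (K (Complex 1 s)) \<le> \<H>_norm H / \<delta>"
      unfolding K[OF bd(2)] nrm_scale[OF semi1 calderon_elems1[OF H]]
      using mult_mono[OF bd(4) calderon_norm_ge1[OF H, of s], of s] \<delta> n
        nrm_nonneg[OF semi1 calderon_elems1[OF H, of s]] by simp
  qed
qed

end

locale interpolation_couple = kothe_couple +
  fixes \<theta> :: real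
  assumes \<theta>: "0 < \<theta>" "\<theta> < 1"
begin

abbreviation X :: "'a fspace" where "X \<equiv> interp_space M X0 X1 \<theta>"

lemmas \<theta>_strip = of_real_in_strip(2)[OF \<theta>]

lemma interp_elemsI:
  assumes g: "g \<in> \<H>" and f: "f \<in> borel_measurable M" and eq: "AE t in M. g (of_real \<theta>) t = f t"
  shows "f \<in> elems X"
proof -
  let ?h = "\<lambda>z. if z = of_real \<theta> then f else g z"
  have "?h \<in> \<H>"
  proof (rule calderon_AE_eq[OF g])
    fix z assume z: "z \<in> strip"
    show "?h z \<in> borel_measurable M" using f calderon_measurable[OF g z] by simp
    show "AE t in M. ?h z t = g z t" using eq by (auto elim: eventually_mono)
  qed
  then show ?thesis unfolding interp_space_def by (auto intro!: exI[of _ ?h])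
qed

lemma interp_nrm_le:
  assumes "g \<in> \<H>" "AE t in M. g (of_real \<theta>) t = f t"
  shows "nrm X f \<le> \<H>_norm g"
  unfolding interp_space_def using assms calderon_norm_nonneg
  by (auto intro!: cInf_lower bdd_belowI[of _ 0])

lemma interp_elemsD: "f \<in> elems X \<Longrightarrow> \<exists>g\<in>\<H>. g (of_real \<theta>) = f"
  unfolding interp_space_def by auto

lemma interp_lift:
  assumes "f \<in> elems X" "nrm X f < r"
  obtains g where "g \<in> \<H>" "AE t in M. g (of_real \<theta>) t = f t" "\<H>_norm g < r"
proof -
  let ?S = "{\<H>_norm g |g. g \<in> \<H> \<and> (AE t in M. g (of_real \<theta>) t = f t)}"
  have "?S \<noteq> {}" using interp_elemsD[OF assms(1)] by auto
  moreover have "Inf ?S < r" using assms(2) by (simp add: interp_space_def)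
  ultimately obtain s where "s \<in> ?S" "s < r" by (rule cInf_lessD[THEN bexE])
  then show thesis using that by blast
qed

lemma solidX: "solid_space M X"
proof -
  have meas: "f \<in> borel_measurable M" if "f \<in> elems X" for f
    using interp_elemsD[OF that] calderon_measurable[OF _ \<theta>_strip] by blast
  have nonneg: "0 \<le> nrm X f" if f: "f \<in> elems X" for f
  proof (rule ccontr)
    assume "\<not> 0 \<le> nrm X f"
    then obtain g where "g \<in> \<H>" "\<H>_norm g < 0"
      using interp_lift[OF f, of 0] by (metis not_le)
    then show False using calderon_norm_nonneg by fastforce
  qed
  have add: "(\<lambda>t. f t + g t) \<in> elems X \<and> nrm X (\<lambda>t. f t + g t) \<le> nrm X f + nrm X g"
    if f: "f \<in> elems X" and g: "g \<in> elems X" for f g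
  proof -
    have *: "(\<lambda>t. f t + g t) \<in> elems X \<and> nrm X (\<lambda>t. f t + g t) \<le> nrm X f + nrm X g + \<epsilon>"
      if \<epsilon>: "0 < \<epsilon>" for \<epsilon>
    proof -
      obtain F where F: "F \<in> \<H>" "AE t in M. F (of_real \<theta>) t = f t" "\<H>_norm F < nrm X f + \<epsilon> / 2"
        using interp_lift[OF f, of "nrm X f + \<epsilon> / 2"] \<epsilon> by auto
      obtain G where G: "G \<in> \<H>" "AE t in M. G (of_real \<theta>) t = g t" "\<H>_norm G < nrm X g + \<epsilon> / 2"
        using interp_lift[OF g, of "nrm X g + \<epsilon> / 2"] \<epsilon> by auto
      have eq: "AE t in M. F (of_real \<theta>) t + G (of_real \<theta>) t = f t + g t"
        using F(2) G(2) by eventually_elim simp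
      note FG = calderon_add[OF F(1) G(1)]
      show ?thesis
        using interp_elemsI[OF FG _ eq] meas[OF f] meas[OF g] interp_nrm_le[OF FG eq]
          calderon_norm_add[OF F(1) G(1)] F(3) G(3) by simp
    qed
    then show ?thesis using field_le_epsilon[of "nrm X (\<lambda>t. f t + g t)"] zero_less_one by blast
  qed
  have mult: "(\<lambda>t. u t * g t) \<in> elems X \<and> nrm X (\<lambda>t. u t * g t) \<le> c * nrm X g"
    if u: "u \<in> borel_measurable M" and c: "0 \<le> c" and g: "g \<in> elems X"
      and uG: "\<And>G. G \<in> \<H> \<Longrightarrow>
        (\<lambda>z t. u t * G z t) \<in> \<H> \<and> \<H>_norm (\<lambda>z t. u t * G z t) \<le> c * \<H>_norm G"
    for u g c
  proof -
    have m: "(\<lambda>t. u t * g t) \<in> borel_measurable M"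
      using u meas[OF g] by (rule borel_measurable_times)
    have *: "(\<lambda>t. u t * g t) \<in> elems X \<and> nrm X (\<lambda>t. u t * g t) \<le> c * (nrm X g + \<epsilon>)"
      if \<epsilon>: "0 < \<epsilon>" for \<epsilon>
    proof -
      obtain G where G: "G \<in> \<H>" "AE t in M. G (of_real \<theta>) t = g t" "\<H>_norm G < nrm X g + \<epsilon>"
        using interp_lift[OF g, of "nrm X g + \<epsilon>"] \<epsilon> by auto
      have eq: "AE t in M. u t * G (of_real \<theta>) t = u t * g t"
        using G(2) by eventually_elim simp
      have "nrm X (\<lambda>t. u t * g t) \<le> c * \<H>_norm G"
        using interp_nrm_le[OF conjunct1[OF uG[OF G(1)]] eq] uG[OF G(1)] by simp
      also have "\<dots> \<le> c * (nrm X g + \<epsilon>)" using G(3) c by (intro mult_left_mono) auto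
      finally show ?thesis using interp_elemsI[OF conjunct1[OF uG[OF G(1)]] m eq] by simp
    qed
    then show ?thesis using le_mult_if_le_mult_add_epsilon[OF c] zero_less_one by blast
  qed
  have S: "seminormed X"
  proof (rule seminormedI[OF _ add _ nonneg])
    show "(\<lambda>_. 0) \<in> elems X" by (rule interp_elemsI[OF calderon_zero]) auto
    show "(\<lambda>t. c * f t) \<in> elems X \<and> nrm X (\<lambda>t. c * f t) \<le> cmod c * nrm X f"
      if "f \<in> elems X" for c f
      using that by (intro mult) (auto simp: calderon_scale calderon_norm_scale)
  qed
  show ?thesis
  proof (rule solid_spaceI[OF _ S])
    show "elems X \<subseteq> borel_measurable M" using meas by blast
    fix f g assume f: "f \<in> borel_measurable M" and g: "g \<in> elems X" and eq: "AE t in M. f t = g t"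
    have iff: "(AE t in M. h t = f t) \<longleftrightarrow> (AE t in M. h t = g t)" for h :: "'a \<Rightarrow> complex"
      using eq by (auto elim: eventually_elim2)
    obtain G where "G \<in> \<H>" "G (of_real \<theta>) = g" using interp_elemsD[OF g] by blast
    then have "f \<in> elems X" using f iff[of g] by (auto intro: interp_elemsI)
    then show "f \<in> elems X \<and> nrm X f \<le> nrm X g" by (simp add: interp_space_def iff)
  next
    fix u :: "'a \<Rightarrow> complex" and g
    assume u: "u \<in> borel_measurable M" "\<And>t. cmod (u t) \<le> 1" and g: "g \<in> elems X"
    show "(\<lambda>t. u t * g t) \<in> elems X \<and> nrm X (\<lambda>t. u t * g t) \<le> nrm X g"
      using mult[OF u(1) _ g, of 1] calderon_multiplier[OF _ u] calderon_norm_multiplier[OF _ u]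
      by simp
  qed
qed

lemmas semiX = solid_seminormed[OF solidX]

text \<open>The standard fact that the derivative at \<open>\<theta>\<close> maps the kernel of
  evaluation at \<open>\<theta>\<close> boundedly into \<open>X\<close>: the divided difference of
  \<open>H\<close> is a lifting of \<open>d\<close>. Every estimate for \<open>\<Omega>\<close>
  below is an instance.\<close>

lemma
  assumes "H \<in> \<H>" "AE t in M. H (of_real \<theta>) t = 0" "has_deriv_in E H d (of_real \<theta>)"
  shows deriv_at_zero_in_interp: "d \<in> elems X"
    and nrm_deriv_at_zero_le: "nrm X d \<le> \<H>_norm H / min \<theta> (1 - \<theta>)"
proof -
  note K = calderon_divided_difference[OF \<theta> assms] calderon_norm_divided_difference[OF \<theta> assms]
  show "d \<in> elems X"
    by (rule interp_elemsI[OF K(1)]) (auto intro: solid_measurable[OF solidE has_deriv_in_elems[OF assms(3)]])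
  show "nrm X d \<le> \<H>_norm H / min \<theta> (1 - \<theta>)"
    by (rule order_trans[OF interp_nrm_le[OF K(1)] K(2)]) auto
qed

end

section \<open>Closed spans and sign changes\<close>

lemma has_deriv_in_sum:
  assumes S: "seminormed X" and U: "open U" "z \<in> U" and I: "finite I"
    and g: "\<And>i w. i \<in> I \<Longrightarrow> w \<in> U \<Longrightarrow> g i w \<in> elems X"
    and d: "\<And>i. i \<in> I \<Longrightarrow> has_deriv_in X (g i) (d i) z"
  shows "has_deriv_in X (\<lambda>w t. \<Sum>i\<in>I. g i w t) (\<lambda>t. \<Sum>i\<in>I. d i t) z"
  using I g d
proof (induction I rule: finite_induct)
  case empty
  then show ?case by (simp add: has_deriv_in_def nrm_zero[OF S] seminormed_zero[OF S])
next
  case (insert i I)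
  have "has_deriv_in X (\<lambda>w t. g i w t + (\<Sum>i\<in>I. g i w t)) (\<lambda>t. d i t + (\<Sum>i\<in>I. d i t)) z"
    by (rule has_deriv_in_add[OF S U])
      (use insert in \<open>auto intro: seminormed_sum[OF S]\<close>)
  then show ?case using insert.hyps by simp
qed

lemma elems_closed_span_subset: "f \<in> elems (closed_span X e) \<Longrightarrow> f \<in> elems X"
  and nrm_closed_span: "nrm (closed_span X e) = nrm X"
  by (auto simp: closed_span_def)

lemma closed_span_seminormed:
  assumes S: "seminormed X" and e: "\<And>i. e i \<in> elems X"
  shows "seminormed (closed_span X e)"
proof -
  let ?W = "closed_span X e"
  let ?s = "\<lambda>(n::nat) c t. \<Sum>i<n. c i * e i t"
  have W: "f \<in> elems ?W \<longleftrightarrow> f \<in> elems X \<and> (\<forall>\<epsilon>>0. \<exists>n c. nrm X (\<lambda>t. f t - ?s n c t) < \<epsilon>)" for f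
    by (simp add: closed_span_def)
  have sX: "?s n c \<in> elems X" for n c
    by (intro seminormed_sum[OF S] seminormed_scale[OF S] e) simp
  have pad: "?s n c = ?s N (\<lambda>i. if i < n then c i else 0)" if "n \<le> N" for n N c
  proof (rule ext)
    fix t
    show "?s n c t = ?s N (\<lambda>i. if i < n then c i else 0) t"
      by (rule sum.mono_neutral_cong_left) (use that in auto)
  qed
  have zero: "(\<lambda>_. 0) \<in> elems ?W"
    unfolding W using seminormed_zero[OF S] nrm_zero[OF S] by (auto intro!: exI[of _ "0::nat"])
  have add: "(\<lambda>t. f t + g t) \<in> elems ?W" if f: "f \<in> elems ?W" and g: "g \<in> elems ?W" for f g
    unfolding W
  proof (intro conjI allI impI)
    note fX = elems_closed_span_subset[OF f] and gX = elems_closed_span_subset[OF g]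
    show "(\<lambda>t. f t + g t) \<in> elems X" by (rule seminormed_add[OF S fX gX])
    fix \<epsilon> :: real assume "0 < \<epsilon>"
    then have "0 < \<epsilon> / 2" by simp
    then obtain n c m d where nc: "nrm X (\<lambda>t. f t - ?s n c t) < \<epsilon> / 2"
      and md: "nrm X (\<lambda>t. g t - ?s m d t) < \<epsilon> / 2"
      using f g unfolding W by blast
    define c' d' where "c' i = (if i < n then c i else 0)" and "d' i = (if i < m then d i else 0)" for i
    have eq: "?s n c t = ?s (n + m) c' t" "?s m d t = ?s (n + m) d' t" for t
      unfolding c'_def d'_def by (rule fun_cong[OF pad]; simp)+
    have "(\<lambda>t. f t + g t - ?s (n + m) (\<lambda>i. c' i + d' i) t)
        = (\<lambda>t. (f t - ?s n c t) + (g t - ?s m d t))"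
      by (simp only: eq fun_eq_iff distrib_right sum.distrib) simp
    then have "nrm X (\<lambda>t. f t + g t - ?s (n + m) (\<lambda>i. c' i + d' i) t) < \<epsilon>"
      using seminormed_triangle[OF S seminormed_diff[OF S fX sX[of c n]]
          seminormed_diff[OF S gX sX[of d m]]] nc md by simp
    then show "\<exists>n c. nrm X (\<lambda>t. f t + g t - ?s n c t) < \<epsilon>"
      by (intro exI[of _ "n + m"] exI[of _ "\<lambda>i. c' i + d' i"])
  qed
  have scale: "(\<lambda>t. a * f t) \<in> elems ?W" if f: "f \<in> elems ?W" for a f
  proof (cases "a = 0")
    case True
    then show ?thesis using zero by simp
  next
    case False
    note fX = elems_closed_span_subset[OF f]
    show ?thesis
      unfolding W
    proof (intro conjI allI impI)
      show "(\<lambda>t. a * f t) \<in> elems X" by (rule seminormed_scale[OF S fX])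
      fix \<epsilon> :: real assume "0 < \<epsilon>"
      then have "0 < \<epsilon> / cmod a" using False by simp
      then obtain n c where nc: "nrm X (\<lambda>t. f t - ?s n c t) < \<epsilon> / cmod a"
        using f unfolding W by blast
      have "(\<lambda>t. a * f t - ?s n (\<lambda>i. a * c i) t) = (\<lambda>t. a * (f t - ?s n c t))"
        by (simp add: fun_eq_iff right_diff_distrib sum_distrib_left mult.assoc)
      then have "nrm X (\<lambda>t. a * f t - ?s n (\<lambda>i. a * c i) t) < \<epsilon>"
        using nrm_scale[OF S seminormed_diff[OF S fX sX[of c n]], of a] nc False
        by (simp add: field_simps)
      then show "\<exists>n c. nrm X (\<lambda>t. a * f t - ?s n c t) < \<epsilon>"
        by (intro exI[of _ n] exI[of _ "\<lambda>i. a * c i"])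
    qed
  qed
  show ?thesis
    unfolding seminormed_def nrm_closed_span
    by (intro conjI ballI allI zero add scale seminormed_triangle[OF S] nrm_scale[OF S]
        nrm_nonneg[OF S]; (assumption | erule elems_closed_span_subset))
qed

lemma
  assumes "linear_into_L0 M W l" "x \<in> W"
  shows linear_into_L0_add: "y \<in> W \<Longrightarrow> AE t in M. l (\<lambda>s. x s + y s) t = l x t + l y t"
    and linear_into_L0_scale: "AE t in M. l (\<lambda>s. c * x s) t = c * l x t"
proof -
  note l = assms(1)[unfolded linear_into_L0_def]
  show "AE t in M. l (\<lambda>s. x s + y s) t = l x t + l y t" if "y \<in> W"
    by (rule bspec[OF bspec[OF conjunct1[OF conjunct2[OF conjunct2[OF l]]] assms(2)] that])
  show "AE t in M. l (\<lambda>s. c * x s) t = c * l x t"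
    by (rule bspec[OF spec[OF conjunct2[OF conjunct2[OF conjunct2[OF l]]]] assms(2)])
qed

lemma linear_into_L0_sum:
  fixes n :: nat
  assumes l: "linear_into_L0 M W l" and W: "(\<lambda>_. 0) \<in> W"
    "\<And>f g. f \<in> W \<Longrightarrow> g \<in> W \<Longrightarrow> (\<lambda>t. f t + g t) \<in> W" "\<And>c f. f \<in> W \<Longrightarrow> (\<lambda>t. c * f t) \<in> W"
    and x: "\<And>i. i < n \<Longrightarrow> x i \<in> W"
  shows "(\<lambda>t. \<Sum>i<n. c i * x i t) \<in> W \<and>
    (AE t in M. l (\<lambda>t. \<Sum>i<n. c i * x i t) t = (\<Sum>i<n. c i * l (x i) t))"
  using x
proof (induction n)
  case 0
  have "AE t in M. l (\<lambda>s. 0 * 0) t = 0 * l (\<lambda>s. 0) t"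
    by (rule linear_into_L0_scale[OF l W(1)])
  then show ?case using W(1) by simp
next
  case (Suc n)
  let ?s = "\<lambda>t. \<Sum>i<n. c i * x i t"
  have IH: "?s \<in> W" "AE t in M. l ?s t = (\<Sum>i<n. c i * l (x i) t)" using Suc by auto
  have xn: "x n \<in> W" "(\<lambda>t. c n * x n t) \<in> W" using Suc.prems W(3) by auto
  have "AE t in M. l (\<lambda>t. ?s t + c n * x n t) t = l ?s t + l (\<lambda>t. c n * x n t) t"
    by (rule linear_into_L0_add[OF l IH(1) xn(2)])
  moreover have "AE t in M. l (\<lambda>t. c n * x n t) t = c n * l (x n) t"
    by (rule linear_into_L0_scale[OF l xn(1)])
  ultimately have "AE t in M. l (\<lambda>t. ?s t + c n * x n t) t = (\<Sum>i<Suc n. c i * l (x i) t)"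
    using IH(2) by eventually_elim simp
  then show ?case using W(2)[OF IH(1) xn(2)] by simp
qed

section \<open>Sign changes on disjoint supports and their averages\<close>

text \<open>Rademacher functions, with the \<open>2 ^ n\<close> sign patterns indexed by the subsets
  of \<open>{..<n}\<close>; averages over signs become sums over \<open>Pow {..<n}\<close>.\<close>

definition set_sign :: "nat set \<Rightarrow> nat \<Rightarrow> complex" where
  "set_sign S i = (if i \<in> S then -1 else 1)"

text \<open>Toggling the membership of \<open>i\<close> is an involution of the power set that
  reverses the sign of every term.\<close>

lemma sum_Pow_odd_eq_0:
  fixes f :: "nat set \<Rightarrow> complex"
  assumes i: "i < n"
    and f: "\<And>S. f (if i \<in> S then S - {i} else insert i S) = - f S"
  shows "(\<Sum>S\<in>Pow {..<n}. f S) = 0"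
proof -
  define \<tau> where "\<tau> S = (if i \<in> S then S - {i} else insert i S)" for S :: "nat set"
  have \<tau>: "\<tau> (\<tau> S) = S" "S \<in> Pow {..<n} \<Longrightarrow> \<tau> S \<in> Pow {..<n}" for S
    using i by (auto simp: \<tau>_def)
  have "(\<Sum>S\<in>Pow {..<n}. f S) = (\<Sum>S\<in>Pow {..<n}. f (\<tau> S))"
    by (rule sum.reindex_bij_witness[of _ \<tau> \<tau>]) (simp_all only: \<tau>)
  also have "\<dots> = - (\<Sum>S\<in>Pow {..<n}. f S)"
    by (simp add: \<tau>_def f sum_negf)
  finally show ?thesis by simp
qed

lemma sum_set_sign: "i < n \<Longrightarrow> (\<Sum>S\<in>Pow {..<n}. set_sign S i) = 0"
  by (rule sum_Pow_odd_eq_0[of i]) (auto simp: set_sign_def)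

text \<open>Orthogonality of the Rademacher functions.\<close>

lemma sum_set_sign_mult:
  assumes "i < n"
  shows "(\<Sum>S\<in>Pow {..<n}. set_sign S i * set_sign S j) = (if i = j then 2 ^ n else 0)"
proof (cases "i = j")
  case True
  have "set_sign S j * set_sign S j = 1" for S by (simp add: set_sign_def)
  then show ?thesis using True by (simp add: card_Pow)
next
  case False
  have "(\<Sum>S\<in>Pow {..<n}. set_sign S i * set_sign S j) = 0"
    by (rule sum_Pow_odd_eq_0[of i]) (use assms False in \<open>auto simp: set_sign_def\<close>)
  then show ?thesis using False by simp
qed

text \<open>Indicator of the support of \<open>x i\<close> minus the supports of its predecessors.
  The \<open>x i\<close> are disjoint only almost everywhere, while these sets are disjoint at every
  point. The product form makes measurability immediate.\<close>

definition first_support :: "(nat \<Rightarrow> 'a \<Rightarrow> complex) \<Rightarrow> nat \<Rightarrow> 'a \<Rightarrow> complex" where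
  "first_support x i t = (if x i t = 0 then 0 else 1) * (\<Prod>j<i. if x j t = 0 then 1 else 0)"

lemma first_support_values:
  "first_support x i t = (if x i t \<noteq> 0 \<and> (\<forall>j<i. x j t = 0) then 1 else 0)"
proof (cases "\<forall>j<i. x j t = 0")
  case False
  then have "(\<Prod>j<i. if x j t = 0 then 1 else 0) = (0::complex)"
    by (intro prod_zero) auto
  then show ?thesis using False by (simp add: first_support_def)
qed (simp add: first_support_def)

lemma first_support_measurable:
  assumes "\<And>j. j \<le> i \<Longrightarrow> x j \<in> borel_measurable M"
  shows "first_support x i \<in> borel_measurable M"
proof -
  have *: "(\<lambda>t. if x j t = 0 then a else b) \<in> borel_measurable M" if "j \<le> i" for j and a b :: complex
    using assms[OF that] by measurable
  show ?thesis
    unfolding first_support_def[abs_def]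
    by (intro borel_measurable_times borel_measurable_prod *) auto
qed

lemma first_support_cases:
  obtains (none) "\<And>i. i < n \<Longrightarrow> first_support x i t = 0"
  | (one) k where "k < n" "first_support x k t = 1" "\<And>i. i \<noteq> k \<Longrightarrow> first_support x i t = 0"
proof (cases "\<exists>k<n. first_support x k t \<noteq> 0")
  case True
  then obtain k where k: "k < n" "x k t \<noteq> 0" "\<forall>j<k. x j t = 0"
    by (auto simp: first_support_values split: if_splits)
  have "first_support x i t = 0" if "i \<noteq> k" for i
    using k(2,3) that by (cases "i < k") (auto simp: first_support_values)
  moreover have "first_support x k t = 1" using k by (simp add: first_support_values)
  ultimately show thesis using one k(1) by blast
qed (use none in blast)

lemma AE_first_support:
  assumes "\<And>i j. i < n \<Longrightarrow> j < n \<Longrightarrow> i \<noteq> j \<Longrightarrow> disjoint_supp M (x i) (x j)"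
  shows "AE t in M. \<forall>i<n. x i t = 0 \<or> first_support x i t = 1"
proof -
  have "AE t in M. i \<noteq> j \<longrightarrow> x i t = 0 \<or> x j t = 0" if "i < n" "j < n" for i j
    using assms[OF that] unfolding disjoint_supp_def by (cases "i = j") auto
  then have "AE t in M. \<forall>i\<in>{..<n}. \<forall>j\<in>{..<n}. i \<noteq> j \<longrightarrow> x i t = 0 \<or> x j t = 0"
    by (intro AE_finite_allI) auto
  then show ?thesis
  proof eventually_elim
    case (elim t)
    have "first_support x i t = 1" if "i < n" "x i t \<noteq> 0" for i
    proof -
      have "x j t = 0" if "j < i" for j
        using elim \<open>i < n\<close> \<open>x i t \<noteq> 0\<close> that by (metis lessThan_iff less_irrefl less_trans)
      then show ?thesis using that by (simp add: first_support_values)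
    qed
    then show ?case by blast
  qed
qed

text \<open>The function equal to the \<open>k\<close>-th sign on the \<open>k\<close>-th piece and
  to 1 off all pieces. Exact disjointness of the pieces makes it take the values 1 and -1
  everywhere, as \<open>admissible_selector\<close> demands.\<close>

definition sign_multiplier :: "(nat \<Rightarrow> 'a \<Rightarrow> complex) \<Rightarrow> nat \<Rightarrow> nat set \<Rightarrow> 'a \<Rightarrow> complex" where
  "sign_multiplier x n S t = 1 + (\<Sum>i<n. (set_sign S i - 1) * first_support x i t)"

lemma sign_multiplier_none:
  "(\<And>i. i < n \<Longrightarrow> first_support x i t = 0) \<Longrightarrow> sign_multiplier x n S t = 1"
  by (simp add: sign_multiplier_def)

lemma sign_multiplier_one:
  assumes "k < n" "first_support x k t = 1" "\<And>i. i \<noteq> k \<Longrightarrow> first_support x i t = 0"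
  shows "sign_multiplier x n S t = set_sign S k"
proof -
  have "(\<Sum>i<n. (set_sign S i - 1) * first_support x i t)
      = (\<Sum>i<n. if i = k then set_sign S k - 1 else 0)"
    by (rule sum.cong) (use assms in auto)
  then show ?thesis using assms(1) by (simp add: sign_multiplier_def)
qed

lemma sign_multiplier_values: "sign_multiplier x n S t \<in> {-1, 1}"
  by (rule first_support_cases[of n x t])
    (auto simp: sign_multiplier_none sign_multiplier_one set_sign_def)

text \<open>Changing the signs of the coefficients amounts to multiplying the whole sum by one
  function with values 1 and -1, to which the symmetry of \<open>B\<close> applies.\<close>

lemma sign_multiplier_mult:
  assumes "\<forall>i<n. x i t = 0 \<or> first_support x i t = 1"
  shows "(\<Sum>i<n. set_sign S i * x i t) = sign_multiplier x n S t * (\<Sum>i<n. x i t)"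
proof (rule first_support_cases[of n x t])
  assume "\<And>i. i < n \<Longrightarrow> first_support x i t = 0"
  then have "x i t = 0" if "i < n" for i using assms that by force
  then show ?thesis by simp
next
  fix k assume k: "k < n" "first_support x k t = 1" "\<And>i. i \<noteq> k \<Longrightarrow> first_support x i t = 0"
  have "x i t = 0" if "i < n" "i \<noteq> k" for i using assms k(3)[OF that(2)] that(1) by force
  then have "(\<Sum>i<n. set_sign S i * x i t) = (\<Sum>i<n. set_sign S k * x i t)"
    by (intro sum.cong) (metis lessThan_iff mult_zero_right)+
  then show ?thesis by (simp add: sign_multiplier_one[OF k] sum_distrib_left)
qed

text \<open>Averaging projects onto the diagonal: on the \<open>k\<close>-th piece orthogonality
  keeps only \<open>b k\<close>, and off all pieces the signs average to 0. Thus \<open>b i\<close>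
  survives exactly on its own piece.\<close>

lemma sum_sign_multiplier:
  "(\<Sum>S\<in>Pow {..<n}. sign_multiplier x n S t * (\<Sum>i<n. set_sign S i * b i))
     = 2 ^ n * (\<Sum>i<n. first_support x i t * b i)"
proof (rule first_support_cases[of n x t])
  assume none: "\<And>i. i < n \<Longrightarrow> first_support x i t = 0"
  have "(\<Sum>S\<in>Pow {..<n}. \<Sum>i<n. set_sign S i * b i) = (\<Sum>i<n. (\<Sum>S\<in>Pow {..<n}. set_sign S i) * b i)"
    unfolding sum_distrib_right by (rule sum.swap)
  also have "\<dots> = 0" by (intro sum.neutral) (simp add: sum_set_sign)
  finally show ?thesis by (simp add: sign_multiplier_none[OF none] none)
next
  fix k assume k: "k < n" "first_support x k t = 1" "\<And>i. i \<noteq> k \<Longrightarrow> first_support x i t = 0"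
  have "(\<Sum>S\<in>Pow {..<n}. \<Sum>i<n. set_sign S k * set_sign S i * b i)
      = (\<Sum>i<n. (\<Sum>S\<in>Pow {..<n}. set_sign S k * set_sign S i) * b i)"
    unfolding sum_distrib_right by (rule sum.swap)
  also have "\<dots> = (\<Sum>i<n. if i = k then 2 ^ n * b k else 0)"
    by (rule sum.cong) (auto simp: sum_set_sign_mult[OF k(1)])
  also have "\<dots> = (\<Sum>i<n. 2 ^ n * (first_support x i t * b i))"
    by (rule sum.cong) (use k(2,3) in auto)
  finally show ?thesis
    by (simp add: sign_multiplier_one[OF k] sum_distrib_left mult.assoc)
qed

lemma sign_multiplier_measurable:
  assumes "\<And>i. i < n \<Longrightarrow> x i \<in> borel_measurable M"
  shows "sign_multiplier x n S \<in> borel_measurable M"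
  unfolding sign_multiplier_def[abs_def]
  by (intro borel_measurable_add borel_measurable_sum borel_measurable_times
      borel_measurable_const first_support_measurable assms) auto

section \<open>Disjoint singularity of the centralizer\<close>

text \<open>\<open>C\<close> is taken strictly positive so that it can serve as the scaling factor
  in \<open>nrm_sum_le_mult_M_fun\<close>.\<close>

locale centralizer = interpolation_couple +
  fixes B :: "('a \<Rightarrow> complex) \<Rightarrow> complex \<Rightarrow> 'a \<Rightarrow> complex"
    and \<Omega> :: "('a \<Rightarrow> complex) \<Rightarrow> 'a \<Rightarrow> complex" and C :: real
  assumes B: "admissible_selector M X0 X1 \<theta> B"
    and \<Omega>: "x \<in> elems X \<Longrightarrow> has_deriv_in E (B x) (\<Omega> x) (of_real \<theta>)"
    and C: "0 < C" "x \<in> elems X \<Longrightarrow> \<H>_norm (B x) \<le> C * nrm X x"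
begin

lemma
  assumes x: "x \<in> elems X"
  shows B_calderon: "B x \<in> \<H>"
    and B_at_theta: "AE t in M. B x (of_real \<theta>) t = x t"
    and B_AE_eq: "y \<in> elems X \<Longrightarrow> AE t in M. x t = y t \<Longrightarrow> z \<in> strip \<Longrightarrow> AE t in M. B x z t = B y z t"
    and B_sign: "u \<in> borel_measurable M \<Longrightarrow> (\<And>t. u t \<in> {-1, 1}) \<Longrightarrow> z \<in> strip \<Longrightarrow>
        AE t in M. B (\<lambda>s. u s * x s) z t = u t * B x z t"
    and B_supp: "z \<in> strip \<Longrightarrow> AE t in M. x t = 0 \<longrightarrow> B x z t = 0"
proof -
  note sel = B[unfolded admissible_selector_def Let_def]
  note sel2 = conjunct2[OF sel] and sel3 = conjunct2[OF conjunct2[OF conjunct2[OF conjunct2[OF sel]]]]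
  show "B x \<in> \<H>" "AE t in M. B x (of_real \<theta>) t = x t"
    using bspec[OF conjunct1[OF sel] x] by simp_all
  show "AE t in M. B x z t = B y z t" if "y \<in> elems X" "AE t in M. x t = y t" "z \<in> strip"
    by (rule bspec[OF mp[OF bspec[OF bspec[OF conjunct1[OF sel2] x] that(1)] that(2)] that(3)])
  show "AE t in M. B (\<lambda>s. u s * x s) z t = u t * B x z t"
    if "u \<in> borel_measurable M" "\<And>t. u t \<in> {-1, 1}" "z \<in> strip"
    by (rule bspec[OF bspec[OF mp[OF bspec[OF conjunct1[OF sel3] that(1)]] x] that(3)])
      (use that(2) in blast)
  show "AE t in M. x t = 0 \<longrightarrow> B x z t = 0" if "z \<in> strip"
    by (rule bspec[OF bspec[OF conjunct2[OF sel3] x] that])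
qed

lemma \<Omega>_elems: "x \<in> elems X \<Longrightarrow> \<Omega> x \<in> elems E"
  by (rule has_deriv_in_elems[OF \<Omega>])

lemma \<Omega>_measurable: "x \<in> elems X \<Longrightarrow> \<Omega> x \<in> borel_measurable M"
  by (rule solid_measurable[OF solidE \<Omega>_elems])

lemma X_measurable: "x \<in> elems X \<Longrightarrow> x \<in> borel_measurable M"
  by (rule solid_measurable[OF solidX])

lemmas \<theta>_interior = of_real_in_interior_strip[OF \<theta>]

lemma calderon_elems_interior: "g \<in> \<H> \<Longrightarrow> z \<in> interior strip \<Longrightarrow> g z \<in> elems E"
  by (rule calderon_elems[OF _ interior_strip_subset])

text \<open>A substitute for the uniqueness of derivatives in the sum space, which would need that its
  seminorm vanishes only on null functions.\<close>

lemma
  assumes H: "H \<in> \<H>" and zero: "\<And>z. z \<in> strip \<Longrightarrow> AE t in M. H z t = 0"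
    and d: "has_deriv_in E H d (of_real \<theta>)"
  shows null_deriv_elems: "d \<in> elems X" and null_deriv_nrm: "nrm X d = 0"
proof -
  note H0 = zero[OF \<theta>_strip]
  show dX: "d \<in> elems X" by (rule deriv_at_zero_in_interp[OF H H0 d])
  have bd: "Complex 0 s \<in> strip" "Complex 1 s \<in> strip" for s by (auto simp: strip_def)
  have "\<H>_norm H \<le> 0"
    by (rule calderon_norm_leI)
      (simp_all add: nrm_AE_zero[OF solid0 calderon_elems0[OF H] zero[OF bd(1)]]
        nrm_AE_zero[OF solid1 calderon_elems1[OF H] zero[OF bd(2)]])
  then have "\<H>_norm H / min \<theta> (1 - \<theta>) \<le> 0"
    using \<theta> by (intro divide_nonpos_pos) auto
  then show "nrm X d = 0"
    using nrm_deriv_at_zero_le[OF H H0 d] nrm_nonneg[OF semiX dX] by simp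
qed

text \<open>By the symmetry of \<open>B\<close>, the function \<open>B y - u * B x\<close> is null
  at every point of the strip, so its derivative at \<open>\<theta>\<close> has seminorm 0 in
  \<open>X\<close>.\<close>

lemma
  assumes x: "x \<in> elems X" and y: "y \<in> elems X"
    and u: "u \<in> borel_measurable M" "\<And>t. u t \<in> {-1, 1}" and eq: "AE t in M. y t = u t * x t"
  shows \<Omega>_sign_elems: "(\<lambda>t. \<Omega> y t - u t * \<Omega> x t) \<in> elems X"
    and \<Omega>_sign_nrm: "nrm X (\<lambda>t. \<Omega> y t - u t * \<Omega> x t) = 0"
proof -
  define v where "v t = - u t" for t
  have v: "v \<in> borel_measurable M" unfolding v_def using u(1) by measurable
  have u1: "cmod (u t) \<le> 1" and v1: "cmod (v t) \<le> 1" for t using u(2)[of t] by (auto simp: v_def)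
  let ?H = "\<lambda>z t. B y z t + v t * B x z t"
  have H: "?H \<in> \<H>" by (intro calderon_add calderon_multiplier B_calderon x y v v1)
  have zero: "AE t in M. ?H z t = 0" if z: "z \<in> strip" for z
  proof -
    have "AE t in M. B y z t = B (\<lambda>s. u s * x s) z t"
      by (rule B_AE_eq[OF y solid_multiplier[OF solidX x u(1) u1] eq z])
    with B_sign[OF x u z] show ?thesis by eventually_elim (simp add: v_def)
  qed
  have "has_deriv_in E ?H (\<lambda>t. \<Omega> y t + v t * \<Omega> x t) (of_real \<theta>)"
    by (intro has_deriv_in_add[OF semiE open_interior \<theta>_interior]
        has_deriv_in_multiplier[OF solidE open_interior \<theta>_interior] \<Omega> x y v v1
        solid_multiplier[OF solidE] calderon_elems_interior B_calderon)
  from null_deriv_elems[OF H zero this] null_deriv_nrm[OF H zero this]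
  show "(\<lambda>t. \<Omega> y t - u t * \<Omega> x t) \<in> elems X" "nrm X (\<lambda>t. \<Omega> y t - u t * \<Omega> x t) = 0"
    by (simp_all add: v_def)
qed

text \<open>The same device for supports: \<open>(1 - v) * B x\<close> is null throughout the strip
  because \<open>B x\<close> vanishes off the support of \<open>x\<close>.\<close>

lemma
  assumes x: "x \<in> elems X" and v: "v \<in> borel_measurable M" "\<And>t. v t \<in> {0, 1}"
    and supp: "AE t in M. x t = 0 \<or> v t = 1"
  shows \<Omega>_supp_elems: "(\<lambda>t. \<Omega> x t - v t * \<Omega> x t) \<in> elems X"
    and \<Omega>_supp_nrm: "nrm X (\<lambda>t. \<Omega> x t - v t * \<Omega> x t) = 0"
proof -
  define w where "w t = 1 - v t" for t
  have w: "w \<in> borel_measurable M" unfolding w_def using v(1) by measurable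
  have w1: "cmod (w t) \<le> 1" for t using v(2)[of t] by (auto simp: w_def)
  let ?H = "\<lambda>z t. w t * B x z t"
  have H: "?H \<in> \<H>" by (intro calderon_multiplier B_calderon x w w1)
  have zero: "AE t in M. ?H z t = 0" if z: "z \<in> strip" for z
    using supp B_supp[OF x z] by eventually_elim (auto simp: w_def)
  have "has_deriv_in E ?H (\<lambda>t. w t * \<Omega> x t) (of_real \<theta>)"
    by (intro has_deriv_in_multiplier[OF solidE open_interior \<theta>_interior] \<Omega> x w w1
        calderon_elems_interior B_calderon)
  from null_deriv_elems[OF H zero this] null_deriv_nrm[OF H zero this]
  show "(\<lambda>t. \<Omega> x t - v t * \<Omega> x t) \<in> elems X" "nrm X (\<lambda>t. \<Omega> x t - v t * \<Omega> x t) = 0"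
    by (simp_all add: w_def left_diff_distrib)
qed

text \<open>With \<open>M0\<close> and \<open>M1\<close> the two values of \<open>M_fun\<close>,
  both \<open>exp (- L * \<theta>) * M0\<close> and \<open>exp (L * (1 - \<theta>)) * M1\<close>
  equal \<open>P\<close>. The weighted sum therefore has norm at most \<open>C * P\<close>, and so
  does \<open>\<Sum> x i\<close> in \<open>X\<close>; applying \<open>B\<close> to that sum costs a
  further factor \<open>C\<close>. Together these give \<open>C * C + C\<close>, and
  \<open>deriv_at_zero_in_interp\<close> with its norm bound finishes.\<close>

lemma
  fixes n :: nat
  assumes x: "\<And>i. i < n \<Longrightarrow> x i \<in> elems X" and x1: "\<And>i. i < n \<Longrightarrow> nrm X (x i) \<le> 1"
    and disj: "\<And>i j. i < n \<Longrightarrow> j < n \<Longrightarrow> i \<noteq> j \<Longrightarrow> disjoint_supp M (x i) (x j)"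
    and pos: "0 < M_fun M X0 n" "0 < M_fun M X1 n"
  defines "L \<equiv> ln (M_fun M X0 n) - ln (M_fun M X1 n)"
    and "P \<equiv> M_fun M X0 n powr (1 - \<theta>) * M_fun M X1 n powr \<theta>"
  defines "d \<equiv> \<lambda>t. \<Omega> (\<lambda>s. \<Sum>i<n. x i s) t - (\<Sum>i<n. \<Omega> (x i) t)
        - of_real L * (\<Sum>i<n. x i t)"
  shows log_derivation_elems: "d \<in> elems X"
    and log_derivation_nrm: "nrm X d \<le> (C * C + C) / min \<theta> (1 - \<theta>) * P"
proof -
  define s where "s t = (\<Sum>i<n. x i t)" for t
  have s: "s \<in> elems X" unfolding s_def by (rule seminormed_sum[OF semiX]) (simp_all add: x)
  define G where "G z t = (\<Sum>i<n. B (x i) z t)" for z t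
  have G: "G \<in> \<H>" unfolding G_def by (rule calderon_sum) (auto intro: B_calderon x)
  have G\<theta>: "AE t in M. G (of_real \<theta>) t = s t"
  proof -
    have "AE t in M. \<forall>i\<in>{..<n}. B (x i) (of_real \<theta>) t = x i t"
      by (intro AE_finite_allI) (auto intro: B_at_theta x)
    then show ?thesis by eventually_elim (simp add: G_def s_def)
  qed
  have dG: "has_deriv_in E G (\<lambda>t. \<Sum>i<n. \<Omega> (x i) t) (of_real \<theta>)"
    unfolding G_def
    by (rule has_deriv_in_sum[OF semiE open_interior \<theta>_interior])
      (auto intro: \<Omega> x calderon_elems_interior B_calderon)
  \<comment> \<open>Since \<open>B\<close> does not enlarge supports, the boundary values remain
    disjoint, and \<open>M_fun\<close> of the endpoint spaces controls their sums.\<close>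
  have disjB: "disjoint_supp M (B (x i) z) (B (x j) z)"
    if "i < n" "j < n" "i \<noteq> j" "z \<in> strip" for i j z
    using disj[OF that(1-3)] B_supp[OF x[OF that(1)] that(4)] B_supp[OF x[OF that(2)] that(4)]
    unfolding disjoint_supp_def by eventually_elim auto
  have bd: "Complex 0 r \<in> strip" "Complex 1 r \<in> strip" for r by (auto simp: strip_def)
  have BC: "\<H>_norm (B (x i)) \<le> C" if "i < n" for i
    using C(2)[OF x[OF that]] mult_left_mono[OF x1[OF that], of C] C(1) by linarith
  have G0: "nrm X0 (G (Complex 0 r)) \<le> C * M_fun M X0 n" for r
    unfolding G_def
    by (rule nrm_sum_le_mult_M_fun[OF semi0 _ _ C(1)])
      (auto intro: calderon_elems0 B_calderon x disjB bd order_trans[OF calderon_norm_ge0 BC])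
  have G1: "nrm X1 (G (Complex 1 r)) \<le> C * M_fun M X1 n" for r
    unfolding G_def
    by (rule nrm_sum_le_mult_M_fun[OF semi1 _ _ C(1)])
      (auto intro: calderon_elems1 B_calderon x disjB bd order_trans[OF calderon_norm_ge1 BC])
  \<comment> \<open>The minus sign turns the difference from \<open>B s\<close> into a sum. At
    \<open>\<theta>\<close> the value is -1 and the derivative \<open>- L\<close>, which produces
    the term with \<open>L\<close> in \<open>d\<close>.\<close>
  define f :: "complex \<Rightarrow> complex" where "f z = - exp (of_real L * (z - of_real \<theta>))" for z
  have f_norm: "cmod (f z) = exp (L * (Re z - \<theta>))" for z
    by (simp add: f_def)
  have f\<theta>: "f (of_real \<theta>) = -1" by (simp add: f_def)
  have f': "(f has_field_derivative - of_real L * exp (of_real L * (z - of_real \<theta>))) (at z)" for z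
    unfolding f_def by (auto intro!: derivative_eq_intros)
  have fG: "(\<lambda>z t. f z * G z t) \<in> \<H>"
  proof (rule calderon_mult[OF G])
    show "continuous_on strip f" unfolding f_def by (intro continuous_intros)
    show "f field_differentiable at z" for z using f' unfolding field_differentiable_def by blast
    show "cmod (f z) \<le> exp \<bar>L\<bar>" if "z \<in> strip" for z
    proof -
      have "\<bar>Re z - \<theta>\<bar> \<le> 1" using that \<theta> by (auto simp: strip_def abs_le_iff)
      then have "\<bar>L\<bar> * \<bar>Re z - \<theta>\<bar> \<le> \<bar>L\<bar> * 1" by (rule mult_left_mono) simp
      then have "L * (Re z - \<theta>) \<le> \<bar>L\<bar>" using abs_ge_self[of "L * (Re z - \<theta>)"] by (simp add: abs_mult)
      then show ?thesis by (simp add: f_norm)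
    qed
  qed

  have P: "P = exp ((1 - \<theta>) * ln (M_fun M X0 n) + \<theta> * ln (M_fun M X1 n))"
    using pos by (simp add: P_def powr_def exp_add)
  have fG_norm: "\<H>_norm (\<lambda>z t. f z * G z t) \<le> C * P"
  proof (rule calderon_norm_leI)
    fix r
    have "cmod (f (Complex 0 r)) * nrm X0 (G (Complex 0 r)) \<le> exp (L * (0 - \<theta>)) * (C * M_fun M X0 n)"
      using G0[of r] by (simp add: f_norm mult_left_mono)
    also have "\<dots> = C * (exp (L * (0 - \<theta>)) * exp (ln (M_fun M X0 n)))" using pos by simp
    also have "\<dots> = C * P"
      unfolding P exp_add[symmetric] by (simp add: L_def algebra_simps)
    finally show "nrm X0 (\<lambda>t. f (Complex 0 r) * G (Complex 0 r) t) \<le> C * P"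
      unfolding nrm_scale[OF semi0 calderon_elems0[OF G]] .
    have "cmod (f (Complex 1 r)) * nrm X1 (G (Complex 1 r)) \<le> exp (L * (1 - \<theta>)) * (C * M_fun M X1 n)"
      using G1[of r] by (simp add: f_norm mult_left_mono)
    also have "\<dots> = C * (exp (L * (1 - \<theta>)) * exp (ln (M_fun M X1 n)))" using pos by simp
    also have "\<dots> = C * P"
      unfolding P exp_add[symmetric] by (simp add: L_def algebra_simps)
    finally show "nrm X1 (\<lambda>t. f (Complex 1 r) * G (Complex 1 r) t) \<le> C * P"
      unfolding nrm_scale[OF semi1 calderon_elems1[OF G]] .
  qed
  \<comment> \<open>The weighted sum is itself a lifting of \<open>- s\<close>, so it also bounds
    the norm of \<open>s\<close>.\<close>
  have "nrm X (\<lambda>t. - s t) \<le> \<H>_norm (\<lambda>z t. f z * G z t)"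
    by (rule interp_nrm_le[OF fG]) (use G\<theta> in \<open>auto simp: f\<theta> elim: eventually_mono\<close>)
  then have s_norm: "nrm X s \<le> C * P" using fG_norm nrm_uminus[OF semiX s] by simp
  let ?H = "\<lambda>z t. B s z t + f z * G z t"
  have H: "?H \<in> \<H>" by (rule calderon_add[OF B_calderon[OF s] fG])
  have "\<H>_norm ?H \<le> C * nrm X s + C * P"
    using calderon_norm_add[OF B_calderon[OF s] fG] C(2)[OF s] fG_norm by linarith
  also have "\<dots> \<le> C * (C * P) + C * P" using s_norm C(1) by simp
  finally have H_norm: "\<H>_norm ?H \<le> (C * C + C) * P" by (simp add: algebra_simps)
  have H0: "AE t in M. ?H (of_real \<theta>) t = 0"
    using B_at_theta[OF s] G\<theta> by eventually_elim (simp add: f\<theta>)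
  have dfG: "has_deriv_in E (\<lambda>z t. f z * G z t)
      (\<lambda>t. f (of_real \<theta>) * (\<Sum>i<n. \<Omega> (x i) t) + - of_real L * G (of_real \<theta>) t) (of_real \<theta>)"
    using f'[of "of_real \<theta>"]
    by (intro has_deriv_in_mult[OF semiE open_interior \<theta>_interior _ dG] calderon_elems_interior[OF G])
      simp_all
  have dH: "has_deriv_in E ?H (\<lambda>t. \<Omega> s t +
      (f (of_real \<theta>) * (\<Sum>i<n. \<Omega> (x i) t) + - of_real L * G (of_real \<theta>) t)) (of_real \<theta>)"
    by (rule has_deriv_in_add[OF semiE open_interior \<theta>_interior _ _ \<Omega>[OF s] dfG])
      (auto intro: calderon_elems_interior B_calderon s fG)
  have "d = (\<lambda>t. \<Omega> s t - (\<Sum>i<n. \<Omega> (x i) t) - of_real L * s t)"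
    by (simp add: d_def s_def[abs_def])
  moreover have "(\<lambda>t. \<Sum>i<n. \<Omega> (x i) t) \<in> borel_measurable M"
    by (intro borel_measurable_sum \<Omega>_measurable x) simp
  ultimately have d_meas: "d \<in> borel_measurable M"
    using \<Omega>_measurable[OF s] X_measurable[OF s] by simp
  have d_eq: "AE t in M. d t = \<Omega> s t +
      (f (of_real \<theta>) * (\<Sum>i<n. \<Omega> (x i) t) + - of_real L * G (of_real \<theta>) t)"
    using G\<theta> by eventually_elim (simp add: d_def f\<theta> s_def[abs_def])
  note dX = deriv_at_zero_in_interp[OF H H0 dH]
  show "d \<in> elems X" by (rule solid_AE_eq[OF solidX dX d_meas d_eq])
  have "nrm X d \<le> \<H>_norm ?H / min \<theta> (1 - \<theta>)"
    unfolding nrm_AE_eq[OF solidX dX d_meas d_eq] by (rule nrm_deriv_at_zero_le[OF H H0 dH])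
  also have "\<dots> \<le> (C * C + C) * P / min \<theta> (1 - \<theta>)"
    using H_norm \<theta> by (intro divide_right_mono) auto
  finally show "nrm X d \<le> (C * C + C) / min \<theta> (1 - \<theta>) * P" by simp
qed

text \<open>Averaging \<open>\<Omega> - l\<close> over all sign changes of the \<open>x i\<close> replaces each \<open>l (x i)\<close> by its
  restriction to the support of \<open>x i\<close>, without increasing the norm.\<close>

lemma
  fixes n :: nat
  assumes l: "linear_into_L0 M W l"
    and W: "W \<subseteq> elems X" "(\<lambda>_. 0) \<in> W"
      "\<And>f g. f \<in> W \<Longrightarrow> g \<in> W \<Longrightarrow> (\<lambda>t. f t + g t) \<in> W" "\<And>c f. f \<in> W \<Longrightarrow> (\<lambda>t. c * f t) \<in> W"
    and triv: "\<And>x. x \<in> W \<Longrightarrow>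
      (\<lambda>t. \<Omega> x t - l x t) \<in> elems X \<and> nrm X (\<lambda>t. \<Omega> x t - l x t) \<le> D * nrm X x"
    and D: "0 < D"
    and x: "\<And>i. i < n \<Longrightarrow> x i \<in> W" and x1: "\<And>i. i < n \<Longrightarrow> nrm X (x i) \<le> 1"
    and disj: "\<And>i j. i < n \<Longrightarrow> j < n \<Longrightarrow> i \<noteq> j \<Longrightarrow> disjoint_supp M (x i) (x j)"
  defines "d \<equiv> \<lambda>t. \<Omega> (\<lambda>s. \<Sum>i<n. x i s) t - (\<Sum>i<n. \<Omega> (x i) t)"
  shows trivial_derivation_elems: "d \<in> elems X"
    and trivial_derivation_nrm: "nrm X d \<le> 2 * D * M_fun M X n"
proof -
  define s where "s t = (\<Sum>i<n. x i t)" for t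
  define y where "y S t = (\<Sum>i<n. set_sign S i * x i t)" for S t
  define u where "u S = sign_multiplier x n S" for S
  define v where "v = first_support x"
  note xX = subsetD[OF W(1) x]
  have s: "s \<in> elems X" unfolding s_def by (rule seminormed_sum[OF semiX]) (simp_all add: xX)
  have "y S \<in> W \<and> (AE t in M. l (y S) t = (\<Sum>i<n. set_sign S i * l (x i) t))" for S
    unfolding y_def[abs_def] by (rule linear_into_L0_sum[OF l W(2)]) (rule W(3,4) x; assumption)+
  then have y: "y S \<in> W" "AE t in M. l (y S) t = (\<Sum>i<n. set_sign S i * l (x i) t)" for S
    by simp_all
  note yX = subsetD[OF W(1) y(1)]
  have v: "v i \<in> borel_measurable M" if "i < n" for i
    unfolding v_def using that by (intro first_support_measurable X_measurable xX) simp
  have v01: "v i t \<in> {0, 1}" for i t by (simp add: v_def first_support_values)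
  then have v1: "cmod (v i t) \<le> 1" for i t by (metis insertE norm_one norm_zero order_refl singletonD zero_le_one)
  have u: "u S \<in> borel_measurable M" "u S t \<in> {-1, 1}" for S t
    unfolding u_def
    by (rule sign_multiplier_measurable[OF X_measurable[OF xX]], assumption)
      (rule sign_multiplier_values)
  then have u1: "cmod (u S t) \<le> 1" for S t
    by (metis insertE norm_minus_cancel norm_one order_refl singletonD)
  have supp: "AE t in M. \<forall>i<n. x i t = 0 \<or> v i t = 1"
    unfolding v_def by (rule AE_first_support[OF disj])
  have ys: "AE t in M. y S t = u S t * s t" for S
    using supp unfolding v_def y_def s_def u_def by eventually_elim (rule sign_multiplier_mult)
  have y_norm: "nrm X (y S) \<le> nrm X s" for S
    using nrm_AE_eq[OF solidX solid_multiplier[OF solidX s u(1) u1] X_measurable[OF yX] ys]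
      nrm_multiplier[OF solidX s u(1) u1, of S] by simp
  \<comment> \<open>\<open>w S\<close> is the bounded error of \<open>l\<close> at the signed sum
    \<open>y S\<close>; \<open>r S\<close>, the failure of \<open>\<Omega>\<close> to commute with
    the sign change, has seminorm 0.\<close>
  define w r where "w S t = \<Omega> (y S) t - l (y S) t" and "r S t = \<Omega> (y S) t - u S t * \<Omega> s t" for S t
  have w: "w S \<in> elems X" "nrm X (w S) \<le> D * nrm X s" for S
    using triv[OF y(1), of S] order_trans[OF _ mult_left_mono[OF y_norm[of S] less_imp_le[OF D]]]
    unfolding w_def by blast+
  have r: "r S \<in> elems X" "nrm X (r S) = 0" for S
    unfolding r_def
    by (rule \<Omega>_sign_elems[OF s yX u ys]) (rule \<Omega>_sign_nrm[OF s yX u ys])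
  \<comment> \<open>Since \<open>u S * u S = 1\<close>, undoing the sign change leaves
    \<open>\<Omega> s\<close> with coefficient 1 for every \<open>S\<close>; only the part involving
    \<open>l\<close> still depends on the signs.\<close>
  define p where "p S t = u S t * (w S t - r S t)" for S t
  have wr: "(\<lambda>t. w S t - r S t) \<in> elems X" "nrm X (\<lambda>t. w S t - r S t) \<le> D * nrm X s" for S
    using seminormed_diff[OF semiX w(1) r(1)] nrm_triangle_diff[OF semiX w(1) r(1), of S S] w(2)[of S] r(2)[of S]
    by auto
  have p: "p S \<in> elems X" "nrm X (p S) \<le> D * nrm X s" for S
    unfolding p_def
    using solid_multiplier[OF solidX wr(1) u(1) u1] nrm_multiplier[OF solidX wr(1) u(1) u1]
      order_trans wr(2) by blast+
  have p_eq: "AE t in M. p S t = \<Omega> s t - u S t * (\<Sum>i<n. set_sign S i * l (x i) t)" for S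
    using y(2)[of S]
  proof eventually_elim
    case (elim t)
    have "u S t * u S t = 1" using u(2)[of S t] by auto
    then show ?case
      unfolding p_def w_def r_def elim[symmetric] by (simp add: algebra_simps mult.assoc[symmetric])
  qed
  \<comment> \<open>The mean over all sign patterns: the norm bound persists by convexity, and
    orthogonality leaves \<open>l (x i)\<close> only on the piece of \<open>x i\<close>.\<close>
  define avg where "avg t = 1 / 2 ^ n * (\<Sum>S\<in>Pow {..<n}. p S t)" for t
  have sum_p: "(\<lambda>t. \<Sum>S\<in>Pow {..<n}. p S t) \<in> elems X"
    by (rule seminormed_sum[OF semiX]) (simp_all add: p)
  have avg: "avg \<in> elems X" unfolding avg_def by (rule seminormed_scale[OF semiX sum_p])
  have "nrm X avg = 1 / 2 ^ n * nrm X (\<lambda>t. \<Sum>S\<in>Pow {..<n}. p S t)"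
    unfolding avg_def nrm_scale[OF semiX sum_p] by (simp add: norm_divide norm_power)
  also have "\<dots> \<le> 1 / 2 ^ n * (\<Sum>S\<in>Pow {..<n}. D * nrm X s)"
    by (intro mult_left_mono order_trans[OF nrm_sum_le[OF semiX] sum_mono] p) simp_all
  also have "\<dots> = D * nrm X s" by (simp add: card_Pow)
  also have "\<dots> \<le> D * M_fun M X n"
    unfolding s_def using D by (intro mult_left_mono nrm_sum_le_M_fun[OF semiX xX disj x1]) auto
  finally have avg_norm: "nrm X avg \<le> D * M_fun M X n" .
  have avg_eq: "AE t in M. avg t = \<Omega> s t - (\<Sum>i<n. v i t * l (x i) t)"
  proof -
    have "AE t in M. \<forall>S\<in>Pow {..<n}. p S t = \<Omega> s t - u S t * (\<Sum>i<n. set_sign S i * l (x i) t)"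
      by (intro AE_finite_allI p_eq) simp
    then show ?thesis
    proof eventually_elim
      case (elim t)
      have "(\<Sum>S\<in>Pow {..<n}. p S t)
          = (\<Sum>S\<in>Pow {..<n}. \<Omega> s t - u S t * (\<Sum>i<n. set_sign S i * l (x i) t))"
        using elim by (intro sum.cong) auto
      also have "\<dots> = 2 ^ n * \<Omega> s t - 2 ^ n * (\<Sum>i<n. v i t * l (x i) t)"
        unfolding u_def v_def sum_subtractf sum_sign_multiplier by (simp add: card_Pow)
      finally show ?case by (simp add: avg_def right_diff_distrib)
    qed
  qed
  \<comment> \<open>\<open>b i\<close> is the error at \<open>x i\<close> cut down to its own piece,
    and \<open>q i\<close> is what \<open>\<Omega> (x i)\<close> has off that piece, of seminorm 0.
    The \<open>b i\<close> are disjoint, so their sum costs a second \<open>D * M_fun M X n\<close>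
    besides that of \<open>avg\<close>.\<close>
  define b q where "b i t = v i t * (\<Omega> (x i) t - l (x i) t)" and "q i t = \<Omega> (x i) t - v i t * \<Omega> (x i) t"
    for i t
  have b: "b i \<in> elems X" "nrm X (b i) \<le> D" if i: "i < n" for i
  proof -
    note t = triv[OF x[OF i]]
    show "b i \<in> elems X"
      unfolding b_def using solid_multiplier[OF solidX _ v[OF i] v1] t by blast
    have "nrm X (b i) \<le> D * nrm X (x i)"
      unfolding b_def using nrm_multiplier[OF solidX _ v[OF i] v1] t order_trans by blast
    also have "\<dots> \<le> D" using x1[OF i] D by (simp add: mult_left_le)
    finally show "nrm X (b i) \<le> D" .
  qed
  have b_disj: "disjoint_supp M (b i) (b j)" if "i \<noteq> j" for i j
  proof -
    have "v i t = 0 \<or> v j t = 0" for t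
      using that by (cases i j rule: linorder_cases) (auto simp: v_def first_support_values)
    then have "b i t = 0 \<or> b j t = 0" for t by (auto simp: b_def)
    then show ?thesis unfolding disjoint_supp_def by simp
  qed
  have q: "q i \<in> elems X" "nrm X (q i) = 0" if i: "i < n" for i
  proof -
    have "AE t in M. x i t = 0 \<or> v i t = 1" using supp i by (auto elim: eventually_mono)
    then show "q i \<in> elems X" "nrm X (q i) = 0"
      unfolding q_def using \<Omega>_supp_elems[OF xX[OF i] v[OF i] v01] \<Omega>_supp_nrm[OF xX[OF i] v[OF i] v01] by blast+
  qed
  have sb: "(\<lambda>t. \<Sum>i<n. b i t) \<in> elems X" and sq: "(\<lambda>t. \<Sum>i<n. q i t) \<in> elems X"
    by (rule seminormed_sum[OF semiX]; simp add: b q)+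
  have sb_norm: "nrm X (\<lambda>t. \<Sum>i<n. b i t) \<le> D * M_fun M X n"
    by (rule nrm_sum_le_mult_M_fun[OF semiX b(1) b_disj D b(2)])
  have "nrm X (\<lambda>t. \<Sum>i<n. q i t) \<le> (\<Sum>i<n. nrm X (q i))"
    by (rule nrm_sum_le[OF semiX]) (simp_all add: q)
  also have "\<dots> = 0" using q(2) by simp
  finally have sq_norm: "nrm X (\<lambda>t. \<Sum>i<n. q i t) \<le> 0" .
  note sbq = seminormed_add[OF semiX sb sq]
  note e = seminormed_diff[OF semiX avg sbq]
  have d_eq: "AE t in M. d t = avg t - ((\<Sum>i<n. b i t) + (\<Sum>i<n. q i t))"
    using avg_eq
  proof eventually_elim
    case (elim t)
    have "(\<Sum>i<n. b i t) + (\<Sum>i<n. q i t) = (\<Sum>i<n. \<Omega> (x i) t - v i t * l (x i) t)"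
      unfolding sum.distrib[symmetric] by (rule sum.cong) (auto simp: b_def q_def right_diff_distrib)
    then show ?case unfolding elim by (simp add: d_def s_def[abs_def] sum_subtractf)
  qed
  have "(\<lambda>t. \<Sum>i<n. \<Omega> (x i) t) \<in> borel_measurable M"
    by (intro borel_measurable_sum \<Omega>_measurable xX) simp
  then have d_meas: "d \<in> borel_measurable M"
    using \<Omega>_measurable[OF s] by (simp add: d_def s_def[abs_def])
  show "d \<in> elems X" by (rule solid_AE_eq[OF solidX e d_meas d_eq])
  show "nrm X d \<le> 2 * D * M_fun M X n"
    unfolding nrm_AE_eq[OF solidX e d_meas d_eq]
    using nrm_triangle_diff[OF semiX avg sbq] seminormed_triangle[OF semiX sb sq]
      avg_norm sb_norm sq_norm by simp
qed

text \<open>The vector \<open>\<Omega> (\<Sum> x i) - \<Sum> \<Omega> (x i)\<close> is small by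
  triviality, and it is close to \<open>L * \<Sum> x i\<close> by interpolation. Subtracting leaves
  \<open>L * \<Sum> x i\<close>, whose norm is then maximised over disjoint \<open>x i\<close> in
  the span.\<close>

lemma log_M_fun_ratio_bound:
  fixes n :: nat
  assumes e: "\<And>i. e i \<in> elems X"
    and l: "linear_into_L0 M (elems (closed_span X e)) l"
    and triv: "\<And>x. x \<in> elems (closed_span X e) \<Longrightarrow>
      (\<lambda>t. \<Omega> x t - l x t) \<in> elems X \<and> nrm X (\<lambda>t. \<Omega> x t - l x t) \<le> D * nrm X x"
    and D: "0 < D" and pos: "0 < M_fun M X0 n" "0 < M_fun M X1 n"
  shows "\<bar>ln (M_fun M X0 n) - ln (M_fun M X1 n)\<bar> * M_fun M (closed_span X e) n
    \<le> 2 * D * M_fun M X n + (C * C + C) / min \<theta> (1 - \<theta>)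
        * (M_fun M X0 n powr (1 - \<theta>) * M_fun M X1 n powr \<theta>)"
proof -
  let ?W = "closed_span X e"
  define L where "L = ln (M_fun M X0 n) - ln (M_fun M X1 n)"
  define A where "A = 2 * D * M_fun M X n + (C * C + C) / min \<theta> (1 - \<theta>)
        * (M_fun M X0 n powr (1 - \<theta>) * M_fun M X1 n powr \<theta>)"
  note SW = closed_span_seminormed[where e=e, OF semiX e]
  have WX: "elems ?W \<subseteq> elems X" using elems_closed_span_subset by blast
  have bound: "\<bar>L\<bar> * nrm X (\<lambda>t. \<Sum>i<n. x i t) \<le> A"
    if x: "\<And>i. i < n \<Longrightarrow> x i \<in> elems ?W" and x1: "\<And>i. i < n \<Longrightarrow> nrm X (x i) \<le> 1"
      and disj: "\<And>i j. i < n \<Longrightarrow> j < n \<Longrightarrow> i \<noteq> j \<Longrightarrow> disjoint_supp M (x i) (x j)" for x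
  proof -
    define a where "a t = \<Omega> (\<lambda>s. \<Sum>i<n. x i s) t - (\<Sum>i<n. \<Omega> (x i) t)" for t
    define b where "b t = a t - of_real L * (\<Sum>i<n. x i t)" for t
    note xX = subsetD[OF WX x]
    have sX: "(\<lambda>t. \<Sum>i<n. x i t) \<in> elems X" by (rule seminormed_sum[OF semiX]) (simp_all add: xX)
    have a: "a \<in> elems X" "nrm X a \<le> 2 * D * M_fun M X n"
      unfolding a_def
      by (rule trivial_derivation_elems[OF l WX seminormed_zero[OF SW] seminormed_add[OF SW]
            seminormed_scale[OF SW] triv D x x1 disj]; assumption)
        (rule trivial_derivation_nrm[OF l WX seminormed_zero[OF SW] seminormed_add[OF SW]
            seminormed_scale[OF SW] triv D x x1 disj]; assumption)
    have b: "b \<in> elems X" "nrm X b \<le> (C * C + C) / min \<theta> (1 - \<theta>)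
        * (M_fun M X0 n powr (1 - \<theta>) * M_fun M X1 n powr \<theta>)"
      unfolding b_def a_def L_def
      by (rule log_derivation_elems[OF xX x1 disj pos]; assumption)
        (rule log_derivation_nrm[OF xX x1 disj pos]; assumption)
    have "(\<lambda>t. a t - b t) = (\<lambda>t. of_real L * (\<Sum>i<n. x i t))" by (simp add: b_def)
    then have "\<bar>L\<bar> * nrm X (\<lambda>t. \<Sum>i<n. x i t) = nrm X (\<lambda>t. a t - b t)"
      using nrm_scale[OF semiX sX, of "of_real L"] by simp
    also have "\<dots> \<le> nrm X a + nrm X b" by (rule nrm_triangle_diff[OF semiX a(1) b(1)])
    finally show ?thesis using a(2) b(2) by (simp add: A_def)
  qed
  have "\<bar>L\<bar> * M_fun M ?W n \<le> A"
  \<comment> \<open>Passing to the supremum divides by the modulus of \<open>L\<close>. For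
    \<open>L = 0\<close> only \<open>0 \<le> A\<close> is left, which is \<open>bound\<close> at
    zero vectors.\<close>
  proof (cases "L = 0")
    case True
    then show ?thesis
      using bound[of "\<lambda>_ _. 0"] nrm_zero[OF semiX] seminormed_zero[OF SW] by (simp add: disjoint_supp_def)
  next
    case False
    have "M_fun M ?W n \<le> A / \<bar>L\<bar>"
    proof (rule M_fun_leI[OF SW])
      fix x assume "\<And>i. i < n \<Longrightarrow> x i \<in> elems ?W \<and> nrm ?W (x i) \<le> 1"
        and "\<And>i j. i < n \<Longrightarrow> j < n \<Longrightarrow> i \<noteq> j \<Longrightarrow> disjoint_supp M (x i) (x j)"
      then have "\<bar>L\<bar> * nrm X (\<lambda>t. \<Sum>i<n. x i t) \<le> A"
        by (intro bound) (simp_all add: nrm_closed_span)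
      then show "nrm ?W (\<lambda>t. \<Sum>i<n. x i t) \<le> A / \<bar>L\<bar>"
        using False by (simp add: nrm_closed_span field_simps)
    qed
    then show ?thesis using False by (simp add: field_simps)
  qed
  then show ?thesis by (simp add: A_def L_def)
qed

end

section \<open>Equivalence of sequences and conclusion\<close>

lemma equivalent_seq_lower_bound:
  assumes "equivalent_seq f g"
  obtains c where "0 < c" "\<forall>\<^sub>F n in sequentially. c < f n / g n"
proof -
  obtain c where c: "0 < ereal c" "ereal c < liminf (\<lambda>n. ereal (f n / g n))"
    using assms ereal_dense2[of 0] unfolding equivalent_seq_def by blast
  show thesis using that[of c] c(1) less_LiminfD[OF c(2)] by simp
qed

lemma equivalent_seqI:
  assumes "0 < c" "\<forall>\<^sub>F n in sequentially. c \<le> f n / g n \<and> f n / g n \<le> C"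
  shows "equivalent_seq f g"
  unfolding equivalent_seq_def
proof
  have "ereal c \<le> liminf (\<lambda>n. ereal (f n / g n))"
    by (rule Liminf_bounded) (use assms(2) in \<open>auto elim: eventually_mono\<close>)
  then show "0 < liminf (\<lambda>n. ereal (f n / g n))"
    using assms(1) by (meson ereal_less(2) less_le_trans)
  have "limsup (\<lambda>n. ereal (f n / g n)) \<le> ereal C"
    by (rule Limsup_bounded) (use assms(2) in \<open>auto elim: eventually_mono\<close>)
  then show "limsup (\<lambda>n. ereal (f n / g n)) < \<infinity>" by (rule order_le_less_trans) simp
qed

lemma equivalent_seq_if_log_bounded:
  fixes f g :: "nat \<Rightarrow> real"
  assumes "\<forall>\<^sub>F n in sequentially. 0 < f n \<and> 0 < g n \<and> \<bar>ln (f n) - ln (g n)\<bar> \<le> K"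
  shows "equivalent_seq f g"
proof (rule equivalent_seqI)
  show "\<forall>\<^sub>F n in sequentially. exp (- K) \<le> f n / g n \<and> f n / g n \<le> exp K"
    using assms
  proof eventually_elim
    case (elim n)
    then have "f n / g n = exp (ln (f n) - ln (g n))" by (simp add: exp_diff)
    then show ?case using elim by (simp add: abs_le_iff)
  qed
qed simp

theorem proposition5p2:
  fixes M :: "'a measure" and X0 X1 :: "'a fspace" and \<theta> :: real
    and \<Omega> :: "('a \<Rightarrow> complex) \<Rightarrow> 'a \<Rightarrow> complex"
  assumes "sigma_finite_measure M"
    and "kothe_space M X0" and "kothe_space M X1"
    and "\<not> equivalent_seq (M_fun M X0) (M_fun M X1)"
    and "0 < \<theta>" and "\<theta> < 1"
    and "reflexive_space (interp_space M X0 X1 \<theta>)"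
    and "self_similar M (interp_space M X0 X1 \<theta>)"
    and "equivalent_seq (M_fun M (interp_space M X0 X1 \<theta>))
           (\<lambda>n. M_fun M X0 n powr (1 - \<theta>) * M_fun M X1 n powr \<theta>)"
    and "induced_centralizer M X0 X1 \<theta> \<Omega>"
  shows "disjointly_singular M (interp_space M X0 X1 \<theta>) \<Omega>"
  unfolding disjointly_singular_def
proof (intro allI impI notI)
  interpret interpolation_couple M X0 X1 \<theta>
    using assms(2,3,5,6) by unfold_locales
  fix e assume e: "disjoint_seq M X e" and trivial: "trivial_on M X \<Omega> (elems (closed_span X e))"
  obtain B where B: "admissible_selector M X0 X1 \<theta> B"
    and deriv: "\<And>x. x \<in> elems X \<Longrightarrow> has_deriv_in E (B x) (\<Omega> x) (of_real \<theta>)"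
    using assms(10) unfolding induced_centralizer_def by blast
  obtain C' where C': "\<And>x. x \<in> elems X \<Longrightarrow> \<H>_norm (B x) \<le> C' * nrm X x"
    using B unfolding admissible_selector_def Let_def by (elim conjE exE) blast
  define C where "C = max C' 1"
  have mono: "a * nrm X f \<le> max a 1 * nrm X f" if "f \<in> elems X" for a f
    by (intro mult_right_mono nrm_nonneg[OF semiX that]) simp
  interpret centralizer M X0 X1 \<theta> B \<Omega> C
  proof
    show "\<H>_norm (B x) \<le> C * nrm X x" if "x \<in> elems X" for x
      using C'[OF that] mono[OF that, of C'] by (simp add: C_def)
  qed (simp_all add: B deriv C_def)
  obtain l D' where l: "linear_into_L0 M (elems (closed_span X e)) l"
    and lD: "\<And>x. x \<in> elems (closed_span X e) \<Longrightarrow>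
      (\<lambda>t. \<Omega> x t - l x t) \<in> elems X \<and> nrm X (\<lambda>t. \<Omega> x t - l x t) \<le> D' * nrm X x"
    using trivial unfolding trivial_on_def by blast
  define D where "D = max D' 1"
  have D: "0 < D" by (simp add: D_def)
  have triv: "(\<lambda>t. \<Omega> x t - l x t) \<in> elems X \<and> nrm X (\<lambda>t. \<Omega> x t - l x t) \<le> D * nrm X x"
    if "x \<in> elems (closed_span X e)" for x
    using lD[OF that] mono[OF elems_closed_span_subset[OF that], of D'] unfolding D_def by linarith
  have eX: "\<And>i. e i \<in> elems X" using e unfolding disjoint_seq_def by blast
  define P where "P n = M_fun M X0 n powr (1 - \<theta>) * M_fun M X1 n powr \<theta>" for n
  obtain c where c: "0 < c" "\<forall>\<^sub>F n in sequentially. c < M_fun M X n / P n"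
    using equivalent_seq_lower_bound[OF assms(9)] unfolding P_def by blast
  have "equivalent_seq (M_fun M (closed_span X e)) (M_fun M X)"
    using assms(8) e unfolding self_similar_def by blast
  then obtain c' where c': "0 < c'"
      "\<forall>\<^sub>F n in sequentially. c' < M_fun M (closed_span X e) n / M_fun M X n"
    by (rule equivalent_seq_lower_bound)
  define K where "K = (C * C + C) / min \<theta> (1 - \<theta>)"
  have K: "0 \<le> K" using \<theta> by (simp add: K_def C_def)
  have "\<forall>\<^sub>F n in sequentially. 0 < M_fun M X0 n \<and> 0 < M_fun M X1 n \<and>
      \<bar>ln (M_fun M X0 n) - ln (M_fun M X1 n)\<bar> \<le> (2 * D + K / c) / c'"
    using c(2) c'(2)
  proof eventually_elim
    case (elim n)
    let ?m = "M_fun M X n" and ?w = "M_fun M (closed_span X e) n"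
    \<comment> \<open>A quotient with denominator 0 has value 0 and so cannot exceed
      \<open>c\<close> or \<open>c'\<close>; the eventual lower bounds thus exclude zero
      denominators.\<close>
    have P0: "P n \<noteq> 0" and m0: "?m \<noteq> 0" using elim c(1) c'(1) by auto
    have "0 \<le> M_fun M X0 n" "0 \<le> M_fun M X1 n" "0 \<le> ?m"
      by (rule M_fun_nonneg; rule semi0 semi1 semiX)+
    \<comment> \<open>As \<open>0 powr a = 0\<close>, a nonzero \<open>P n\<close> forces both of
      its factors to be positive, so the logarithms are meaningful.\<close>
    then have pos: "0 < M_fun M X0 n" "0 < M_fun M X1 n" "0 < ?m" "0 < P n"
      using P0 m0 by (auto simp: P_def less_le)
    have Pm: "P n \<le> ?m / c" and wm: "c' * ?m \<le> ?w"
      using elim c(1) pos by (simp_all add: field_simps)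
    let ?L = "\<bar>ln (M_fun M X0 n) - ln (M_fun M X1 n)\<bar>"
    \<comment> \<open>Self-similarity replaces \<open>?w\<close> by a multiple of \<open>?m\<close>,
      and the assumption on \<open>P\<close> does the same for \<open>P n\<close>. Each term is then
      a multiple of \<open>?m\<close>, which cancels and leaves a bound independent of
      \<open>n\<close>.\<close>
    have "?L * (c' * ?m) \<le> ?L * ?w" by (rule mult_left_mono[OF wm]) simp
    also have "\<dots> \<le> 2 * D * ?m + K * P n"
      using log_M_fun_ratio_bound[OF eX l triv D pos(1,2)] by (simp add: K_def P_def)
    also have "\<dots> \<le> 2 * D * ?m + K * (?m / c)" using mult_left_mono[OF Pm K] by simp
    also have "\<dots> = (2 * D + K / c) * ?m" by (simp add: algebra_simps)
    finally have "(?L * c') * ?m \<le> (2 * D + K / c) * ?m" by (simp add: mult.assoc)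
    then have "?L * c' \<le> 2 * D + K / c" using pos(3) by (rule mult_right_le_imp_le)
    then show ?case using pos(1,2) c'(1) by (simp add: pos_le_divide_eq)
  qed
  then have "equivalent_seq (M_fun M X0) (M_fun M X1)" by (rule equivalent_seq_if_log_bounded)
  with assms(4) show False by simp
qed

end
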